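(* Let $\otimes$ be either multiplication on $[0,1]$ or the Łukasiewicz tensor $u\otimes v=\max(0,u+v-1)$ on $[0,1]$. Consider the adjunction $C\dashv G$ with $C:\mathsf{PosComp}\to\mathsf{LaxMon}([0,1]\text{-}\mathsf{FinSup})^{\mathrm{op}}$ and $G:\mathsf{LaxMon}([0,1]\text{-}\mathsf{FinSup})^{\mathrm{op}}\to\mathsf{PosComp}$ induced by the dualising object $([0,1]^{\mathrm{op}},[0,1])$. Then the monad morphism $j$ from the Vietoris monad $\mathbb{V}$ on $\mathsf{PosComp}$ to the monad on $\mathsf{PosComp}$ induced by $C\dashv G$, with components $$j_X:VX\longrightarrow GCX,\quad A\longmapsto\Big(\Phi_A:CX\to[0,1],\ \psi\mapsto\sup_{x\in A}\psi(x)\Big),$$ is an isomorphism. Therefore the functor $$C:\mathsf{PosCompDist}\longrightarrow\mathsf{LaxMon}([0,1]\text{-}\mathsf{FinSup})^{\mathrm{op}},$$ which sends $X$ to $CX$ and a continuous distributor $\varphi$ from $X$ to $Y$ to the map $C\varphi:CY\to CX$, $(C\varphi)(\psi)(x)=\sup\{\psi(y)\mid x\,\varphi\,y\}$, is fully faithful.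
   Context: **Enriched categories.** Let $\otimes$ be the given tensor on $[0,1]$ (associative, commutative, with neutral element $1$, preserving suprema in each variable, continuous), and let $\hom(u,-)$ be the right adjoint of $u\otimes-$, i.e. $u\otimes v\le w\iff v\le\hom(u,w)$. Suprema of empty subsets of $[0,1]$ are $0$. A $[0,1]$-category is a set $X$ with a map $a:X\times X\to[0,1]$ with $a(x,x)=1$ and $a(x,y)\otimes a(y,z)\le a(x,z)$. A $[0,1]$-functor $f:(X,a)\to(Y,b)$ is a map with $a(x,y)\le b(f(x),f(y))$. The natural order is $x\le y\iff a(x,y)=1$; $(X,a)$ is separated if this order is anti-symmetric. A $u$-copower of $x$ is an element $x\otimes u$ with $a(x\otimes u,y)=\hom(u,a(x,y))$ for all $y$. $(X,a)$ is finitely cocomplete if it has all colimits of weighted diagrams with finite underlying set; equivalently, it has all copowers ($u\in[0,1]$), a bottom element, and all binary suprema in the natural order, with $a(x\vee y,z)=a(x,z)\wedge a(y,z)$ for all $z$. A map between finitely cocomplete $[0,1]$-categories is a finitely cocontinuous $[0,1]$-functor iff it is monotone and preserves copowers and binary suprema. $[0,1]\text{-}\mathsf{FinSup}$ is the category of separated finitely cocomplete $[0,1]$-categories and finitely cocontinuous $[0,1]$-functors. **Monoids.** Objects of $\mathsf{LaxMon}([0,1]\text{-}\mathsf{FinSup})$ are objects $X$ of $[0,1]\text{-}\mathsf{FinSup}$ with an associative commutative operation $\otimes:X\times X\to X$ whose unit is the top element $1$ of $X$, such that each $x\otimes-:X\to X$ is a finitely cocontinuous $[0,1]$-functor. Morphisms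 are finitely cocontinuous $[0,1]$-functors $f$ with $f(x\otimes x')\le f(x)\otimes f(x')$. The $[0,1]$-category $([0,1],\hom)$ with $\otimes$ is such an object. **Spaces.** A partially ordered compact space is a compact space $X$ with a partial order $\le$ that is closed in $X\times X$ (so $X$ is Hausdorff). $\mathsf{PosComp}$ is the category of these spaces and monotone continuous maps. $X^{\mathrm{op}}$ is $X$ with the dual order; $[0,1]$ has the Euclidean topology and usual order. $CX=\mathsf{PosComp}(X,[0,1]^{\mathrm{op}})$, i.e. the set of continuous order-reversing maps $X\to[0,1]$ (with $[0,1]$ usually ordered), with all operations ($\vee$, $-\otimes u$, $\otimes$, $0$, $1$) pointwise and structure $d(\psi_1,\psi_2)=\inf_x\hom(\psi_1(x),\psi_2(x))$. For $f:X\to Y$ in $\mathsf{PosComp}$, $Cf(\psi)=\psi\cdot f$. $GA$ is the set $\mathsf{LaxMon}([0,1]\text{-}\mathsf{FinSup})(A,[0,1])$ with the initial structure with respect to all evaluation maps $\mathrm{ev}_a:\Phi\mapsto\Phi(a)$ into $[0,1]^{\mathrm{op}}$ (topology of pointwise convergence, reversed pointwise order); $G$ acts on morphisms by precomposition, and the units of the adjunction are the evaluation maps. **Vietoris monad.** $VX$ is the set of closed upper subsets of $X$ (including $\varnothing$), ordered by $\supseteq$, with the topology generated by the sets $\{A\mid A\cap U\ne\varnothing\}$ ($U$ open lower) and $\{A\mid A\cap K=\varnothing\}$ ($K$ closed lower). $Vf(A)$ is the smallest closed upper set containing $f[A]$; the unit is $x\mapsto\{y\mid y\ge x\}$ and the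 multiplication is union. $\mathsf{PosCompDist}$ is the Kleisli category of $\mathbb{V}$: objects are partially ordered compact spaces; a morphism from $X$ to $Y$ (continuous distributor) is a relation $\varphi\subseteq X\times Y$ such that $x\mapsto\{y\mid x\,\varphi\,y\}$ is a morphism $X\to VY$ in $\mathsf{PosComp}$; composition is relational composition, and the identity on $X$ is $\le$. *)

theory Defs
  imports "HOL-Analysis.Analysis"
begin

text \<open>
  Structured sets live on a carrier inside a type; maps between them are elements of
  function spaces that are \<^const>\<open>extensional\<close> on the carrier of the domain, so that equality of
  HOL functions is equality of morphisms. The unit interval is the carrier \<open>{0..1}\<close> in
  the type of reals. Infima and suprema in it are written \<open>Inf (insert 1 S)\<close> and
  \<open>Sup (insert 0 S)\<close>, which give the right values \<open>1\<close> and \<open>0\<close> for empty \<open>S\<close>.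
\<close>

abbreviation id_map :: "'a set \<Rightarrow> 'a \<Rightarrow> 'a" where
  "id_map S \<equiv> (\<lambda>x\<in>S. x)"


section \<open>Tensors on the unit interval\<close>

type_synonym tensor = "real \<Rightarrow> real \<Rightarrow> real"

definition mult_tensor :: tensor where
  "mult_tensor u v = u * v"

definition lukasiewicz_tensor :: tensor where
  "lukasiewicz_tensor u v = max 0 (u + v - 1)"

text \<open>The right adjoint of \<open>t u\<close>, for \<open>t\<close> preserving suprema in its second argument.\<close>

definition ihom :: "tensor \<Rightarrow> real \<Rightarrow> real \<Rightarrow> real" where
  "ihom t u w = Sup {v \<in> {0..1}. t u v \<le> w}"


section \<open>Categories enriched in the unit interval\<close>

definition enriched_category :: "tensor \<Rightarrow> 'a set \<Rightarrow> ('a \<Rightarrow> 'a \<Rightarrow> real) \<Rightarrow> bool" where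
  "enriched_category t X a \<longleftrightarrow>
     (\<forall>x\<in>X. \<forall>y\<in>X. a x y \<in> {0..1}) \<and>
     (\<forall>x\<in>X. a x x = 1) \<and>
     (\<forall>x\<in>X. \<forall>y\<in>X. \<forall>z\<in>X. t (a x y) (a y z) \<le> a x z)"

definition enriched_functor ::
  "'a set \<Rightarrow> ('a \<Rightarrow> 'a \<Rightarrow> real) \<Rightarrow> 'b set \<Rightarrow> ('b \<Rightarrow> 'b \<Rightarrow> real) \<Rightarrow> ('a \<Rightarrow> 'b) \<Rightarrow> bool" where
  "enriched_functor X a Y b f \<longleftrightarrow>
     f \<in> X \<rightarrow> Y \<and> (\<forall>x\<in>X. \<forall>x'\<in>X. a x x' \<le> b (f x) (f x'))"

definition natural_le :: "('a \<Rightarrow> 'a \<Rightarrow> real) \<Rightarrow> 'a \<Rightarrow> 'a \<Rightarrow> bool" where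
  "natural_le a x y \<longleftrightarrow> a x y = 1"

definition separated :: "'a set \<Rightarrow> ('a \<Rightarrow> 'a \<Rightarrow> real) \<Rightarrow> bool" where
  "separated X a \<longleftrightarrow>
     (\<forall>x\<in>X. \<forall>y\<in>X. natural_le a x y \<and> natural_le a y x \<longrightarrow> x = y)"

text \<open>
  A finite weighted diagram in \<open>(X, a)\<close>: an enriched functor \<open>h\<close> from an enriched category
  \<open>(D, r)\<close> with finite underlying set, together with a weight, i.e. a distributor \<open>w\<close> from
  \<open>(D, r)\<close> to the one-point category. Every finite set is in bijection with a set of natural
  numbers, so taking \<open>D\<close> to be a set of natural numbers is no restriction; \<open>D\<close> may be empty.
\<close>

definition finite_weighted_diagram ::
  "tensor \<Rightarrow> 'a set \<Rightarrow> ('a \<Rightarrow> 'a \<Rightarrow> real) \<Rightarrow>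
   nat set \<Rightarrow> (nat \<Rightarrow> nat \<Rightarrow> real) \<Rightarrow> (nat \<Rightarrow> 'a) \<Rightarrow> (nat \<Rightarrow> real) \<Rightarrow> bool" where
  "finite_weighted_diagram t X a D r h w \<longleftrightarrow>
     finite D \<and> enriched_category t D r \<and> enriched_functor D r X a h \<and>
     w \<in> D \<rightarrow> {0..1} \<and> (\<forall>d\<in>D. \<forall>d'\<in>D. t (r d d') (w d') \<le> w d)"

definition is_colimit ::
  "tensor \<Rightarrow> 'a set \<Rightarrow> ('a \<Rightarrow> 'a \<Rightarrow> real) \<Rightarrow>
   nat set \<Rightarrow> (nat \<Rightarrow> 'a) \<Rightarrow> (nat \<Rightarrow> real) \<Rightarrow> 'a \<Rightarrow> bool" where
  "is_colimit t X a D h w c \<longleftrightarrow>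
     c \<in> X \<and> (\<forall>y\<in>X. a c y = Inf (insert 1 ((\<lambda>d. ihom t (w d) (a (h d) y)) ` D)))"

definition finitely_cocomplete :: "tensor \<Rightarrow> 'a set \<Rightarrow> ('a \<Rightarrow> 'a \<Rightarrow> real) \<Rightarrow> bool" where
  "finitely_cocomplete t X a \<longleftrightarrow>
     (\<forall>D r h w. finite_weighted_diagram t X a D r h w \<longrightarrow> (\<exists>c. is_colimit t X a D h w c))"

definition finitely_cocontinuous ::
  "tensor \<Rightarrow> 'a set \<Rightarrow> ('a \<Rightarrow> 'a \<Rightarrow> real) \<Rightarrow> 'b set \<Rightarrow> ('b \<Rightarrow> 'b \<Rightarrow> real) \<Rightarrow> ('a \<Rightarrow> 'b) \<Rightarrow> bool" where
  "finitely_cocontinuous t X a Y b f \<longleftrightarrow>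
     enriched_functor X a Y b f \<and>
     (\<forall>D r h w c. finite_weighted_diagram t X a D r h w \<and> is_colimit t X a D h w c \<longrightarrow>
        is_colimit t Y b D (\<lambda>d. f (h d)) w (f c))"


section \<open>Monoids with lax morphisms\<close>

record 'a enriched_monoid =
  elems :: "'a set"
  dist_of :: "'a \<Rightarrow> 'a \<Rightarrow> real"
  mult_of :: "'a \<Rightarrow> 'a \<Rightarrow> 'a"

definition laxmon :: "tensor \<Rightarrow> 'a enriched_monoid \<Rightarrow> bool" where
  "laxmon t A \<longleftrightarrow>
     enriched_category t (elems A) (dist_of A) \<and>
     separated (elems A) (dist_of A) \<and>
     finitely_cocomplete t (elems A) (dist_of A) \<and>
     (\<forall>x\<in>elems A. \<forall>y\<in>elems A. mult_of A x y \<in> elems A) \<and>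
     (\<forall>x\<in>elems A. \<forall>y\<in>elems A. \<forall>z\<in>elems A.
        mult_of A (mult_of A x y) z = mult_of A x (mult_of A y z)) \<and>
     (\<forall>x\<in>elems A. \<forall>y\<in>elems A. mult_of A x y = mult_of A y x) \<and>
     (\<exists>e\<in>elems A. (\<forall>x\<in>elems A. natural_le (dist_of A) x e) \<and> (\<forall>x\<in>elems A. mult_of A e x = x)) \<and>
     (\<forall>x\<in>elems A.
        finitely_cocontinuous t (elems A) (dist_of A) (elems A) (dist_of A) (mult_of A x))"

definition laxmon_hom ::
  "tensor \<Rightarrow> 'a enriched_monoid \<Rightarrow> 'b enriched_monoid \<Rightarrow> ('a \<Rightarrow> 'b) set" where
  "laxmon_hom t A B =
     {f \<in> elems A \<rightarrow>\<^sub>E elems B.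
        finitely_cocontinuous t (elems A) (dist_of A) (elems B) (dist_of B) f \<and>
        (\<forall>x\<in>elems A. \<forall>x'\<in>elems A.
           natural_le (dist_of B) (f (mult_of A x x')) (mult_of B (f x) (f x')))}"

definition unit_monoid :: "tensor \<Rightarrow> real enriched_monoid" where
  "unit_monoid t = \<lparr>elems = {0..1}, dist_of = ihom t, mult_of = t\<rparr>"


section \<open>Partially ordered compact spaces\<close>

record 'a ordered_space =
  topol :: "'a topology"
  order_rel :: "'a rel"  \<comment> \<open>\<open>(x, y)\<close> is in the relation iff \<open>x\<close> is below \<open>y\<close>\<close>

abbreviation points :: "'a ordered_space \<Rightarrow> 'a set" where
  "points X \<equiv> topspace (topol X)"

definition poscomp :: "'a ordered_space \<Rightarrow> bool" where
  "poscomp X \<longleftrightarrow>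
     compact_space (topol X) \<and>
     partial_order_on (points X) (order_rel X) \<and>
     closedin (prod_topology (topol X) (topol X)) (order_rel X)"

definition poscomp_hom :: "'a ordered_space \<Rightarrow> 'b ordered_space \<Rightarrow> ('a \<Rightarrow> 'b) set" where
  "poscomp_hom X Y =
     {f \<in> points X \<rightarrow>\<^sub>E points Y.
        continuous_map (topol X) (topol Y) f \<and>
        (\<forall>(x, y)\<in>order_rel X. (f x, f y) \<in> order_rel Y)}"

definition poscomp_iso :: "'a ordered_space \<Rightarrow> 'b ordered_space \<Rightarrow> ('a \<Rightarrow> 'b) \<Rightarrow> bool" where
  "poscomp_iso X Y f \<longleftrightarrow>
     f \<in> poscomp_hom X Y \<and>
     (\<exists>g\<in>poscomp_hom Y X.
        compose (points X) g f = id_map (points X) \<and> compose (points Y) f g = id_map (points Y))"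

definition op_space :: "'a ordered_space \<Rightarrow> 'a ordered_space" where
  "op_space X = \<lparr>topol = topol X, order_rel = (order_rel X)\<inverse>\<rparr>"

definition unit_space :: "real ordered_space" where
  "unit_space =
     \<lparr>topol = top_of_set {0..1}, order_rel = {(u, v). u \<in> {0..1} \<and> v \<in> {0..1} \<and> u \<le> v}\<rparr>"


section \<open>The adjunction induced by the unit interval\<close>

definition C_obj :: "tensor \<Rightarrow> 'a ordered_space \<Rightarrow> ('a \<Rightarrow> real) enriched_monoid" where
  "C_obj t X =
     \<lparr>elems = poscomp_hom X (op_space unit_space),
      dist_of = (\<lambda>\<psi> \<psi>'. Inf (insert 1 ((\<lambda>x. ihom t (\<psi> x) (\<psi>' x)) ` points X))),
      mult_of = (\<lambda>\<psi> \<psi>'. \<lambda>x\<in>points X. t (\<psi> x) (\<psi>' x))\<rparr>"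

text \<open>For \<open>f\<close> from \<open>X\<close> to \<open>Y\<close>, the map \<open>C f\<close> goes from \<open>C Y\<close> to \<open>C X\<close>.\<close>

definition C_map ::
  "tensor \<Rightarrow> 'a ordered_space \<Rightarrow> 'b ordered_space \<Rightarrow> ('a \<Rightarrow> 'b) \<Rightarrow> ('b \<Rightarrow> real) \<Rightarrow> 'a \<Rightarrow> real" where
  "C_map t X Y f = (\<lambda>\<psi>\<in>elems (C_obj t Y). compose (points X) \<psi> f)"

text \<open>
  The initial structure for the evaluations into the order dual of the unit interval:
  the subspace topology of the product, and the reversed pointwise order.
\<close>

definition G_obj :: "tensor \<Rightarrow> 'm enriched_monoid \<Rightarrow> ('m \<Rightarrow> real) ordered_space" where
  "G_obj t A =
     (let H = laxmon_hom t A (unit_monoid t) in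
      \<lparr>topol = subtopology (product_topology (\<lambda>_. top_of_set {0..1}) (elems A)) H,
       order_rel = {(\<Phi>, \<Psi>). \<Phi> \<in> H \<and> \<Psi> \<in> H \<and> (\<forall>a\<in>elems A. \<Psi> a \<le> \<Phi> a)}\<rparr>)"

text \<open>For \<open>f\<close> from \<open>A\<close> to \<open>B\<close>, the map \<open>G f\<close> goes from \<open>G B\<close> to \<open>G A\<close>.\<close>

definition G_map ::
  "tensor \<Rightarrow> 'm enriched_monoid \<Rightarrow> 'n enriched_monoid \<Rightarrow> ('m \<Rightarrow> 'n) \<Rightarrow> ('n \<Rightarrow> real) \<Rightarrow> 'm \<Rightarrow> real" where
  "G_map t A B f = (\<lambda>\<Phi>\<in>points (G_obj t B). compose (elems A) \<Phi> f)"

text \<open>The correspondence of morphisms \<open>X \<rightarrow> G A\<close> and \<open>A \<rightarrow> C X\<close> under the adjunction.\<close>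

definition transpose_map ::
  "'a ordered_space \<Rightarrow> 'm enriched_monoid \<Rightarrow> ('a \<Rightarrow> 'm \<Rightarrow> real) \<Rightarrow> 'm \<Rightarrow> 'a \<Rightarrow> real" where
  "transpose_map X A h = (\<lambda>a\<in>elems A. \<lambda>x\<in>points X. h x a)"

definition GC_unit :: "tensor \<Rightarrow> 'a ordered_space \<Rightarrow> 'a \<Rightarrow> ('a \<Rightarrow> real) \<Rightarrow> real" where
  "GC_unit t X = (\<lambda>x\<in>points X. \<lambda>\<psi>\<in>elems (C_obj t X). \<psi> x)"

definition CG_unit :: "tensor \<Rightarrow> 'm enriched_monoid \<Rightarrow> 'm \<Rightarrow> ('m \<Rightarrow> real) \<Rightarrow> real" where
  "CG_unit t A = (\<lambda>a\<in>elems A. \<lambda>\<Phi>\<in>points (G_obj t A). \<Phi> a)"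

text \<open>The induced monad on partially ordered compact spaces; its unit is \<open>GC_unit\<close>.\<close>

definition GC_obj :: "tensor \<Rightarrow> 'a ordered_space \<Rightarrow> (('a \<Rightarrow> real) \<Rightarrow> real) ordered_space" where
  "GC_obj t X = G_obj t (C_obj t X)"

definition GC_map ::
  "tensor \<Rightarrow> 'a ordered_space \<Rightarrow> 'b ordered_space \<Rightarrow> ('a \<Rightarrow> 'b) \<Rightarrow>
   (('a \<Rightarrow> real) \<Rightarrow> real) \<Rightarrow> ('b \<Rightarrow> real) \<Rightarrow> real" where
  "GC_map t X Y f = G_map t (C_obj t Y) (C_obj t X) (C_map t X Y f)"

definition GC_mult ::
  "tensor \<Rightarrow> 'a ordered_space \<Rightarrow>
   (((('a \<Rightarrow> real) \<Rightarrow> real) \<Rightarrow> real) \<Rightarrow> real) \<Rightarrow> ('a \<Rightarrow> real) \<Rightarrow> real" where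
  "GC_mult t X = G_map t (C_obj t X) (C_obj t (GC_obj t X)) (CG_unit t (C_obj t X))"


section \<open>The Vietoris monad\<close>

definition upper_set :: "'a ordered_space \<Rightarrow> 'a set \<Rightarrow> bool" where
  "upper_set X A \<longleftrightarrow> A \<subseteq> points X \<and> (\<forall>(x, y)\<in>order_rel X. x \<in> A \<longrightarrow> y \<in> A)"

definition lower_set :: "'a ordered_space \<Rightarrow> 'a set \<Rightarrow> bool" where
  "lower_set X A \<longleftrightarrow> A \<subseteq> points X \<and> (\<forall>(x, y)\<in>order_rel X. y \<in> A \<longrightarrow> x \<in> A)"

definition closed_upper_sets :: "'a ordered_space \<Rightarrow> 'a set set" where
  "closed_upper_sets X = {A. closedin (topol X) A \<and> upper_set X A}"

text \<open>The subbasis covers \<open>closed_upper_sets X\<close>, since \<open>K\<close> may be empty.\<close>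

definition V_obj :: "'a ordered_space \<Rightarrow> 'a set ordered_space" where
  "V_obj X =
     \<lparr>topol = topology_generated_by
        ({{A \<in> closed_upper_sets X. A \<inter> U \<noteq> {}} | U. openin (topol X) U \<and> lower_set X U} \<union>
         {{A \<in> closed_upper_sets X. A \<inter> K = {}} | K. closedin (topol X) K \<and> lower_set X K}),
      order_rel = {(A, B). A \<in> closed_upper_sets X \<and> B \<in> closed_upper_sets X \<and> A \<supseteq> B}\<rparr>"

definition V_map ::
  "'a ordered_space \<Rightarrow> 'b ordered_space \<Rightarrow> ('a \<Rightarrow> 'b) \<Rightarrow> 'a set \<Rightarrow> 'b set" where
  "V_map X Y f = (\<lambda>A\<in>closed_upper_sets X. \<Inter>{B \<in> closed_upper_sets Y. f ` A \<subseteq> B})"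

definition V_unit :: "'a ordered_space \<Rightarrow> 'a \<Rightarrow> 'a set" where
  "V_unit X = (\<lambda>x\<in>points X. {y. (x, y) \<in> order_rel X})"

definition V_mult :: "'a ordered_space \<Rightarrow> 'a set set \<Rightarrow> 'a set" where
  "V_mult X = (\<lambda>\<A>\<in>closed_upper_sets (V_obj X). \<Union>\<A>)"

text \<open>The comparison map \<open>V X \<rightarrow> G C X\<close>.\<close>

definition j_map :: "tensor \<Rightarrow> 'a ordered_space \<Rightarrow> 'a set \<Rightarrow> ('a \<Rightarrow> real) \<Rightarrow> real" where
  "j_map t X = (\<lambda>A\<in>closed_upper_sets X. \<lambda>\<psi>\<in>elems (C_obj t X). Sup (insert 0 (\<psi> ` A)))"


section \<open>Continuous distributors\<close>

text \<open>Composition of distributors is \<open>O\<close>, and the identity on \<open>X\<close> is \<open>order_rel X\<close>.\<close>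

definition dist_hom :: "'a ordered_space \<Rightarrow> 'b ordered_space \<Rightarrow> ('a \<times> 'b) set set" where
  "dist_hom X Y =
     {\<phi>. \<phi> \<subseteq> points X \<times> points Y \<and> (\<lambda>x\<in>points X. \<phi> `` {x}) \<in> poscomp_hom X (V_obj Y)}"

definition C_dist ::
  "tensor \<Rightarrow> 'a ordered_space \<Rightarrow> 'b ordered_space \<Rightarrow> ('a \<times> 'b) set \<Rightarrow>
   ('b \<Rightarrow> real) \<Rightarrow> 'a \<Rightarrow> real" where
  "C_dist t X Y \<phi> =
     (\<lambda>\<psi>\<in>elems (C_obj t Y). \<lambda>x\<in>points X. Sup (insert 0 {\<psi> y | y. (x, y) \<in> \<phi>}))"

end

theory Submission
  imports Defs
begin

text \<open>
  A point \<open>x\<close> lies in a closed upper set \<open>A\<close> iff \<open>\<psi> x \<le> \<Phi>\<^sub>A \<psi>\<close> for all \<open>\<psi>\<close> in \<open>C X\<close>, by the ordered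
  Urysohn lemma. This gives that \<open>j\<close> is an order embedding and that its inverse is continuous.

  For surjectivity let \<open>\<Phi>\<close> be a lax morphism \<open>C X \<rightarrow> [0,1]\<close> and \<open>A = {x. \<forall>\<psi>. \<psi> x \<le> \<Phi> \<psi>}\<close>; the point is
  that \<open>\<Phi> \<psi> \<le> u\<close> whenever \<open>\<Phi>\<^sub>A \<psi> < u < 1\<close>. The compact set \<open>K = {\<psi> \<ge> u}\<close> misses \<open>A\<close>, so a finite
  subcover yields \<open>\<rho>\<close> in \<open>C X\<close> with \<open>\<rho> = 1\<close> on \<open>K\<close> and \<open>\<Phi> \<rho> < 1\<close>. Laxness gives
  \<open>\<Phi> (\<rho>^n) \<le> (\<Phi> \<rho>)^n\<close>, and powers of a number below \<open>1\<close> tend to \<open>0\<close> for both tensors. As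
  \<open>\<psi> \<le> max u (\<rho>^n)\<close>, cocontinuity of \<open>\<Phi>\<close> gives \<open>\<Phi> \<psi> \<le> u\<close> for large \<open>n\<close>. No approximation theorem
  of Stone-Weierstrass type is needed.

  The Vietoris space and the structure maps of the monad are then transported along \<open>j\<close>, and the
  functor on distributors is the composite of \<open>j\<close> with the transposition of the adjunction.
\<close>

section \<open>Separation in partially ordered compact spaces\<close>

text \<open>Morphisms are only lax because a supremum over \<open>A\<close> of a product is in
  general strictly below the product of the suprema. Hence \<Phi> cannot be treated as a character;
  only the inequality for powers is available.

  Two properties of the tensor carry the surjectivity: \<open>hom(u, -)\<close> is continuous for
  fixed \<open>u\<close>, which keeps a function that is rescaled to reach \<open>1\<close> at a
  given level inside \<open>C X\<close>, and powers of \<open>u < 1\<close> become small. The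
  minimum has neither.

  The direction of the transport matters. \<open>G C X\<close> is compact as a closed subspace of a
  cube, whereas compactness of \<open>V X\<close> is not known beforehand. So continuity of the
  inverse of \<open>j\<close> cannot come from the usual argument for bijections from a compact to a
  Hausdorff space. It is proved on subbasic sets with separating functions, and compactness of
  \<open>V X\<close> is a consequence.\<close>

lemma poscompD:
  assumes "poscomp X"
  shows "compact_space (topol X)"
    and "order_rel X \<subseteq> points X \<times> points X"
    and "x \<in> points X \<Longrightarrow> (x, x) \<in> order_rel X"
    and "(x, y) \<in> order_rel X \<Longrightarrow> (y, z) \<in> order_rel X \<Longrightarrow> (x, z) \<in> order_rel X"
    and "(x, y) \<in> order_rel X \<Longrightarrow> (y, x) \<in> order_rel X \<Longrightarrow> x = y"
    and "closedin (prod_topology (topol X) (topol X)) (order_rel X)"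
proof -
  have c: "compact_space (topol X)" and p: "order_rel X \<subseteq> points X \<times> points X" "refl_on (points X) (order_rel X)"
      "trans (order_rel X)" "antisym (order_rel X)"
    and o: "closedin (prod_topology (topol X) (topol X)) (order_rel X)"
    using assms by (simp_all add: poscomp_def partial_order_on_def preorder_on_def)
  show "compact_space (topol X)" "order_rel X \<subseteq> points X \<times> points X"
    "closedin (prod_topology (topol X) (topol X)) (order_rel X)"
    using c p o by simp_all
  show "x \<in> points X \<Longrightarrow> (x, x) \<in> order_rel X"
    using p(2) by (simp add: refl_on_def)
  show "(x, y) \<in> order_rel X \<Longrightarrow> (y, z) \<in> order_rel X \<Longrightarrow> (x, z) \<in> order_rel X"
    using p(3) by (rule transD)
  show "(x, y) \<in> order_rel X \<Longrightarrow> (y, x) \<in> order_rel X \<Longrightarrow> x = y"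
    using p(4) by (rule antisymD)
qed

lemma poscompI:
  assumes "compact_space (topol X)"
    and "order_rel X \<subseteq> points X \<times> points X"
    and "\<And>x. x \<in> points X \<Longrightarrow> (x, x) \<in> order_rel X"
    and "\<And>x y z. (x, y) \<in> order_rel X \<Longrightarrow> (y, z) \<in> order_rel X \<Longrightarrow> (x, z) \<in> order_rel X"
    and "\<And>x y. (x, y) \<in> order_rel X \<Longrightarrow> (y, x) \<in> order_rel X \<Longrightarrow> x = y"
    and "closedin (prod_topology (topol X) (topol X)) (order_rel X)"
  shows "poscomp X"
proof -
  have "refl_on (points X) (order_rel X)"
    using assms(3) by (rule refl_onI)
  moreover have "trans (order_rel X)"
    using assms(4) by (rule transI)
  moreover have "antisym (order_rel X)"
    using assms(5) by (rule antisymI)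
  ultimately show ?thesis
    using assms(1,2,6) by (simp add: poscomp_def partial_order_on_def preorder_on_def)
qed

lemma poscomp_op_space:
  assumes "poscomp X"
  shows "poscomp (op_space X)"
proof (rule poscompI)
  note X = poscompD[OF assms]
  show "compact_space (topol (op_space X))"
    using X(1) by (simp add: op_space_def)
  have sw: "continuous_map (prod_topology (topol X) (topol X)) (prod_topology (topol X) (topol X)) prod.swap"
    unfolding prod.swap_def by (intro continuous_intros)
  have "(order_rel X)\<inverse> = {p \<in> topspace (prod_topology (topol X) (topol X)). prod.swap p \<in> order_rel X}"
    using X(2) by auto
  then show "closedin (prod_topology (topol (op_space X)) (topol (op_space X))) (order_rel (op_space X))"
    using closedin_continuous_map_preimage[OF sw X(6)] by (simp add: op_space_def)
  show "order_rel (op_space X) \<subseteq> points (op_space X) \<times> points (op_space X)"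
    using X(2) by (auto simp: op_space_def)
qed (simp_all add: op_space_def poscompD(3)[OF assms],
     meson poscompD(4)[OF assms], meson poscompD(5)[OF assms])

text \<open>By antisymmetry the diagonal is the intersection of the order with its converse, and
  both are closed.\<close>

lemma poscomp_Hausdorff:
  assumes "poscomp X"
  shows "Hausdorff_space (topol X)"
proof -
  note X = poscompD[OF assms]
  have eq: "(\<lambda>x. (x, x)) ` points X = order_rel X \<inter> order_rel (op_space X)"
    using X(2,3,5) by (auto simp: op_space_def image_iff)
  have "closedin (prod_topology (topol X) (topol X)) (order_rel (op_space X))"
    using poscompD(6)[OF poscomp_op_space[OF assms]] by (simp add: op_space_def)
  then show ?thesis
    unfolding Hausdorff_space_closedin_diagonal eq using X(6) by blast
qed

text \<open>The up-closure of \<open>F\<close> is the second projection of the closed set of those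
  pairs in the order that start in \<open>F\<close>, and projecting along a compact factor is a
  closed map.\<close>

lemma closedin_up_closure:
  assumes "poscomp X" and F: "closedin (topol X) F"
  shows "closedin (topol X) (order_rel X `` F)"
proof -
  note X = poscompD[OF assms(1)]
  have "closedin (prod_topology (topol X) (topol X)) (order_rel X \<inter> F \<times> points X)"
    using X(6) F by (intro closedin_Int) (auto simp: closedin_prod_Times_iff)
  moreover have "closed_map (prod_topology (topol X) (topol X)) (topol X) snd"
    using X(1) by (rule closed_map_snd)
  ultimately have "closedin (topol X) (snd ` (order_rel X \<inter> F \<times> points X))"
    by (simp add: closed_map_def)
  also have "snd ` (order_rel X \<inter> F \<times> points X) = order_rel X `` F"
    using X(2) by force
  finally show ?thesis .
qed

lemma closedin_down_closure:
  assumes "poscomp X" and "closedin (topol X) F"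
  shows "closedin (topol X) ((order_rel X)\<inverse> `` F)"
  using closedin_up_closure[OF poscomp_op_space[OF assms(1)]] assms(2) by (simp add: op_space_def)

lemma lower_set_Compl: "poscomp X \<Longrightarrow> upper_set X A \<Longrightarrow> lower_set X (points X - A)"
  using poscompD(2)[of X] unfolding upper_set_def lower_set_def by blast

lemma upper_set_Compl: "poscomp X \<Longrightarrow> lower_set X A \<Longrightarrow> upper_set X (points X - A)"
  using poscompD(2)[of X] unfolding upper_set_def lower_set_def by blast

section \<open>Order-theoretic normality and Urysohn functions\<close>

lemma ordered_normal:
  assumes "poscomp X" and "closedin (topol X) K" and "lower_set X K"
    and "openin (topol X) N" and "lower_set X N" and "K \<subseteq> N"
  obtains W F where "openin (topol X) W" "lower_set X W" "closedin (topol X) F" "lower_set X F"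
    "K \<subseteq> W" "W \<subseteq> F" "F \<subseteq> N"
proof -
  note X = poscompD[OF assms(1)]
  let ?S = "points X"
  have "normal_space (topol X)"
    using compact_Hausdorff_or_regular_imp_normal_space X(1) poscomp_Hausdorff[OF assms(1)] by blast
  moreover have "closedin (topol X) (?S - N)"
    using assms(4) by blast
  moreover have "disjnt K (?S - N)"
    using \<open>K \<subseteq> N\<close> by (auto simp: disjnt_def)
  ultimately obtain U V where UV: "openin (topol X) U" "openin (topol X) V" "K \<subseteq> U" "?S - N \<subseteq> V" "disjnt U V"
    using assms(2) unfolding normal_space_def by metis
  \<comment> \<open>Ordinary normality ignores the order, so both sets are corrected:
    \<open>W\<close> is the largest lower set inside \<open>U\<close>, and \<open>F\<close> is the
    smallest lower set containing the complement of \<open>V\<close>. Up- and down-closures of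
    closed sets are closed, and the inclusions at \<open>K\<close> and \<open>N\<close> survive
    because these are lower sets.\<close>
  define W where "W = ?S - order_rel X `` (?S - U)"
  define F where "F = (order_rel X)\<inverse> `` (?S - V)"
  show thesis
  proof
    show "openin (topol X) W"
      unfolding W_def using closedin_up_closure[OF assms(1)] UV(1) by blast
    show "closedin (topol X) F"
      unfolding F_def using closedin_down_closure[OF assms(1)] UV(2) by blast
    show "lower_set X W"
      unfolding W_def lower_set_def using X(2,4) by blast
    show "lower_set X F"
      unfolding F_def lower_set_def using X(2,4) by blast
    show "K \<subseteq> W"
      unfolding W_def using assms(3) UV(3) by (auto simp: lower_set_def)
    show "W \<subseteq> F"
      unfolding W_def F_def using X(3) UV(5) by (auto simp: disjnt_def)
    show "F \<subseteq> N"
      unfolding F_def using assms(5) UV(4) by (auto simp: lower_set_def)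
  qed
qed

lemma dyadic_between:
  fixes a b :: real
  assumes "0 \<le> a" "a < b" "b \<le> 1"
  obtains r where "r \<in> dyadics \<inter> {0..1}" "a < r" "r < b"
proof -
  obtain n where n: "(1/2) ^ n < b - a"
    using real_arch_pow_inv[of "b - a" "1/2"] assms by auto
  \<comment> \<open>\<open>k\<close> is the least numerator with \<open>a < k / 2 ^ n\<close>, so it
    overshoots \<open>a\<close> by at most one dyadic step, which is shorter than
    \<open>b - a\<close>.\<close>
  define k where "k = Suc (nat \<lfloor>a * 2 ^ n\<rfloor>)"
  have k: "a * 2 ^ n < k" "k \<le> a * 2 ^ n + 1"
    unfolding k_def using assms by (simp_all add: of_nat_nat) linarith+
  have "a < k / 2 ^ n"
    using k(1) by (simp add: field_simps)
  moreover have "k / 2 ^ n \<le> a + (1/2) ^ n"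
    using k(2) by (simp add: field_simps)
  moreover have "real k / 2 ^ n \<in> dyadics"
    by (auto simp: dyadics_def)
  ultimately show thesis
    using that[of "k / 2 ^ n"] n assms by (smt (verit) IntI atLeastAtMost_iff)
qed

text \<open>Nachbin's version of Urysohn's construction: every dyadic level is an open lower set.\<close>

theorem ordered_Urysohn:
  assumes "poscomp X" and "A \<in> closed_upper_sets X"
    and "closedin (topol X) K" and "lower_set X K" and "A \<inter> K = {}"
  obtains \<psi> where "\<psi> \<in> poscomp_hom X (op_space unit_space)"
    "\<And>x. x \<in> K \<Longrightarrow> \<psi> x = 1" "\<And>x. x \<in> A \<Longrightarrow> \<psi> x = 0"
proof -
  note X = poscompD[OF assms(1)]
  let ?S = "points X"
  define D where "D = dyadics \<inter> {0..1::real}"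
  \<comment> \<open>\<open>R\<close> records openness and the lower-set property of both sides, so
    the dyadic recursion, which only knows the relation, returns them for the levels. The closed set
    in between makes the resulting function continuous; its being a lower set permits the next
    interpolation.\<close>
  define R where "R = (\<lambda>U V. openin (topol X) U \<and> lower_set X U \<and> openin (topol X) V \<and> lower_set X V \<and>
    (\<exists>F. closedin (topol X) F \<and> lower_set X F \<and> U \<subseteq> F \<and> F \<subseteq> V))"
  have N: "openin (topol X) (?S - A)" "lower_set X (?S - A)" "K \<subseteq> ?S - A"
    using assms(2,5) lower_set_Compl[OF assms(1)] closedin_subset[OF assms(3)]
    by (auto simp: closed_upper_sets_def)
  obtain W F where WF: "openin (topol X) W" "lower_set X W" "closedin (topol X) F" "lower_set X F"
    "K \<subseteq> W" "W \<subseteq> F" "F \<subseteq> ?S - A"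
    using ordered_normal[OF assms(1,3,4) N] by metis
  have "\<exists>G :: real \<Rightarrow> 'a set. G 0 = W \<and> G 1 = ?S - A \<and>
               (\<forall>x \<in> dyadics \<inter> {0..1}. \<forall>y \<in> dyadics \<inter> {0..1}. x < y \<longrightarrow> R (G x) (G y))"
  proof (rule recursion_on_dyadic_fractions)
    show "R W (?S - A)"
      unfolding R_def using WF(1-4,6,7) N(1,2) by metis
    show "\<exists>z. R x z \<and> R z y" if xRy: "R x y" for x y
    proof -
      have xy: "openin (topol X) x" "lower_set X x" "openin (topol X) y" "lower_set X y"
        using that by (simp_all add: R_def)
      obtain F where F: "closedin (topol X) F" "lower_set X F" "x \<subseteq> F" "F \<subseteq> y"
        using xRy unfolding R_def by metis
      obtain W F' where "openin (topol X) W" "lower_set X W" "closedin (topol X) F'" "lower_set X F'"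
        "F \<subseteq> W" "W \<subseteq> F'" "F' \<subseteq> y"
        using ordered_normal[OF assms(1) F(1,2) xy(3,4) F(4)] by metis
      then have "R x W" "R W y"
        unfolding R_def using F xy by metis+
      then show ?thesis
        by metis
    qed
    show "R x z" if R: "R x y" "R y z" for x y z
    proof -
      obtain F where "closedin (topol X) F" "lower_set X F" "x \<subseteq> F" "F \<subseteq> y"
        using R(1) unfolding R_def by metis
      moreover have "y \<subseteq> z"
        using that(2) unfolding R_def by (metis order_trans)
      ultimately show ?thesis
        using that unfolding R_def by (metis order_trans)
    qed
  qed
  then obtain G :: "real \<Rightarrow> 'a set" where G0: "G 0 = W" and G1: "G 1 = ?S - A"
    and GR: "\<And>x y. x \<in> D \<Longrightarrow> y \<in> D \<Longrightarrow> x < y \<Longrightarrow> R (G x) (G y)"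
    unfolding D_def by auto
  have D01: "0 \<in> D" "1 \<in> D"
    using real_in_dyadics[of 0] real_in_dyadics[of 1] by (auto simp: D_def simp del: real_in_dyadics)
  have Dsub: "0 \<le> r \<and> r \<le> 1" if "r \<in> D" for r
    using that by (auto simp: D_def)
  have Gol: "openin (topol X) (G r) \<and> lower_set X (G r)" if "r \<in> D" for r
  proof (cases "r = 0")
    case False
    then have "R (G 0) (G r)"
      using GR[OF D01(1) that] Dsub[OF that] by simp
    then show ?thesis
      by (simp add: R_def)
  qed (use WF(1,2) G0 in simp)
  have Gmono: "G r \<subseteq> G s" if "r \<in> D" "s \<in> D" "r \<le> s" for r s
    using GR[OF that(1,2)] that(3) unfolding R_def by (cases "r = s") auto
  \<comment> \<open>The default \<open>1\<close> is the value at points that lie in no level set, in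
    particular on \<open>A\<close>, which is disjoint from the largest level
    \<open>G 1\<close>.\<close>
  define f where "f = (\<lambda>x. Inf (insert 1 {r \<in> D. x \<in> G r}))"
  have bdd: "bdd_below (insert 1 {r \<in> D. x \<in> G r})" for x
    by (rule bdd_belowI[of _ 0]) (auto simp: D_def)
  have f01: "f x \<in> {0..1}" for x
    unfolding f_def using bdd Dsub by (auto intro!: cInf_lower cInf_greatest)
  have f_le: "f x \<le> r" if "r \<in> D" "x \<in> G r" for x r
    unfolding f_def using that bdd by (auto intro!: cInf_lower)
  have f_ge: "r \<le> f x" if "r \<in> D" "x \<notin> G r" for x r
    unfolding f_def
  proof (rule cInf_greatest)
    show "r \<le> s" if "s \<in> insert 1 {r \<in> D. x \<in> G r}" for s
      using that \<open>r \<in> D\<close> \<open>x \<notin> G r\<close> Dsub[of r] Gmono[of s r] by (cases "s \<le> r") auto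
  qed simp
  have f_less: "f x < c \<longleftrightarrow> (\<exists>r\<in>D. r < c \<and> x \<in> G r)" if "c \<le> 1" for x c
  proof
    show "\<exists>r\<in>D. r < c \<and> x \<in> G r" if "f x < c"
      using that \<open>c \<le> 1\<close> cInf_less_iff[OF _ bdd, of x c] unfolding f_def by auto
  qed (use f_le in force)
  have f_gr: "c < f x \<longleftrightarrow> (\<exists>r\<in>D. \<exists>s\<in>D. c < r \<and> r < s \<and> x \<notin> G s)" if "0 \<le> c" for x c
  proof
    assume "c < f x"
    then obtain s where s: "s \<in> D" "c < s" "s < f x"
      using dyadic_between[of c "f x"] f01[of x] \<open>0 \<le> c\<close> unfolding D_def by (metis atLeastAtMost_iff)
    then obtain r where "r \<in> D" "c < r" "r < s"
      using dyadic_between[of c s] Dsub[of s] s \<open>0 \<le> c\<close> unfolding D_def by metis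
    then show "\<exists>r\<in>D. \<exists>s\<in>D. c < r \<and> r < s \<and> x \<notin> G s"
      using s f_le by force
  qed (use f_ge in force)
  have op_less: "openin (topol X) {x \<in> ?S. f x < c}" for c
  proof (cases "c \<le> 1")
    case True
    then have "{x \<in> ?S. f x < c} = (\<Union>r\<in>{r \<in> D. r < c}. G r)"
      using Gol by (auto simp: f_less lower_set_def)
    then show ?thesis
      using Gol by auto
  next
    case False
    then have "f x < c" for x
      using f01[of x] by simp
    then have "{x \<in> ?S. f x < c} = ?S"
      by auto
    then show ?thesis
      by simp
  qed
  have op_gr: "openin (topol X) {x \<in> ?S. c < f x}" for c
  proof (cases "0 \<le> c")
    case True
    \<comment> \<open>If \<open>x\<close> lies outside \<open>G s\<close>, then the complement of a
      closed set squeezed between \<open>G r\<close> and \<open>G s\<close> is a neighbourhood of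
      \<open>x\<close>; as it misses \<open>G r\<close>, the values of \<open>f\<close> on it are at
      least \<open>r > c\<close>.\<close>
    have "\<exists>V. openin (topol X) V \<and> x \<in> V \<and> V \<subseteq> {x \<in> ?S. c < f x}" if x: "x \<in> ?S" "c < f x" for x
    proof -
      obtain r s where rs: "r \<in> D" "s \<in> D" "c < r" "r < s" "x \<notin> G s"
        using f_gr[OF True] x by blast
      then obtain F where F: "closedin (topol X) F" "G r \<subseteq> F" "F \<subseteq> G s"
        using GR[OF rs(1,2,4)] unfolding R_def by metis
      have "?S - F \<subseteq> {x \<in> ?S. c < f x}"
        using f_ge[OF rs(1)] F(2) rs(3) by fastforce
      then show ?thesis
        using F rs x by blast
    qed
    then show ?thesis
      by (subst openin_subopen) blast
  next
    case False
    then have "c < f x" for x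
      using f01[of x] by simp
    then have "{x \<in> ?S. c < f x} = ?S"
      by auto
    then show ?thesis
      by simp
  qed
  have cont: "continuous_map (topol X) (top_of_set {0..1}) f"
    unfolding continuous_map_upper_lower_semicontinuous_lt_gen using op_less op_gr f01 by auto
  then have "continuous_map (topol X) euclideanreal f"
    by (rule continuous_map_into_fulltopology)
  then have "continuous_map (topol X) euclideanreal (\<lambda>x. 1 - f x)"
    by (intro continuous_intros)
  then have cont': "continuous_map (topol X) (top_of_set {0..1}) (\<lambda>x. 1 - f x)"
    using f01 by (auto intro!: continuous_map_into_subtopology)
  \<comment> \<open>The levels are lower sets, so \<open>f\<close> is monotone, with value
    \<open>0\<close> on \<open>K\<close> and \<open>1\<close> on \<open>A\<close>;
    \<open>1 - f\<close> is order-reversing with the required values.\<close>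
  define \<psi> where "\<psi> = restrict (\<lambda>x. 1 - f x) ?S"
  have anti: "f x \<le> f y" if "(x, y) \<in> order_rel X" for x y
  proof -
    have "{r \<in> D. y \<in> G r} \<subseteq> {r \<in> D. x \<in> G r}"
      using Gol that unfolding lower_set_def by blast
    then show ?thesis
      unfolding f_def using bdd by (intro cInf_superset_mono) auto
  qed
  show thesis
  proof
    have "continuous_map (topol X) (top_of_set {0..1}) \<psi>"
      using cont' continuous_map_eq[of "topol X" _ "\<lambda>x. 1 - f x" \<psi>] by (simp add: \<psi>_def)
    moreover have "\<psi> \<in> ?S \<rightarrow>\<^sub>E {0..1}"
      using f01 by (auto simp: \<psi>_def)
    moreover have "\<psi> y \<le> \<psi> x" if "(x, y) \<in> order_rel X" for x y
      using anti[OF that] that X(2) by (auto simp: \<psi>_def)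
    ultimately show "\<psi> \<in> poscomp_hom X (op_space unit_space)"
      using X(2) unfolding poscomp_hom_def op_space_def unit_space_def by auto
    show "\<psi> x = 1" if "x \<in> K" for x
    proof -
      have "f x \<le> 0"
        using f_le[OF D01(1)] that WF(5) G0 by auto
      then show ?thesis
        using f01[of x] that N(3) by (auto simp: \<psi>_def)
    qed
    show "\<psi> x = 0" if "x \<in> A" for x
    proof -
      have "1 \<le> f x"
        using f_ge[OF D01(2)] that G1 by auto
      moreover have "x \<in> ?S"
        using assms(2) that by (auto simp: closed_upper_sets_def upper_set_def)
      ultimately show ?thesis
        using f01[of x] by (auto simp: \<psi>_def)
    qed
  qed
qed

section \<open>Tensors with a right adjoint\<close>

lemma le_Inf_insert_1_iff:
  fixes S :: "real set"
  assumes "S \<subseteq> {0..1}"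
  shows "v \<le> Inf (insert 1 S) \<longleftrightarrow> v \<le> 1 \<and> (\<forall>s\<in>S. v \<le> s)"
proof -
  have "bdd_below (insert 1 S)"
    using assms by (intro bdd_belowI[of _ 0]) auto
  then show ?thesis
    by (subst le_cInf_iff) auto
qed

lemma Inf_insert_1_in:
  fixes S :: "real set"
  assumes "S \<subseteq> {0..1}"
  shows "Inf (insert 1 S) \<in> {0..1}"
  using le_Inf_insert_1_iff[OF assms, of 0] le_Inf_insert_1_iff[OF assms, of "Inf (insert 1 S)"] assms
  by auto

lemma Sup_insert_0_le_iff:
  fixes S :: "real set"
  assumes "S \<subseteq> {0..1}"
  shows "Sup (insert 0 S) \<le> v \<longleftrightarrow> 0 \<le> v \<and> (\<forall>s\<in>S. s \<le> v)"
proof -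
  have "bdd_above (insert 0 S)"
    using assms by (intro bdd_aboveI[of _ 1]) auto
  then show ?thesis
    by (subst cSup_le_iff) auto
qed

lemma Sup_insert_0_in:
  fixes S :: "real set"
  assumes "S \<subseteq> {0..1}"
  shows "Sup (insert 0 S) \<in> {0..1}"
  using Sup_insert_0_le_iff[OF assms, of 1] Sup_insert_0_le_iff[OF assms, of "Sup (insert 0 S)"] assms
  by auto

lemma le_Sup_insert_0:
  fixes S :: "real set"
  assumes "S \<subseteq> {0..1}" "s \<in> S"
  shows "s \<le> Sup (insert 0 S)"
  using Sup_insert_0_le_iff[OF assms(1), of "Sup (insert 0 S)"] assms(2) by auto

text \<open>Used as a Yoneda argument: identities between infima and suprema are proved by showing
  that both sides have the same lower (or upper) bounds, so that adjunction formulas can be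
  rewritten under quantifiers.\<close>

lemma eq_of_le_iff_unit:
  fixes a b :: real
  assumes "a \<in> {0..1}" "b \<in> {0..1}" "\<And>v. v \<in> {0..1} \<Longrightarrow> v \<le> a \<longleftrightarrow> v \<le> b"
  shows "a = b"
  using assms(3)[of a] assms(3)[of b] assms(1,2) by auto

lemma eq_of_ge_iff_unit:
  fixes a b :: real
  assumes "a \<in> {0..1}" "b \<in> {0..1}" "\<And>v. v \<in> {0..1} \<Longrightarrow> a \<le> v \<longleftrightarrow> b \<le> v"
  shows "a = b"
  using assms(3)[of a] assms(3)[of b] assms(1,2) by auto

text \<open>The colimit of the diagram \<open>g\<close> with weight \<open>w\<close> in the unit
  interval, where copowers are given by the tensor; the default \<open>0\<close> covers the empty
  diagram.\<close>

definition wsup :: "tensor \<Rightarrow> nat set \<Rightarrow> (nat \<Rightarrow> real) \<Rightarrow> (nat \<Rightarrow> real) \<Rightarrow> real" where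
  "wsup t D w g = Sup (insert 0 ((\<lambda>d. t (w d) (g d)) ` D))"

text \<open>Residuation provides the algebra. Continuity of \<open>ihom t\<close> is asked in the
  second variable only: for multiplication it fails jointly at \<open>(0, 0)\<close>. The
  Archimedean property \<open>powers_small\<close> says in particular that no number strictly
  between \<open>0\<close> and \<open>1\<close> is idempotent.\<close>

locale unit_tensor =
  fixes t :: tensor
  assumes t_in: "u \<in> {0..1} \<Longrightarrow> v \<in> {0..1} \<Longrightarrow> t u v \<in> {0..1}"
    and t_comm: "u \<in> {0..1} \<Longrightarrow> v \<in> {0..1} \<Longrightarrow> t u v = t v u"
    and t_assoc: "u \<in> {0..1} \<Longrightarrow> v \<in> {0..1} \<Longrightarrow> w \<in> {0..1} \<Longrightarrow> t (t u v) w = t u (t v w)"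
    and t_1: "u \<in> {0..1} \<Longrightarrow> t 1 u = u"
    and ihom_in: "u \<in> {0..1} \<Longrightarrow> w \<in> {0..1} \<Longrightarrow> ihom t u w \<in> {0..1}"
    and le_ihom_iff: "u \<in> {0..1} \<Longrightarrow> v \<in> {0..1} \<Longrightarrow> w \<in> {0..1} \<Longrightarrow> v \<le> ihom t u w \<longleftrightarrow> t u v \<le> w"
    and continuous_on_t: "continuous_on ({0..1} \<times> {0..1}) (\<lambda>p. t (fst p) (snd p))"
    and continuous_on_ihom: "u \<in> {0..1} \<Longrightarrow> continuous_on {0..1} (ihom t u)"
    and powers_small: "u \<in> {0..<1} \<Longrightarrow> 0 < e \<Longrightarrow> \<exists>n. (t u ^^ n) 1 < e"
begin

text \<open>A map with a right adjoint is monotone; the other variable follows by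
  commutativity.\<close>

lemma t_mono:
  assumes "u \<in> {0..1}" "v \<in> {0..1}" "u' \<in> {0..1}" "v' \<in> {0..1}" "u \<le> u'" "v \<le> v'"
  shows "t u v \<le> t u' v'"
proof -
  have mono2: "t a b \<le> t a b'" if "a \<in> {0..1}" "b \<in> {0..1}" "b' \<in> {0..1}" "b \<le> b'" for a b b'
    using le_ihom_iff[of a b' "t a b'"] le_ihom_iff[of a b "t a b'"] t_in[of a b'] that by auto
  show ?thesis
    using mono2[of u v v'] mono2[of v' u u'] t_comm[of u v'] t_comm[of u' v'] assms by auto
qed

lemma t_0: "u \<in> {0..1} \<Longrightarrow> t u 0 = 0" "u \<in> {0..1} \<Longrightarrow> t 0 u = 0"
  using t_mono[of 0 u 0 1] t_mono[of u 0 1 0] t_1[of 0] t_1[of 1] t_comm[of 0 1] t_in[of 0 u] t_in[of u 0] 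
  by auto

lemma t_le: 
  assumes "u \<in> {0..1}" "v \<in> {0..1}"
  shows "t u v \<le> u" "t u v \<le> v"
  using t_mono[of u v u 1] t_mono[of u v 1 v] t_comm[of u 1] t_1[of u] t_1[of v] assms by auto

lemma ihom_eq_1_iff:
  assumes "u \<in> {0..1}" "w \<in> {0..1}"
  shows "ihom t u w = 1 \<longleftrightarrow> u \<le> w"
  using le_ihom_iff[of u 1 w] ihom_in[of u w] t_comm[of u 1] t_1[of u] assms by auto

lemma ihom_mono: 
  assumes "u \<in> {0..1}" "w \<in> {0..1}" "w' \<in> {0..1}" "w \<le> w'"
  shows "ihom t u w \<le> ihom t u w'"
  using le_ihom_iff[of u "ihom t u w" w'] le_ihom_iff[of u "ihom t u w" w] ihom_in[of u w] assms by auto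

lemma t_ihom_le: "u \<in> {0..1} \<Longrightarrow> w \<in> {0..1} \<Longrightarrow> t u (ihom t u w) \<le> w"
  using le_ihom_iff[of u "ihom t u w" w] ihom_in[of u w] by auto

text \<open>Composition in the self-enriched interval: evaluate first from \<open>u\<close> to
  \<open>v\<close>, then from \<open>v\<close> to \<open>w\<close>, and transpose the
  result.\<close>

lemma ihom_trans: 
  assumes "u \<in> {0..1}" "v \<in> {0..1}" "w \<in> {0..1}"
  shows "t (ihom t u v) (ihom t v w) \<le> ihom t u w"
proof -
  have i: "ihom t u v \<in> {0..1}" "ihom t v w \<in> {0..1}"
    using assms ihom_in by blast+
  have "t (t u (ihom t u v)) (ihom t v w) \<le> t v (ihom t v w)"
    using assms i t_in[OF assms(1) i(1)] t_ihom_le[OF assms(1,2)] by (intro t_mono) auto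
  also have "\<dots> \<le> w"
    using assms t_ihom_le by blast
  finally show ?thesis
    using le_ihom_iff[OF assms(1) t_in[OF i] assms(3)] t_assoc[OF assms(1) i] by simp
qed

lemma powers_in: "u \<in> {0..1} \<Longrightarrow> (t u ^^ n) 1 \<in> {0..1}"
  using t_in by (induction n) auto

lemma continuous_map_t:
  assumes "continuous_map T euclideanreal f" "continuous_map T euclideanreal g"
    and "\<And>x. x \<in> topspace T \<Longrightarrow> f x \<in> {0..1}" "\<And>x. x \<in> topspace T \<Longrightarrow> g x \<in> {0..1}"
  shows "continuous_map T euclideanreal (\<lambda>x. t (f x) (g x))"
proof -
  have "continuous_map T (prod_topology euclideanreal euclideanreal) (\<lambda>x. (f x, g x))"
    using assms(1,2) by (rule continuous_map_pairedI)
  then have "continuous_map T (top_of_set ({0..1} \<times> {0..1})) (\<lambda>x. (f x, g x))"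
    using assms(3,4) by (auto intro!: continuous_map_into_subtopology)
  moreover have "continuous_map (top_of_set ({0..1} \<times> {0..1})) euclideanreal (\<lambda>p. t (fst p) (snd p))"
    using continuous_on_t by simp
  ultimately have "continuous_map T euclideanreal ((\<lambda>p. t (fst p) (snd p)) \<circ> (\<lambda>x. (f x, g x)))"
    by (rule continuous_map_compose)
  then show ?thesis
    by (simp add: o_def)
qed

lemma continuous_map_ihom:
  assumes "u \<in> {0..1}" "continuous_map T euclideanreal g" "\<And>x. x \<in> topspace T \<Longrightarrow> g x \<in> {0..1}"
  shows "continuous_map T euclideanreal (\<lambda>x. ihom t u (g x))"
proof -
  have "continuous_map T (top_of_set {0..1}) g"
    using assms(2,3) by (auto intro!: continuous_map_into_subtopology)
  moreover have "continuous_map (top_of_set {0..1}) euclideanreal (ihom t u)"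
    using continuous_on_ihom[OF assms(1)] by simp
  ultimately have "continuous_map T euclideanreal (ihom t u \<circ> g)"
    by (rule continuous_map_compose)
  then show ?thesis
    by (simp add: o_def)
qed

lemma wsup_image_in:
  assumes "w \<in> D \<rightarrow> {0..1}" "g \<in> D \<rightarrow> {0..1}"
  shows "(\<lambda>d. t (w d) (g d)) ` D \<subseteq> {0..1}"
  using assms by (auto intro!: t_in simp del: atLeastAtMost_iff)

lemma wsup_in:
  assumes "w \<in> D \<rightarrow> {0..1}" "g \<in> D \<rightarrow> {0..1}"
  shows "wsup t D w g \<in> {0..1}"
  unfolding wsup_def by (rule Sup_insert_0_in[OF wsup_image_in[OF assms]])

lemma wsup_le_iff:
  assumes "w \<in> D \<rightarrow> {0..1}" "g \<in> D \<rightarrow> {0..1}" "v \<in> {0..1}"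
  shows "wsup t D w g \<le> v \<longleftrightarrow> (\<forall>d\<in>D. t (w d) (g d) \<le> v)"
  unfolding wsup_def Sup_insert_0_le_iff[OF wsup_image_in[OF assms(1,2)]] using assms(3) by auto

lemma t_swap:
  assumes "u \<in> {0..1}" "v \<in> {0..1}" "w \<in> {0..1}"
  shows "t u (t v w) = t v (t u w)"
  using t_assoc[OF assms] t_assoc[OF assms(2,1,3)] t_comm[OF assms(1,2)] by metis

text \<open>\<open>t u\<close> is a left adjoint and so preserves suprema; \<open>t_swap\<close>
  carries \<open>u\<close> past the weights.\<close>

lemma t_wsup:
  assumes "w \<in> D \<rightarrow> {0..1}" "g \<in> D \<rightarrow> {0..1}" "u \<in> {0..1}"
  shows "t u (wsup t D w g) = wsup t D w (\<lambda>d. t u (g d))"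
proof (rule eq_of_ge_iff_unit)
  have g': "(\<lambda>d. t u (g d)) \<in> D \<rightarrow> {0..1}"
    using assms by (auto intro!: t_in simp del: atLeastAtMost_iff)
  show "wsup t D w (\<lambda>d. t u (g d)) \<in> {0..1}"
    using wsup_in[OF assms(1) g'] .
  show "t u (wsup t D w g) \<in> {0..1}"
    using t_in[OF assms(3) wsup_in[OF assms(1,2)]] .
  fix v :: real
  assume v: "v \<in> {0..1}"
  have "t u (wsup t D w g) \<le> v \<longleftrightarrow> wsup t D w g \<le> ihom t u v"
    using le_ihom_iff[OF assms(3) wsup_in[OF assms(1,2)] v] by simp
  also have "\<dots> \<longleftrightarrow> (\<forall>d\<in>D. t (w d) (g d) \<le> ihom t u v)"
    using wsup_le_iff[OF assms(1,2) ihom_in[OF assms(3) v]] .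
  also have "\<dots> \<longleftrightarrow> (\<forall>d\<in>D. t (w d) (t u (g d)) \<le> v)"
  proof (intro ball_cong refl)
    fix d assume "d \<in> D"
    then have d: "w d \<in> {0..1}" "g d \<in> {0..1}"
      using assms by blast+
    show "t (w d) (g d) \<le> ihom t u v \<longleftrightarrow> t (w d) (t u (g d)) \<le> v"
      using le_ihom_iff[OF assms(3) t_in[OF d] v] t_swap[OF assms(3) d] by simp
  qed
  also have "\<dots> \<longleftrightarrow> wsup t D w (\<lambda>d. t u (g d)) \<le> v"
    using wsup_le_iff[OF assms(1) g' v] by simp
  finally show "t u (wsup t D w g) \<le> v \<longleftrightarrow> wsup t D w (\<lambda>d. t u (g d)) \<le> v" .
qed

text \<open>Turns the supremum in the contravariant argument into a quantifier over
  \<open>D\<close>. In \<open>C X\<close> this quantifier is exchanged with the one over points,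
  which is how colimits there become pointwise.\<close>

lemma le_ihom_wsup_iff:
  assumes "w \<in> D \<rightarrow> {0..1}" "g \<in> D \<rightarrow> {0..1}" "v \<in> {0..1}" "y \<in> {0..1}"
  shows "v \<le> ihom t (wsup t D w g) y \<longleftrightarrow> (\<forall>d\<in>D. t (w d) v \<le> ihom t (g d) y)"
proof -
  have g': "(\<lambda>d. t v (g d)) \<in> D \<rightarrow> {0..1}"
    using assms by (auto intro!: t_in simp del: atLeastAtMost_iff)
  have "v \<le> ihom t (wsup t D w g) y \<longleftrightarrow> wsup t D w (\<lambda>d. t v (g d)) \<le> y"
    using le_ihom_iff[OF wsup_in[OF assms(1,2)] assms(3,4)] t_comm[OF wsup_in[OF assms(1,2)] assms(3)]
      t_wsup[OF assms(1-3)] by metis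
  also have "\<dots> \<longleftrightarrow> (\<forall>d\<in>D. t (w d) (t v (g d)) \<le> y)"
    using wsup_le_iff[OF assms(1) g' assms(4)] .
  also have "\<dots> \<longleftrightarrow> (\<forall>d\<in>D. t (w d) v \<le> ihom t (g d) y)"
  proof (intro ball_cong refl)
    fix d assume "d \<in> D"
    then have d: "w d \<in> {0..1}" "g d \<in> {0..1}"
      using assms by blast+
    show "t (w d) (t v (g d)) \<le> y \<longleftrightarrow> t (w d) v \<le> ihom t (g d) y"
      using le_ihom_iff[OF d(2) t_in[OF d(1) assms(3)] assms(4)] t_assoc[OF d(1) assms(3) d(2)]
        t_comm[OF d(2) t_in[OF d(1) assms(3)]] by metis
  qed
  finally show ?thesis .
qed

text \<open>This is the defining equation of a colimit in \<open>({0..1}, ihom t)\<close>.\<close>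

lemma ihom_wsup:
  assumes "w \<in> D \<rightarrow> {0..1}" "g \<in> D \<rightarrow> {0..1}" "y \<in> {0..1}"
  shows "ihom t (wsup t D w g) y = Inf (insert 1 ((\<lambda>d. ihom t (w d) (ihom t (g d) y)) ` D))"
proof (rule eq_of_le_iff_unit)
  have im: "(\<lambda>d. ihom t (w d) (ihom t (g d) y)) ` D \<subseteq> {0..1}"
    using assms by (auto intro!: ihom_in simp del: atLeastAtMost_iff)
  show "ihom t (wsup t D w g) y \<in> {0..1}"
    using ihom_in[OF wsup_in[OF assms(1,2)] assms(3)] .
  show "Inf (insert 1 ((\<lambda>d. ihom t (w d) (ihom t (g d) y)) ` D)) \<in> {0..1}"
    by (rule Inf_insert_1_in[OF im])
  fix v :: real
  assume v: "v \<in> {0..1}"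
  have "v \<le> Inf (insert 1 ((\<lambda>d. ihom t (w d) (ihom t (g d) y)) ` D)) \<longleftrightarrow>
    (\<forall>d\<in>D. v \<le> ihom t (w d) (ihom t (g d) y))"
    unfolding le_Inf_insert_1_iff[OF im] using v by auto
  also have "\<dots> \<longleftrightarrow> (\<forall>d\<in>D. t (w d) v \<le> ihom t (g d) y)"
  proof (intro ball_cong refl)
    fix d assume "d \<in> D"
    then have d: "w d \<in> {0..1}" "g d \<in> {0..1}"
      using assms by blast+
    show "v \<le> ihom t (w d) (ihom t (g d) y) \<longleftrightarrow> t (w d) v \<le> ihom t (g d) y"
      using le_ihom_iff[OF d(1) v ihom_in[OF d(2) assms(3)]] .
  qed
  finally show "v \<le> ihom t (wsup t D w g) y \<longleftrightarrow>
    v \<le> Inf (insert 1 ((\<lambda>d. ihom t (w d) (ihom t (g d) y)) ` D))"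
    using le_ihom_wsup_iff[OF assms(1,2) v assms(3)] by blast
qed

text \<open>A finite supremum is a maximum, built by adding one continuous function at a time. Here
  finiteness of the diagrams enters.\<close>

lemma continuous_map_wsup:
  assumes "finite D" "w \<in> D \<rightarrow> {0..1}"
    and "\<And>d. d \<in> D \<Longrightarrow> continuous_map T euclideanreal (\<lambda>x. g x d)"
    and "\<And>x d. d \<in> D \<Longrightarrow> x \<in> topspace T \<Longrightarrow> g x d \<in> {0..1}"
  shows "continuous_map T euclideanreal (\<lambda>x. wsup t D w (g x))"
proof -
  have "continuous_map T euclideanreal (\<lambda>x. Max (insert 0 ((\<lambda>d. t (w d) (g x d)) ` D)))"
    using assms
  proof (induction D rule: finite_induct)
    case (insert d D)
    have "continuous_map T euclideanreal (\<lambda>x. t (w d) (g x d))"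
      using insert.prems by (intro continuous_map_t) (auto simp: Pi_iff)
    moreover have "continuous_map T euclideanreal (\<lambda>x. Max (insert 0 ((\<lambda>d. t (w d) (g x d)) ` D)))"
      by (rule insert.IH) (use insert.prems in \<open>auto simp: Pi_iff\<close>)
    ultimately have "continuous_map T euclideanreal
        (\<lambda>x. max (t (w d) (g x d)) (Max (insert 0 ((\<lambda>d. t (w d) (g x d)) ` D))))"
      by (rule continuous_map_real_max)
    moreover have "Max (insert 0 ((\<lambda>d. t (w d) (g x d)) ` insert d D)) =
       max (t (w d) (g x d)) (Max (insert 0 ((\<lambda>d. t (w d) (g x d)) ` D)))" for x
      using insert(1) by (simp add: insert_commute[of 0])
    ultimately show ?case
      by simp
  qed simp
  then show ?thesis
    using assms(1) by (simp add: wsup_def cSup_eq_Max)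
qed

end

section \<open>The product and the Lukasiewicz tensor\<close>

lemma ihom_mult_tensor:
  assumes "u \<in> {0..1}" "w \<in> {0..1}"
  shows "ihom mult_tensor u w = (if u = 0 then 1 else min 1 (w / u))"
proof -
  \<comment> \<open>The case \<open>u = 0\<close> is separate because \<open>w / 0\<close> is
    \<open>0\<close>, while the residual is \<open>1\<close> there: every \<open>v\<close> satisfies
    the inequality.\<close>
  have "{v \<in> {0..1}. mult_tensor u v \<le> w} = {0..(if u = 0 then 1 else min 1 (w / u))}"
    using assms by (auto simp: mult_tensor_def field_simps)
  then show ?thesis
    using assms by (simp add: ihom_def)
qed

lemma ihom_lukasiewicz_tensor:
  assumes "u \<in> {0..1}" "w \<in> {0..1}"
  shows "ihom lukasiewicz_tensor u w = min 1 (w + 1 - u)"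
proof -
  have "{v \<in> {0..1}. lukasiewicz_tensor u v \<le> w} = {0..min 1 (w + 1 - u)}"
    using assms by (auto simp: lukasiewicz_tensor_def)
  then show ?thesis
    using assms by (simp add: ihom_def)
qed

lemma unit_tensor_mult: "unit_tensor mult_tensor"
proof
  fix u v w :: real
  assume u: "u \<in> {0..1}"
  show "mult_tensor 1 u = u"
    by (simp add: mult_tensor_def)
  have "continuous_on {0..1} (\<lambda>w. if u = 0 then 1 else min 1 (w / u))"
    by (cases "u = 0") (auto intro!: continuous_intros)
  then show "continuous_on {0..1} (ihom mult_tensor u)"
    using u by (subst continuous_on_cong[OF refl ihom_mult_tensor]) auto
  assume v: "v \<in> {0..1}"
  show "mult_tensor u v \<in> {0..1}"
    using u v by (auto simp: mult_tensor_def mult_le_one)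
  show "mult_tensor u v = mult_tensor v u"
    by (simp add: mult_tensor_def)
  show "ihom mult_tensor u v \<in> {0..1}"
    using u v by (simp add: ihom_mult_tensor)
  assume w: "w \<in> {0..1}"
  show "mult_tensor (mult_tensor u v) w = mult_tensor u (mult_tensor v w)"
    by (simp add: mult_tensor_def)
  show "v \<le> ihom mult_tensor u w \<longleftrightarrow> mult_tensor u v \<le> w"
    using u v w by (auto simp: ihom_mult_tensor mult_tensor_def field_simps)
next
  show "continuous_on ({0..1} \<times> {0..1}) (\<lambda>p. mult_tensor (fst p) (snd p))"
    unfolding mult_tensor_def by (intro continuous_intros)
next
  fix u e :: real
  assume u: "u \<in> {0..<1}" and e: "0 < e"
  have "(mult_tensor u ^^ n) 1 = u ^ n" for n
    by (induction n) (auto simp: mult_tensor_def)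
  then show "\<exists>n. (mult_tensor u ^^ n) 1 < e"
    using real_arch_pow_inv[OF e, of u] u by auto
qed

lemma unit_tensor_lukasiewicz: "unit_tensor lukasiewicz_tensor"
proof
  fix u v w :: real
  assume u: "u \<in> {0..1}"
  show "lukasiewicz_tensor 1 u = u"
    using u by (simp add: lukasiewicz_tensor_def)
  have "continuous_on {0..1} (\<lambda>w. min 1 (w + 1 - u))"
    by (intro continuous_intros)
  then show "continuous_on {0..1} (ihom lukasiewicz_tensor u)"
    using u by (subst continuous_on_cong[OF refl ihom_lukasiewicz_tensor]) auto
  assume v: "v \<in> {0..1}"
  show "lukasiewicz_tensor u v \<in> {0..1}"
    using u v by (auto simp: lukasiewicz_tensor_def)
  show "lukasiewicz_tensor u v = lukasiewicz_tensor v u"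
    by (simp add: lukasiewicz_tensor_def add.commute)
  show "ihom lukasiewicz_tensor u v \<in> {0..1}"
    using u v by (auto simp: ihom_lukasiewicz_tensor)
  assume w: "w \<in> {0..1}"
  show "lukasiewicz_tensor (lukasiewicz_tensor u v) w = lukasiewicz_tensor u (lukasiewicz_tensor v w)"
    using u v w by (auto simp: lukasiewicz_tensor_def max_def)
  show "v \<le> ihom lukasiewicz_tensor u w \<longleftrightarrow> lukasiewicz_tensor u v \<le> w"
    using u v w by (auto simp: ihom_lukasiewicz_tensor lukasiewicz_tensor_def)
next
  show "continuous_on ({0..1} \<times> {0..1}) (\<lambda>p. lukasiewicz_tensor (fst p) (snd p))"
    unfolding lukasiewicz_tensor_def by (intro continuous_intros)
next
  fix u e :: real
  assume u: "u \<in> {0..<1}" and e: "0 < e"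
  \<comment> \<open>Each factor lowers the power by \<open>1 - u\<close> until it reaches
    \<open>0\<close>, so with more than \<open>1 / (1 - u)\<close> factors the power is exactly
    \<open>0\<close>.\<close>
  have le: "(lukasiewicz_tensor u ^^ n) 1 \<le> max 0 (1 - n * (1 - u))" for n
  proof (induction n)
    case (Suc n)
    have "real (Suc n) * (1 - u) = (1 - u) + real n * (1 - u)"
      by (simp add: algebra_simps)
    then show ?case
      using Suc u by (simp add: lukasiewicz_tensor_def max_def split: if_splits)
  qed simp
  obtain n where "1 / (1 - u) < real n"
    using reals_Archimedean2 by blast
  then have "1 - n * (1 - u) \<le> 0"
    using u by (simp add: field_simps)
  then show "\<exists>n. (lukasiewicz_tensor u ^^ n) 1 < e"
    using le[of n] e by (intro exI[of _ n]) simp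
qed

section \<open>Colimits and morphisms\<close>

lemma finitely_cocontinuousD:
  assumes "finitely_cocontinuous t X a Y b f" "finite_weighted_diagram t X a D r h w" "is_colimit t X a D h w c"
  shows "is_colimit t Y b D (\<lambda>d. f (h d)) w (f c)"
  using assms unfolding finitely_cocontinuous_def by blast

text \<open>Morphisms are extensional and therefore appear wrapped in \<open>restrict\<close>.
  Diagrams and their colimits never leave \<open>X\<close>, so only the values there matter.\<close>

lemma finitely_cocontinuous_cong:
  assumes "\<And>x. x \<in> X \<Longrightarrow> f x = g x"
  shows "finitely_cocontinuous t X a Y b f \<longleftrightarrow> finitely_cocontinuous t X a Y b g"
proof -
  have *: "finitely_cocontinuous t X a Y b g"
    if "finitely_cocontinuous t X a Y b f" and eq: "\<And>x. x \<in> X \<Longrightarrow> f x = g x" for f g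
    unfolding finitely_cocontinuous_def
  proof (intro conjI allI impI)
    show "enriched_functor X a Y b g"
      using that by (auto simp: finitely_cocontinuous_def enriched_functor_def Pi_iff)
    fix D r h w c
    assume c: "finite_weighted_diagram t X a D r h w \<and> is_colimit t X a D h w c"
    then have "h d \<in> X" if "d \<in> D" for d
      using that by (auto simp: finite_weighted_diagram_def enriched_functor_def)
    moreover have "c \<in> X"
      using c by (simp add: is_colimit_def)
    moreover have "is_colimit t Y b D (\<lambda>d. f (h d)) w (f c)"
      using finitely_cocontinuousD[OF that(1)] c by blast
    ultimately show "is_colimit t Y b D (\<lambda>d. g (h d)) w (g c)"
      using eq by (simp add: is_colimit_def cong: image_cong)
  qed
  show ?thesis
    using *[of f g] *[of g f] assms by auto
qed

text \<open>Preservation by \<open>g\<close> applies to the image of the diagram under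
  \<open>f\<close>, which is again a diagram because \<open>f\<close> is an enriched
  functor.\<close>

lemma finitely_cocontinuous_compose:
  assumes "finitely_cocontinuous t X a Y b f" "finitely_cocontinuous t Y b Z c g"
  shows "finitely_cocontinuous t X a Z c (\<lambda>x. g (f x))"
  unfolding finitely_cocontinuous_def
proof (intro conjI allI impI)
  have f: "f \<in> X \<rightarrow> Y" "\<And>x x'. x \<in> X \<Longrightarrow> x' \<in> X \<Longrightarrow> a x x' \<le> b (f x) (f x')"
    and g: "g \<in> Y \<rightarrow> Z" "\<And>x x'. x \<in> Y \<Longrightarrow> x' \<in> Y \<Longrightarrow> b x x' \<le> c (g x) (g x')"
    using assms by (auto simp: finitely_cocontinuous_def enriched_functor_def)
  have ab: "a x x' \<le> c (g (f x)) (g (f x'))" if "x \<in> X" "x' \<in> X" for x x'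
    using f(2)[OF that] g(2)[of "f x" "f x'"] that f(1) by (auto intro: order_trans)
  show "enriched_functor X a Z c (\<lambda>x. g (f x))"
    using f(1) g(1) ab by (auto simp: enriched_functor_def)
  fix D r h w k
  assume k: "finite_weighted_diagram t X a D r h w \<and> is_colimit t X a D h w k"
  then have "is_colimit t Y b D (\<lambda>d. f (h d)) w (f k)"
    using finitely_cocontinuousD[OF assms(1)] by blast
  moreover have "finite_weighted_diagram t Y b D r (\<lambda>d. f (h d)) w"
  proof -
    have h: "h \<in> D \<rightarrow> X" "\<And>d d'. d \<in> D \<Longrightarrow> d' \<in> D \<Longrightarrow> r d d' \<le> a (h d) (h d')"
      using k by (auto simp: finite_weighted_diagram_def enriched_functor_def)
    have "r d d' \<le> b (f (h d)) (f (h d'))" if "d \<in> D" "d' \<in> D" for d d'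
      using h(2)[OF that] f(2)[of "h d" "h d'"] that h(1) by (auto intro: order_trans)
    then have "enriched_functor D r Y b (\<lambda>d. f (h d))"
      using h(1) f(1) by (auto simp: enriched_functor_def)
    then show ?thesis
      using k by (simp add: finite_weighted_diagram_def)
  qed
  ultimately show "is_colimit t Z c D (\<lambda>d. g (f (h d))) w (g (f k))"
    using finitely_cocontinuousD[OF assms(2)] by blast
qed

text \<open>Two colimits have the same distance to every element; evaluating at the colimits
  themselves gives distance \<open>1\<close> both ways.\<close>

lemma is_colimit_unique:
  assumes "enriched_category t X a" "separated X a" "is_colimit t X a D h w c" "is_colimit t X a D h w c'"
  shows "c = c'"
proof -
  have c: "c \<in> X" "c' \<in> X" "\<And>y. y \<in> X \<Longrightarrow> a c y = a c' y"
    using assms(3,4) by (auto simp: is_colimit_def)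
  moreover have "a c c = 1" "a c' c' = 1"
    using assms(1) c by (auto simp: enriched_category_def)
  ultimately show ?thesis
    using assms(2) c(3)[of c] c(3)[of c'] by (auto simp: separated_def natural_le_def)
qed

lemma finite_weighted_diagramD:
  assumes "finite_weighted_diagram t X a D r h w"
  shows "finite D" "h \<in> D \<rightarrow> X" "w \<in> D \<rightarrow> {0..1}"
  using assms by (auto simp: finite_weighted_diagram_def enriched_functor_def)

lemma elems_C_obj: "elems (C_obj t X) = poscomp_hom X (op_space unit_space)"
  by (simp add: C_obj_def)

lemma elems_C_obj_iff:
  assumes "poscomp X"
  shows "\<psi> \<in> elems (C_obj t X) \<longleftrightarrow> \<psi> \<in> extensional (points X) \<and> (\<forall>x\<in>points X. \<psi> x \<in> {0..1}) \<and>
    continuous_map (topol X) euclideanreal \<psi> \<and> (\<forall>x y. (x, y) \<in> order_rel X \<longrightarrow> \<psi> y \<le> \<psi> x)"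
proof -
  have "continuous_map (topol X) (top_of_set {0..1}) \<psi> \<longleftrightarrow>
      continuous_map (topol X) euclideanreal \<psi> \<and> (\<forall>x\<in>points X. \<psi> x \<in> {0..1})"
    by (auto simp: continuous_map_in_subtopology)
  then show ?thesis
    using poscompD(2)[OF assms] unfolding elems_C_obj poscomp_hom_def op_space_def unit_space_def
    by (auto simp: PiE_iff)
qed

lemma elems_C_obj_restrictI:
  assumes "poscomp X" "continuous_map (topol X) euclideanreal g" "\<And>x. x \<in> points X \<Longrightarrow> g x \<in> {0..1}"
    and "\<And>x y. (x, y) \<in> order_rel X \<Longrightarrow> x \<in> points X \<Longrightarrow> y \<in> points X \<Longrightarrow> g y \<le> g x"
  shows "restrict g (points X) \<in> elems (C_obj t X)"
proof -
  have "continuous_map (topol X) euclideanreal (restrict g (points X))"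
    using continuous_map_eq[OF assms(2)] by simp
  then show ?thesis
    unfolding elems_C_obj_iff[OF assms(1)] using assms(3,4) poscompD(2)[OF assms(1)] by auto
qed

lemma elems_C_obj_in:
  assumes "\<psi> \<in> elems (C_obj t X)" "x \<in> points X"
  shows "\<psi> x \<in> {0..1}"
  using assms by (auto simp: elems_C_obj poscomp_hom_def op_space_def unit_space_def PiE_iff)

lemma mult_of_C_obj: "x \<in> points X \<Longrightarrow> mult_of (C_obj t X) \<psi> \<psi>' x = t (\<psi> x) (\<psi>' x)"
  by (simp add: C_obj_def)

lemma laxmon_homD:
  assumes "f \<in> laxmon_hom t A B"
  shows "f \<in> elems A \<rightarrow>\<^sub>E elems B"
    and "finitely_cocontinuous t (elems A) (dist_of A) (elems B) (dist_of B) f"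
    and "a \<in> elems A \<Longrightarrow> a' \<in> elems A \<Longrightarrow> natural_le (dist_of B) (f (mult_of A a a')) (mult_of B (f a) (f a'))"
  using assms by (auto simp: laxmon_hom_def)

lemma points_G_obj: "points (G_obj t A) = laxmon_hom t A (unit_monoid t)"
  by (auto simp: G_obj_def Let_def laxmon_hom_def unit_monoid_def)

lemma laxmon_hom_unit_in: "\<Phi> \<in> laxmon_hom t A (unit_monoid t) \<Longrightarrow> a \<in> elems A \<Longrightarrow> \<Phi> a \<in> {0..1}"
  by (auto simp: laxmon_hom_def unit_monoid_def PiE_iff)

text \<open>With this and the rules that follow, closedness of a set is read off from its defining
  formula, down to inequalities and equations between continuous functions.\<close>

lemma closedin_Collect_all:
  "(\<And>i. closedin T {x \<in> topspace T. Q i x}) \<Longrightarrow> closedin T {x \<in> topspace T. \<forall>i. Q i x}"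
  using closedin_INT[of UNIV T "\<lambda>i. {x \<in> topspace T. Q i x}"]
  by (auto simp: Collect_all_eq[symmetric] intro: back_subst[of "closedin T"])

text \<open>\<open>P\<close> does not depend on \<open>x\<close>: the set is either the whole space
  or the one defined by \<open>Q\<close>.\<close>

lemma closedin_Collect_imp:
  "(P \<Longrightarrow> closedin T {x \<in> topspace T. Q x}) \<Longrightarrow> closedin T {x \<in> topspace T. P \<longrightarrow> Q x}"
  by (cases P) auto

lemma closedin_Collect_conj:
  "closedin T {x \<in> topspace T. P x} \<Longrightarrow> closedin T {x \<in> topspace T. Q x} \<Longrightarrow>
   closedin T {x \<in> topspace T. P x \<and> Q x}"
  using closedin_Int[of T "{x \<in> topspace T. P x}" "{x \<in> topspace T. Q x}"]
  by (auto intro: back_subst[of "closedin T"])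

lemma closedin_Collect_le:
  fixes f g :: "'a \<Rightarrow> real"
  assumes "continuous_map T euclideanreal f" "continuous_map T euclideanreal g"
  shows "closedin T {x \<in> topspace T. f x \<le> g x}"
proof -
  have "continuous_map T euclideanreal (\<lambda>x. g x - f x)"
    using assms by (intro continuous_intros)
  from closedin_continuous_map_preimage[OF this, of "{0..}"] show ?thesis
    by simp
qed

lemma closedin_Collect_eq:
  fixes f g :: "'a \<Rightarrow> real"
  assumes "continuous_map T euclideanreal f" "continuous_map T euclideanreal g"
  shows "closedin T {x \<in> topspace T. f x = g x}"
  using closedin_continuous_maps_eq[OF _ assms] by simp

section \<open>Colimits in the unit interval and, pointwise, in \<open>C X\<close>\<close>

context unit_tensor
begin

lemma is_colimit_unit_iff:
  assumes "w \<in> D \<rightarrow> {0..1}" "h \<in> D \<rightarrow> {0..1}"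
  shows "is_colimit t {0..1} (ihom t) D h w c \<longleftrightarrow> c = wsup t D w h"
proof
  assume "c = wsup t D w h"
  then show "is_colimit t {0..1} (ihom t) D h w c"
    using wsup_in[OF assms] ihom_wsup[OF assms] by (simp add: is_colimit_def)
next
  assume c: "is_colimit t {0..1} (ihom t) D h w c"
  then have cI: "c \<in> {0..1}"
    by (simp add: is_colimit_def)
  have eq: "ihom t c y = ihom t (wsup t D w h) y" if "y \<in> {0..1}" for y
    using c that ihom_wsup[OF assms that] unfolding is_colimit_def by simp
  show "c = wsup t D w h"
    using eq[OF cI] eq[OF wsup_in[OF assms]] ihom_eq_1_iff[OF cI cI] ihom_eq_1_iff[OF cI wsup_in[OF assms]]
      ihom_eq_1_iff[OF wsup_in[OF assms] cI] ihom_eq_1_iff[OF wsup_in[OF assms] wsup_in[OF assms]]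
    by auto
qed

text \<open>Cocontinuity is rewritten into inequalities and equations between values of
  \<open>f\<close>, a form whose solutions are closed under pointwise convergence.\<close>

lemma finitely_cocontinuous_unit_iff:
  assumes "enriched_category t X a"
  shows "finitely_cocontinuous t X a {0..1} (ihom t) f \<longleftrightarrow> f \<in> X \<rightarrow> {0..1} \<and>
    (\<forall>x x'. x \<in> X \<longrightarrow> x' \<in> X \<longrightarrow> t (a x x') (f x) \<le> f x') \<and>
    (\<forall>D r h w c. finite_weighted_diagram t X a D r h w \<longrightarrow> is_colimit t X a D h w c \<longrightarrow>
       f c = wsup t D w (\<lambda>d. f (h d)))"
proof (cases "f \<in> X \<rightarrow> {0..1}")
  case True
  have "enriched_functor X a {0..1} (ihom t) f \<longleftrightarrow> (\<forall>x x'. x \<in> X \<longrightarrow> x' \<in> X \<longrightarrow> t (a x x') (f x) \<le> f x')"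
  proof -
    have "a x x' \<le> ihom t (f x) (f x') \<longleftrightarrow> t (a x x') (f x) \<le> f x'" if "x \<in> X" "x' \<in> X" for x x'
    proof -
      have "a x x' \<in> {0..1}" "f x \<in> {0..1}" "f x' \<in> {0..1}"
        using assms that True by (auto simp: enriched_category_def)
      then show ?thesis
        using le_ihom_iff[of "f x" "a x x'" "f x'"] t_comm[of "f x" "a x x'"] by metis
    qed
    then show ?thesis
      using True unfolding enriched_functor_def by blast
  qed
  moreover have "is_colimit t {0..1} (ihom t) D (\<lambda>d. f (h d)) w (f c) \<longleftrightarrow> f c = wsup t D w (\<lambda>d. f (h d))"
    if "finite_weighted_diagram t X a D r h w" for D r h w c
  proof (rule is_colimit_unit_iff)
    show "w \<in> D \<rightarrow> {0..1}" "(\<lambda>d. f (h d)) \<in> D \<rightarrow> {0..1}"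
      using finite_weighted_diagramD(2,3)[OF that] True by blast+
  qed
  ultimately show ?thesis
    using True unfolding finitely_cocontinuous_def by blast
qed (auto simp: finitely_cocontinuous_def enriched_functor_def)

lemma laxmon_hom_unit_iff:
  assumes "laxmon t A"
  shows "\<Phi> \<in> laxmon_hom t A (unit_monoid t) \<longleftrightarrow> \<Phi> \<in> elems A \<rightarrow>\<^sub>E {0..1} \<and>
    (\<forall>x x'. x \<in> elems A \<longrightarrow> x' \<in> elems A \<longrightarrow> t (dist_of A x x') (\<Phi> x) \<le> \<Phi> x') \<and>
    (\<forall>D r h w c. finite_weighted_diagram t (elems A) (dist_of A) D r h w \<longrightarrow>
       is_colimit t (elems A) (dist_of A) D h w c \<longrightarrow> \<Phi> c = wsup t D w (\<lambda>d. \<Phi> (h d))) \<and>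
    (\<forall>x x'. x \<in> elems A \<longrightarrow> x' \<in> elems A \<longrightarrow> \<Phi> (mult_of A x x') \<le> t (\<Phi> x) (\<Phi> x'))"
proof (cases "\<Phi> \<in> elems A \<rightarrow>\<^sub>E {0..1}")
  case True
  have *: "natural_le (ihom t) (\<Phi> (mult_of A x x')) (t (\<Phi> x) (\<Phi> x')) \<longleftrightarrow> \<Phi> (mult_of A x x') \<le> t (\<Phi> x) (\<Phi> x')"
    if "x \<in> elems A" "x' \<in> elems A" for x x'
  proof -
    have "mult_of A x x' \<in> elems A"
      using assms that by (simp add: laxmon_def)
    then have "\<Phi> (mult_of A x x') \<in> {0..1}" "\<Phi> x \<in> {0..1}" "\<Phi> x' \<in> {0..1}"
      using True that by blast+
    then show ?thesis
      unfolding natural_le_def using ihom_eq_1_iff t_in by blast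
  qed
  have "enriched_category t (elems A) (dist_of A)"
    using assms by (simp add: laxmon_def)
  note fc = finitely_cocontinuous_unit_iff[OF this, of \<Phi>]
  have "\<Phi> \<in> elems A \<rightarrow> {0..1}"
    using True by blast
  then show ?thesis
    unfolding laxmon_hom_def unit_monoid_def using True * by (simp add: fc Ball_def)
qed (simp add: laxmon_hom_def unit_monoid_def)

lemma dist_image_in:
  assumes "\<psi> \<in> elems (C_obj t X)" "\<psi>' \<in> elems (C_obj t X)"
  shows "(\<lambda>x. ihom t (\<psi> x) (\<psi>' x)) ` points X \<subseteq> {0..1}"
  using assms elems_C_obj_in[of _ t X] by (auto intro!: ihom_in simp del: atLeastAtMost_iff)

lemma dist_C_obj_in:
  assumes "\<psi> \<in> elems (C_obj t X)" "\<psi>' \<in> elems (C_obj t X)"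
  shows "dist_of (C_obj t X) \<psi> \<psi>' \<in> {0..1}"
  using Inf_insert_1_in[OF dist_image_in[OF assms]] by (simp add: C_obj_def)

lemma le_dist_C_obj_iff:
  assumes "\<psi> \<in> elems (C_obj t X)" "\<psi>' \<in> elems (C_obj t X)" "v \<in> {0..1}"
  shows "v \<le> dist_of (C_obj t X) \<psi> \<psi>' \<longleftrightarrow> (\<forall>x\<in>points X. v \<le> ihom t (\<psi> x) (\<psi>' x))"
  using le_Inf_insert_1_iff[OF dist_image_in[OF assms(1,2)], of v] assms(3) by (simp add: C_obj_def)

lemma dist_C_obj_le:
  assumes "\<psi> \<in> elems (C_obj t X)" "\<psi>' \<in> elems (C_obj t X)" "x \<in> points X"
  shows "dist_of (C_obj t X) \<psi> \<psi>' \<le> ihom t (\<psi> x) (\<psi>' x)"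
  using le_dist_C_obj_iff[OF assms(1,2) dist_C_obj_in[OF assms(1,2)]] assms(3) by simp

lemma natural_le_C_obj_iff:
  assumes "\<psi> \<in> elems (C_obj t X)" "\<psi>' \<in> elems (C_obj t X)"
  shows "natural_le (dist_of (C_obj t X)) \<psi> \<psi>' \<longleftrightarrow> (\<forall>x\<in>points X. \<psi> x \<le> \<psi>' x)"
proof -
  have "natural_le (dist_of (C_obj t X)) \<psi> \<psi>' \<longleftrightarrow> 1 \<le> dist_of (C_obj t X) \<psi> \<psi>'"
    unfolding natural_le_def using dist_C_obj_in[OF assms] by auto
  also have "\<dots> \<longleftrightarrow> (\<forall>x\<in>points X. 1 \<le> ihom t (\<psi> x) (\<psi>' x))"
    using le_dist_C_obj_iff[OF assms, of 1] by simp
  also have "\<dots> \<longleftrightarrow> (\<forall>x\<in>points X. \<psi> x \<le> \<psi>' x)"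
  proof (intro ball_cong refl)
    fix x assume "x \<in> points X"
    then have x: "\<psi> x \<in> {0..1}" "\<psi>' x \<in> {0..1}"
      using elems_C_obj_in[OF assms(1)] elems_C_obj_in[OF assms(2)] by blast+
    show "1 \<le> ihom t (\<psi> x) (\<psi>' x) \<longleftrightarrow> \<psi> x \<le> \<psi>' x"
      using ihom_eq_1_iff[OF x] ihom_in[OF x] by auto
  qed
  finally show ?thesis .
qed

lemma enriched_category_C_obj: "enriched_category t (elems (C_obj t X)) (dist_of (C_obj t X))"
  unfolding enriched_category_def
proof (intro conjI ballI)
  fix \<psi>1 assume 1: "\<psi>1 \<in> elems (C_obj t X)"
  show "dist_of (C_obj t X) \<psi>1 \<psi>1 = 1"
    using natural_le_C_obj_iff[OF 1 1] by (simp add: natural_le_def)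
  fix \<psi>2 assume 2: "\<psi>2 \<in> elems (C_obj t X)"
  show "dist_of (C_obj t X) \<psi>1 \<psi>2 \<in> {0..1}"
    using dist_C_obj_in[OF 1 2] .
  fix \<psi>3 assume 3: "\<psi>3 \<in> elems (C_obj t X)"
  show "t (dist_of (C_obj t X) \<psi>1 \<psi>2) (dist_of (C_obj t X) \<psi>2 \<psi>3) \<le> dist_of (C_obj t X) \<psi>1 \<psi>3"
    unfolding le_dist_C_obj_iff[OF 1 3 t_in[OF dist_C_obj_in[OF 1 2] dist_C_obj_in[OF 2 3]]]
  proof
    fix x assume x: "x \<in> points X"
    have I: "\<psi>1 x \<in> {0..1}" "\<psi>2 x \<in> {0..1}" "\<psi>3 x \<in> {0..1}"
      using elems_C_obj_in[OF 1 x] elems_C_obj_in[OF 2 x] elems_C_obj_in[OF 3 x] by blast+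
    have "t (dist_of (C_obj t X) \<psi>1 \<psi>2) (dist_of (C_obj t X) \<psi>2 \<psi>3) \<le> t (ihom t (\<psi>1 x) (\<psi>2 x)) (ihom t (\<psi>2 x) (\<psi>3 x))"
      by (intro t_mono dist_C_obj_in ihom_in dist_C_obj_le 1 2 3 I x)
    also have "\<dots> \<le> ihom t (\<psi>1 x) (\<psi>3 x)"
      by (rule ihom_trans[OF I])
    finally show "t (dist_of (C_obj t X) \<psi>1 \<psi>2) (dist_of (C_obj t X) \<psi>2 \<psi>3) \<le> ihom t (\<psi>1 x) (\<psi>3 x)" .
  qed
qed

lemma C_obj_eqI:
  assumes "\<psi> \<in> elems (C_obj t X)" "\<psi>' \<in> elems (C_obj t X)" "\<And>x. x \<in> points X \<Longrightarrow> \<psi> x = \<psi>' x"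
  shows "\<psi> = \<psi>'"
  using assms by (intro extensionalityI[of _ "points X"]) (auto simp: elems_C_obj poscomp_hom_def PiE_iff)

lemma separated_C_obj: "separated (elems (C_obj t X)) (dist_of (C_obj t X))"
  unfolding separated_def
proof (intro ballI impI)
  fix \<psi> \<psi>' assume \<psi>: "\<psi> \<in> elems (C_obj t X)" "\<psi>' \<in> elems (C_obj t X)"
    and "natural_le (dist_of (C_obj t X)) \<psi> \<psi>' \<and> natural_le (dist_of (C_obj t X)) \<psi>' \<psi>"
  then show "\<psi> = \<psi>'"
    using natural_le_C_obj_iff[OF \<psi>] natural_le_C_obj_iff[OF \<psi>(2,1)] by (intro C_obj_eqI[OF \<psi>] antisym) auto
qed

lemma wsup_C_obj_in:
  assumes "poscomp X" "finite D" "w \<in> D \<rightarrow> {0..1}" "h \<in> D \<rightarrow> elems (C_obj t X)"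
  shows "(\<lambda>x\<in>points X. wsup t D w (\<lambda>d. h d x)) \<in> elems (C_obj t X)"
proof (rule elems_C_obj_restrictI[OF assms(1)])
  have hd: "h d \<in> elems (C_obj t X)" if "d \<in> D" for d
    using that assms(4) by blast
  have hI: "(\<lambda>d. h d x) \<in> D \<rightarrow> {0..1}" if "x \<in> points X" for x
    using elems_C_obj_in[OF hd that] by blast
  show "wsup t D w (\<lambda>d. h d x) \<in> {0..1}" if "x \<in> points X" for x
    using wsup_in[OF assms(3) hI[OF that]] .
  show "continuous_map (topol X) euclideanreal (\<lambda>x. wsup t D w (\<lambda>d. h d x))"
  proof (rule continuous_map_wsup[OF assms(2,3)])
    show "continuous_map (topol X) euclideanreal (\<lambda>x. h d x)" if "d \<in> D" for d
      using hd[OF that] by (simp add: elems_C_obj_iff[OF assms(1)])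
    show "h d x \<in> {0..1}" if "d \<in> D" "x \<in> points X" for x d
      using elems_C_obj_in[OF hd] that by blast
  qed
  fix x y assume xy: "(x, y) \<in> order_rel X" "x \<in> points X" "y \<in> points X"
  show "wsup t D w (\<lambda>d. h d y) \<le> wsup t D w (\<lambda>d. h d x)"
    unfolding wsup_le_iff[OF assms(3) hI[OF xy(3)] wsup_in[OF assms(3) hI[OF xy(2)]]]
  proof
    fix d assume d: "d \<in> D"
    have I: "w d \<in> {0..1}" "h d x \<in> {0..1}" "h d y \<in> {0..1}"
      using d assms(3) elems_C_obj_in[OF hd[OF d]] xy by blast+
    have "h d y \<le> h d x"
      using hd[OF d] xy(1) by (simp add: elems_C_obj_iff[OF assms(1)])
    then have "t (w d) (h d y) \<le> t (w d) (h d x)"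
      using I by (intro t_mono) auto
    also have "\<dots> \<le> wsup t D w (\<lambda>d. h d x)"
      using wsup_le_iff[OF assms(3) hI[OF xy(2)] wsup_in[OF assms(3) hI[OF xy(2)]]] d by simp
    finally show "t (w d) (h d y) \<le> wsup t D w (\<lambda>d. h d x)" .
  qed
qed

text \<open>A lower bound \<open>v\<close> of the distance from \<open>s\<close> to
  \<open>y\<close>, and one of the infimum over \<open>D\<close>, unfold to the same inequalities
  \<open>t (w d) v \<le> ihom t (h d x) (y x)\<close>, with the quantifiers over points and indices
  in either order. Separatedness makes the pointwise supremum the only colimit.\<close>

lemma is_colimit_C_obj_iff:
  assumes "poscomp X" "finite D" "w \<in> D \<rightarrow> {0..1}" "h \<in> D \<rightarrow> elems (C_obj t X)"
  shows "is_colimit t (elems (C_obj t X)) (dist_of (C_obj t X)) D h w c \<longleftrightarrow>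
    c = (\<lambda>x\<in>points X. wsup t D w (\<lambda>d. h d x))"
proof -
  let ?a = "dist_of (C_obj t X)"
  define s where "s = (\<lambda>x\<in>points X. wsup t D w (\<lambda>d. h d x))"
  have s: "s \<in> elems (C_obj t X)"
    unfolding s_def by (rule wsup_C_obj_in[OF assms])
  have hd: "h d \<in> elems (C_obj t X)" "w d \<in> {0..1}" if "d \<in> D" for d
    using that assms(3,4) by blast+
  have "is_colimit t (elems (C_obj t X)) ?a D h w s"
    unfolding is_colimit_def
  proof (intro conjI ballI s)
    fix y assume y: "y \<in> elems (C_obj t X)"
    have im: "(\<lambda>d. ihom t (w d) (?a (h d) y)) ` D \<subseteq> {0..1}"
      using ihom_in[OF hd(2) dist_C_obj_in[OF hd(1) y]] by blast
    show "?a s y = Inf (insert 1 ((\<lambda>d. ihom t (w d) (?a (h d) y)) ` D))"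
    proof (rule eq_of_le_iff_unit)
      show "?a s y \<in> {0..1}"
        by (rule dist_C_obj_in[OF s y])
      show "Inf (insert 1 ((\<lambda>d. ihom t (w d) (?a (h d) y)) ` D)) \<in> {0..1}"
        by (rule Inf_insert_1_in[OF im])
      fix v :: real assume v: "v \<in> {0..1}"
      have "v \<le> ?a s y \<longleftrightarrow> (\<forall>x\<in>points X. v \<le> ihom t (wsup t D w (\<lambda>d. h d x)) (y x))"
        unfolding le_dist_C_obj_iff[OF s y v] by (simp add: s_def)
      also have "\<dots> \<longleftrightarrow> (\<forall>x\<in>points X. \<forall>d\<in>D. t (w d) v \<le> ihom t (h d x) (y x))"
      proof (intro ball_cong refl le_ihom_wsup_iff[OF assms(3)] v)
        fix x assume "x \<in> points X"
        then show "(\<lambda>d. h d x) \<in> D \<rightarrow> {0..1}" "y x \<in> {0..1}"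
          using elems_C_obj_in[OF hd(1)] elems_C_obj_in[OF y] by blast+
      qed
      also have "\<dots> \<longleftrightarrow> (\<forall>d\<in>D. t (w d) v \<le> ?a (h d) y)"
        using le_dist_C_obj_iff[OF hd(1) y t_in[OF hd(2) v]] by blast
      also have "\<dots> \<longleftrightarrow> (\<forall>d\<in>D. v \<le> ihom t (w d) (?a (h d) y))"
        using le_ihom_iff[OF hd(2) v dist_C_obj_in[OF hd(1) y]] by blast
      also have "\<dots> \<longleftrightarrow> v \<le> Inf (insert 1 ((\<lambda>d. ihom t (w d) (?a (h d) y)) ` D))"
        unfolding le_Inf_insert_1_iff[OF im] using v by auto
      finally show "v \<le> ?a s y \<longleftrightarrow> v \<le> Inf (insert 1 ((\<lambda>d. ihom t (w d) (?a (h d) y)) ` D))" .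
    qed
  qed
  then show ?thesis
    using is_colimit_unique[OF enriched_category_C_obj separated_C_obj] unfolding s_def by blast
qed

text \<open>Distances and colimits in \<open>C X\<close> are computed pointwise, so maps into
  \<open>C X\<close> can be tested by evaluation. Multiplication in \<open>C X\<close> and
  transposition are both handled through this criterion.\<close>

lemma finitely_cocontinuous_C_obj_iff:
  assumes "poscomp X" "enriched_category t Y a" "f \<in> Y \<rightarrow> elems (C_obj t X)"
  shows "finitely_cocontinuous t Y a (elems (C_obj t X)) (dist_of (C_obj t X)) f \<longleftrightarrow>
    (\<forall>x\<in>points X. finitely_cocontinuous t Y a {0..1} (ihom t) (\<lambda>y. f y x))"
proof -
  have fy: "f y \<in> elems (C_obj t X)" if "y \<in> Y" for y
    using assms(3) that by blast
  have fI: "(\<lambda>y. f y x) \<in> Y \<rightarrow> {0..1}" if "x \<in> points X" for x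
    using elems_C_obj_in[OF fy that] by blast
  have "a y y' \<le> dist_of (C_obj t X) (f y) (f y') \<longleftrightarrow> (\<forall>x\<in>points X. a y y' \<le> ihom t (f y x) (f y' x))"
    if "y \<in> Y" "y' \<in> Y" for y y'
    using assms(2) that by (intro le_dist_C_obj_iff fy) (auto simp: enriched_category_def)
  then have F: "enriched_functor Y a (elems (C_obj t X)) (dist_of (C_obj t X)) f \<longleftrightarrow>
      (\<forall>x\<in>points X. enriched_functor Y a {0..1} (ihom t) (\<lambda>y. f y x))"
    using assms(3) fI unfolding enriched_functor_def by blast
  have C: "is_colimit t (elems (C_obj t X)) (dist_of (C_obj t X)) D (\<lambda>d. f (h d)) w (f c) \<longleftrightarrow>
      (\<forall>x\<in>points X. is_colimit t {0..1} (ihom t) D (\<lambda>d. f (h d) x) w (f c x))"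
    if D: "finite_weighted_diagram t Y a D r h w" and c: "is_colimit t Y a D h w c" for D r h w c
  proof -
    note D = finite_weighted_diagramD[OF D]
    have fh: "(\<lambda>d. f (h d)) \<in> D \<rightarrow> elems (C_obj t X)"
      using D(2) assms(3) by blast
    have fhI: "(\<lambda>d. f (h d) x) \<in> D \<rightarrow> {0..1}" if "x \<in> points X" for x
      using D(2) fI[OF that] by blast
    have "c \<in> Y"
      using c by (simp add: is_colimit_def)
    have "f c = (\<lambda>x\<in>points X. wsup t D w (\<lambda>d. f (h d) x)) \<longleftrightarrow>
        (\<forall>x\<in>points X. f c x = wsup t D w (\<lambda>d. f (h d) x))"
    proof
      assume "\<forall>x\<in>points X. f c x = wsup t D w (\<lambda>d. f (h d) x)"
      then show "f c = (\<lambda>x\<in>points X. wsup t D w (\<lambda>d. f (h d) x))"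
        by (intro C_obj_eqI[OF fy[OF \<open>c \<in> Y\<close>] wsup_C_obj_in[OF assms(1) D(1,3) fh]]) simp
    qed simp
    then show ?thesis
      using is_colimit_C_obj_iff[OF assms(1) D(1,3) fh] is_colimit_unit_iff[OF D(3) fhI] by simp
  qed
  show ?thesis
  proof (intro iffI ballI)
    fix x assume x: "x \<in> points X"
      and f: "finitely_cocontinuous t Y a (elems (C_obj t X)) (dist_of (C_obj t X)) f"
    show "finitely_cocontinuous t Y a {0..1} (ihom t) (\<lambda>y. f y x)"
      unfolding finitely_cocontinuous_def
    proof (intro conjI allI impI; (elim conjE)?)
      show "enriched_functor Y a {0..1} (ihom t) (\<lambda>y. f y x)"
        using f F x by (simp add: finitely_cocontinuous_def)
      fix D r h w c assume D: "finite_weighted_diagram t Y a D r h w" "is_colimit t Y a D h w c"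
      show "is_colimit t {0..1} (ihom t) D (\<lambda>d. f (h d) x) w (f c x)"
        using C[OF D] finitely_cocontinuousD[OF f D] x by blast
    qed
  next
    assume f: "\<forall>x\<in>points X. finitely_cocontinuous t Y a {0..1} (ihom t) (\<lambda>y. f y x)"
    show "finitely_cocontinuous t Y a (elems (C_obj t X)) (dist_of (C_obj t X)) f"
      unfolding finitely_cocontinuous_def
    proof (intro conjI allI impI; (elim conjE)?)
      show "enriched_functor Y a (elems (C_obj t X)) (dist_of (C_obj t X)) f"
        using f F by (simp add: finitely_cocontinuous_def)
      fix D r h w c assume D: "finite_weighted_diagram t Y a D r h w" "is_colimit t Y a D h w c"
      show "is_colimit t (elems (C_obj t X)) (dist_of (C_obj t X)) D (\<lambda>d. f (h d)) w (f c)"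
        unfolding C[OF D] using finitely_cocontinuousD[OF _ D] f by blast
    qed
  qed
qed

text \<open>The pointwise criterion, applied to the identity of \<open>C X\<close>.\<close>

lemma finitely_cocontinuous_eval:
  assumes "poscomp X" "x \<in> points X"
  shows "finitely_cocontinuous t (elems (C_obj t X)) (dist_of (C_obj t X)) {0..1} (ihom t) (\<lambda>\<psi>. \<psi> x)"
proof -
  have "finitely_cocontinuous t (elems (C_obj t X)) (dist_of (C_obj t X)) (elems (C_obj t X)) (dist_of (C_obj t X)) (\<lambda>\<psi>. \<psi>)"
    by (simp add: finitely_cocontinuous_def enriched_functor_def)
  then show ?thesis
    using finitely_cocontinuous_C_obj_iff[OF assms(1) enriched_category_C_obj, of "\<lambda>\<psi>. \<psi>"] assms(2) by simp
qed

lemma enriched_category_unit: "enriched_category t {0..1} (ihom t)"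
  unfolding enriched_category_def using ihom_in ihom_trans ihom_eq_1_iff by blast

lemma finitely_cocontinuous_t:
  assumes "u \<in> {0..1}"
  shows "finitely_cocontinuous t {0..1} (ihom t) {0..1} (ihom t) (t u)"
proof -
  have "t (ihom t x x') (t u x) \<le> t u x'" if "x \<in> {0..1}" "x' \<in> {0..1}" for x x'
  proof -
    \<comment> \<open>Functoriality of \<open>t u\<close> reduces to evaluation: moving
      \<open>u\<close> outside leaves \<open>t x (ihom t x x')\<close>, which is below
      \<open>x'\<close>.\<close>
    have "t (ihom t x x') (t u x) = t u (t x (ihom t x x'))"
      using t_swap[OF ihom_in[OF that] assms that(1)] t_comm[OF ihom_in[OF that] that(1)] by simp
    also have "\<dots> \<le> t u x'"
      using t_ihom_le[OF that] by (intro t_mono assms that t_in ihom_in) auto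
    finally show ?thesis .
  qed
  moreover have "t u c = wsup t D w (\<lambda>d. t u (h d))"
    if "finite_weighted_diagram t {0..1} (ihom t) D r h w" "is_colimit t {0..1} (ihom t) D h w c" for D r h w c
    using is_colimit_unit_iff[of w D h c] finite_weighted_diagramD[OF that(1)] that(2) t_wsup[of w D h u] assms
    by simp
  ultimately show ?thesis
    using t_in[OF assms] by (subst finitely_cocontinuous_unit_iff[OF enriched_category_unit]) (intro conjI allI impI funcsetI, auto)
qed

lemma mult_of_C_obj_in:
  assumes "poscomp X" "\<psi> \<in> elems (C_obj t X)" "\<psi>' \<in> elems (C_obj t X)"
  shows "mult_of (C_obj t X) \<psi> \<psi>' \<in> elems (C_obj t X)"
proof -
  have "restrict (\<lambda>x. t (\<psi> x) (\<psi>' x)) (points X) \<in> elems (C_obj t X)"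
  proof (rule elems_C_obj_restrictI[OF assms(1)])
    show "continuous_map (topol X) euclideanreal (\<lambda>x. t (\<psi> x) (\<psi>' x))"
      using assms by (intro continuous_map_t) (simp_all add: elems_C_obj_iff)
    show "t (\<psi> x) (\<psi>' x) \<in> {0..1}" if "x \<in> points X" for x
      using t_in[OF elems_C_obj_in[OF assms(2) that] elems_C_obj_in[OF assms(3) that]] .
    show "t (\<psi> y) (\<psi>' y) \<le> t (\<psi> x) (\<psi>' x)" if "(x, y) \<in> order_rel X" "x \<in> points X" "y \<in> points X" for x y
    proof (rule t_mono)
      show "\<psi> y \<le> \<psi> x" "\<psi>' y \<le> \<psi>' x"
        using assms that(1) by (simp_all add: elems_C_obj_iff)
    qed (intro elems_C_obj_in[OF assms(2)] elems_C_obj_in[OF assms(3)] that(2,3))+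
  qed
  then show ?thesis
    by (simp add: C_obj_def)
qed

lemma const_in_C_obj:
  assumes "poscomp X" "u \<in> {0..1}"
  shows "(\<lambda>x\<in>points X. u) \<in> elems (C_obj t X)"
  using assms by (intro elems_C_obj_restrictI) auto

theorem laxmon_C_obj:
  assumes "poscomp X"
  shows "laxmon t (C_obj t X)"
  unfolding laxmon_def
proof (intro conjI ballI)
  let ?C = "elems (C_obj t X)" and ?a = "dist_of (C_obj t X)" and ?m = "mult_of (C_obj t X)"
  show "enriched_category t ?C ?a" "separated ?C ?a"
    by (rule enriched_category_C_obj separated_C_obj)+
  show "finitely_cocomplete t ?C ?a"
    unfolding finitely_cocomplete_def using finite_weighted_diagramD is_colimit_C_obj_iff[OF assms] by metis
  show "\<exists>e\<in>?C. (\<forall>x\<in>?C. natural_le ?a x e) \<and> (\<forall>x\<in>?C. ?m e x = x)"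
  proof (intro bexI[of _ "\<lambda>x\<in>points X. 1"] conjI ballI)
    show e: "(\<lambda>x\<in>points X. 1) \<in> ?C"
      using const_in_C_obj[OF assms] by simp
    fix \<psi> assume \<psi>: "\<psi> \<in> ?C"
    show "natural_le ?a \<psi> (\<lambda>x\<in>points X. 1)"
      using natural_le_C_obj_iff[OF \<psi> e] elems_C_obj_in[OF \<psi>] by simp
    show "?m (\<lambda>x\<in>points X. 1) \<psi> = \<psi>"
    proof (rule C_obj_eqI[OF mult_of_C_obj_in[OF assms e \<psi>] \<psi>])
      fix x assume "x \<in> points X"
      then show "?m (\<lambda>x\<in>points X. 1) \<psi> x = \<psi> x"
        using t_1[OF elems_C_obj_in[OF \<psi>]] by (simp add: mult_of_C_obj)
    qed
  qed
  fix \<psi>1 assume 1: "\<psi>1 \<in> ?C"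
  show "finitely_cocontinuous t ?C ?a ?C ?a (?m \<psi>1)"
  proof (subst finitely_cocontinuous_C_obj_iff[OF assms enriched_category_C_obj], use mult_of_C_obj_in[OF assms 1] in blast, intro ballI)
    fix x assume x: "x \<in> points X"
    \<comment> \<open>At \<open>x\<close>, multiplication by \<open>\<psi>1\<close> is evaluation at
      \<open>x\<close> followed by multiplication by the number \<open>\<psi>1 x\<close>.\<close>
    have "finitely_cocontinuous t ?C ?a {0..1} (ihom t) (\<lambda>y. t (\<psi>1 x) (y x))"
      using finitely_cocontinuous_compose[OF finitely_cocontinuous_eval[OF assms x]
          finitely_cocontinuous_t[OF elems_C_obj_in[OF 1 x]]] .
    then show "finitely_cocontinuous t ?C ?a {0..1} (ihom t) (\<lambda>y. ?m \<psi>1 y x)"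
      using x by (simp add: mult_of_C_obj)
  qed
  fix \<psi>2 assume 2: "\<psi>2 \<in> ?C"
  show "?m \<psi>1 \<psi>2 \<in> ?C"
    using mult_of_C_obj_in[OF assms 1 2] .
  show "?m \<psi>1 \<psi>2 = ?m \<psi>2 \<psi>1"
  proof (rule C_obj_eqI[OF mult_of_C_obj_in[OF assms 1 2] mult_of_C_obj_in[OF assms 2 1]])
    fix x assume "x \<in> points X"
    then show "?m \<psi>1 \<psi>2 x = ?m \<psi>2 \<psi>1 x"
      using t_comm[OF elems_C_obj_in[OF 1] elems_C_obj_in[OF 2]] by (simp add: mult_of_C_obj)
  qed
  fix \<psi>3 assume 3: "\<psi>3 \<in> ?C"
  note m = mult_of_C_obj_in[OF assms]
  show "?m (?m \<psi>1 \<psi>2) \<psi>3 = ?m \<psi>1 (?m \<psi>2 \<psi>3)"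
  proof (rule C_obj_eqI[OF m[OF m[OF 1 2] 3] m[OF 1 m[OF 2 3]]])
    fix x assume "x \<in> points X"
    then show "?m (?m \<psi>1 \<psi>2) \<psi>3 x = ?m \<psi>1 (?m \<psi>2 \<psi>3) x"
      using t_assoc[OF elems_C_obj_in[OF 1] elems_C_obj_in[OF 2] elems_C_obj_in[OF 3]] by (simp add: mult_of_C_obj)
  qed
qed

text \<open>Cocontinuity, order and multiplication of \<open>C X\<close> are all pointwise. This is
  the core of the adjunction, since the maps on the right are points of \<open>G A\<close>.\<close>

theorem laxmon_hom_C_obj_iff:
  assumes "poscomp X" "laxmon t A" "f \<in> elems A \<rightarrow>\<^sub>E elems (C_obj t X)"
  shows "f \<in> laxmon_hom t A (C_obj t X) \<longleftrightarrow>
    (\<forall>x\<in>points X. (\<lambda>a\<in>elems A. f a x) \<in> laxmon_hom t A (unit_monoid t))"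
proof -
  have A: "enriched_category t (elems A) (dist_of A)" "\<And>a b. a \<in> elems A \<Longrightarrow> b \<in> elems A \<Longrightarrow> mult_of A a b \<in> elems A"
    using assms(2) by (auto simp: laxmon_def)
  have fa: "f a \<in> elems (C_obj t X)" if "a \<in> elems A" for a
    using assms(3) that by blast
  have fx: "f a x \<in> {0..1}" if "a \<in> elems A" "x \<in> points X" for a x
    using elems_C_obj_in[OF fa] that by blast
  have 1: "finitely_cocontinuous t (elems A) (dist_of A) (elems (C_obj t X)) (dist_of (C_obj t X)) f \<longleftrightarrow>
    (\<forall>x\<in>points X. finitely_cocontinuous t (elems A) (dist_of A) {0..1} (ihom t) (\<lambda>a\<in>elems A. f a x))"
  proof -
    have "f \<in> elems A \<rightarrow> elems (C_obj t X)"
      using assms(3) by blast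
    from finitely_cocontinuous_C_obj_iff[OF assms(1) A(1) this] show ?thesis
      using finitely_cocontinuous_cong[of "elems A" "\<lambda>a. f a _" "\<lambda>a\<in>elems A. f a _"] by simp
  qed
  have 2: "natural_le (dist_of (C_obj t X)) (f (mult_of A a a')) (mult_of (C_obj t X) (f a) (f a')) \<longleftrightarrow>
    (\<forall>x\<in>points X. natural_le (ihom t) (f (mult_of A a a') x) (t (f a x) (f a' x)))"
    if "a \<in> elems A" "a' \<in> elems A" for a a'
  proof -
    have "natural_le (ihom t) (f (mult_of A a a') x) (t (f a x) (f a' x)) \<longleftrightarrow> f (mult_of A a a') x \<le> t (f a x) (f a' x)"
      if "x \<in> points X" for x
      unfolding natural_le_def
      using ihom_eq_1_iff[OF fx[OF A(2)] t_in[OF fx fx]] \<open>a \<in> elems A\<close> \<open>a' \<in> elems A\<close> that by blast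
    then show ?thesis
      using natural_le_C_obj_iff[OF fa[OF A(2)] mult_of_C_obj_in[OF assms(1) fa fa]] that
      by (simp add: mult_of_C_obj)
  qed
  have "(\<lambda>a\<in>elems A. f a x) \<in> laxmon_hom t A (unit_monoid t) \<longleftrightarrow>
     finitely_cocontinuous t (elems A) (dist_of A) {0..1} (ihom t) (\<lambda>a\<in>elems A. f a x) \<and>
     (\<forall>a\<in>elems A. \<forall>a'\<in>elems A. natural_le (ihom t) (f (mult_of A a a') x) (t (f a x) (f a' x)))"
    if "x \<in> points X" for x
  proof -
    have "(\<lambda>a\<in>elems A. f a x) \<in> elems A \<rightarrow>\<^sub>E {0..1}"
      using fx[OF _ that] by (auto simp del: atLeastAtMost_iff)
    then show ?thesis
      unfolding laxmon_hom_def unit_monoid_def using A(2) by simp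
  qed
  moreover have "f \<in> laxmon_hom t A (C_obj t X) \<longleftrightarrow>
     finitely_cocontinuous t (elems A) (dist_of A) (elems (C_obj t X)) (dist_of (C_obj t X)) f \<and>
     (\<forall>a\<in>elems A. \<forall>a'\<in>elems A. natural_le (dist_of (C_obj t X)) (f (mult_of A a a')) (mult_of (C_obj t X) (f a) (f a')))"
    unfolding laxmon_hom_def using assms(3) by simp
  ultimately show ?thesis
    using 1 2 by auto
qed

end

section \<open>The adjunction\<close>

lemma poscomp_homD:
  assumes "f \<in> poscomp_hom X Y"
  shows "f \<in> points X \<rightarrow>\<^sub>E points Y" "continuous_map (topol X) (topol Y) f"
    "(x, y) \<in> order_rel X \<Longrightarrow> (f x, f y) \<in> order_rel Y"
  using assms by (auto simp: poscomp_hom_def)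

lemma compose_in_poscomp_hom:
  assumes "poscomp X" "f \<in> poscomp_hom X Y" "g \<in> poscomp_hom Y Z"
  shows "compose (points X) g f \<in> poscomp_hom X Z"
proof -
  have "continuous_map (topol X) (topol Z) (compose (points X) g f)"
    using continuous_map_eq[OF continuous_map_compose[OF poscomp_homD(2)[OF assms(2)] poscomp_homD(2)[OF assms(3)]]]
    by (simp add: compose_def)
  moreover have "compose (points X) g f \<in> points X \<rightarrow>\<^sub>E points Z"
    using poscomp_homD(1)[OF assms(2)] poscomp_homD(1)[OF assms(3)] by (auto simp: compose_def)
  moreover have "(compose (points X) g f x, compose (points X) g f y) \<in> order_rel Z" if "(x, y) \<in> order_rel X" for x y
    using poscomp_homD(3)[OF assms(3) poscomp_homD(3)[OF assms(2) that]] poscompD(2)[OF assms(1)] that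
    by (auto simp: compose_def)
  ultimately show ?thesis
    by (auto simp: poscomp_hom_def)
qed

lemma laxmon_mult_in: "laxmon t A \<Longrightarrow> a \<in> elems A \<Longrightarrow> a' \<in> elems A \<Longrightarrow> mult_of A a a' \<in> elems A"
  by (simp add: laxmon_def)

lemma order_rel_G_obj:
  "(\<Phi>, \<Psi>) \<in> order_rel (G_obj t A) \<longleftrightarrow> \<Phi> \<in> points (G_obj t A) \<and> \<Psi> \<in> points (G_obj t A) \<and> (\<forall>a\<in>elems A. \<Psi> a \<le> \<Phi> a)"
  unfolding points_G_obj by (simp add: G_obj_def Let_def)

lemma continuous_map_eval_G_obj:
  assumes "a \<in> elems A"
  shows "continuous_map (topol (G_obj t A)) euclideanreal (\<lambda>\<Phi>. \<Phi> a)"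
proof -
  have "continuous_map (product_topology (\<lambda>_. top_of_set {0..1::real}) (elems A)) (top_of_set {0..1}) (\<lambda>\<Phi>. \<Phi> a)"
    using continuous_map_product_coordinates[OF assms, of "\<lambda>_. top_of_set {0..1::real}"] .
  then show ?thesis
    unfolding G_obj_def Let_def
    by (simp add: continuous_map_from_subtopology continuous_map_into_fulltopology)
qed

lemma continuous_map_into_G_obj:
  assumes "f \<in> topspace T \<rightarrow> points (G_obj t A)"
    and "\<And>a. a \<in> elems A \<Longrightarrow> continuous_map T euclideanreal (\<lambda>x. f x a)"
  shows "continuous_map T (topol (G_obj t A)) f"
proof -
  have f: "f x \<in> elems A \<rightarrow>\<^sub>E {0..1}" if "x \<in> topspace T" for x
  proof -
    have "f x \<in> laxmon_hom t A (unit_monoid t)"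
      using assms(1) that by (auto simp: points_G_obj)
    then show ?thesis
      by (simp add: laxmon_hom_def unit_monoid_def)
  qed
  have "continuous_map T (product_topology (\<lambda>_. top_of_set {0..1}) (elems A)) f"
    unfolding continuous_map_componentwise
  proof (intro conjI ballI)
    show "f ` topspace T \<subseteq> extensional (elems A)"
      using f by (auto simp: PiE_iff)
    show "continuous_map T (top_of_set {0..1}) (\<lambda>x. f x a)" if "a \<in> elems A" for a
      using assms(2)[OF that] PiE_mem[OF f that] by (auto intro!: continuous_map_into_subtopology)
  qed
  moreover have "f \<in> topspace T \<rightarrow> laxmon_hom t A (unit_monoid t)"
    using assms(1) by (simp add: points_G_obj)
  ultimately show ?thesis
    by (simp add: G_obj_def Let_def continuous_map_into_subtopology)
qed

text \<open>The universal property of the initial structure: continuity and monotonicity into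
  \<open>G A\<close> are tested on the evaluations, and the reversed order of \<open>G A\<close>
  matches the order-reversing functions that make up \<open>C X\<close>.\<close>

lemma poscomp_hom_G_obj_iff:
  assumes "poscomp X"
  shows "f \<in> poscomp_hom X (G_obj t A) \<longleftrightarrow> f \<in> points X \<rightarrow>\<^sub>E points (G_obj t A) \<and>
    (\<forall>a\<in>elems A. (\<lambda>x\<in>points X. f x a) \<in> elems (C_obj t X))"
proof
  assume f: "f \<in> poscomp_hom X (G_obj t A)"
  note f' = poscomp_homD[OF f]
  show "f \<in> points X \<rightarrow>\<^sub>E points (G_obj t A) \<and> (\<forall>a\<in>elems A. (\<lambda>x\<in>points X. f x a) \<in> elems (C_obj t X))"
  proof (intro conjI ballI f'(1) elems_C_obj_restrictI[OF assms])
    fix a assume a: "a \<in> elems A"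
    show "continuous_map (topol X) euclideanreal (\<lambda>x. f x a)"
      using continuous_map_compose[OF f'(2) continuous_map_eval_G_obj[OF a]] by (simp add: o_def)
    show "f x a \<in> {0..1}" if "x \<in> points X" for x
      using laxmon_hom_unit_in[OF _ a] PiE_mem[OF f'(1) that] by (simp only: points_G_obj)
    show "f y a \<le> f x a" if "(x, y) \<in> order_rel X" for x y
      using f'(3)[OF that] a by (simp add: order_rel_G_obj)
  qed
next
  assume f: "f \<in> points X \<rightarrow>\<^sub>E points (G_obj t A) \<and> (\<forall>a\<in>elems A. (\<lambda>x\<in>points X. f x a) \<in> elems (C_obj t X))"
  have "continuous_map (topol X) (topol (G_obj t A)) f"
  proof (rule continuous_map_into_G_obj)
    show "f \<in> points X \<rightarrow> points (G_obj t A)"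
      using f by blast
    show "continuous_map (topol X) euclideanreal (\<lambda>x. f x a)" if "a \<in> elems A" for a
    proof -
      have "continuous_map (topol X) euclideanreal (\<lambda>x\<in>points X. f x a)"
        using f that by (simp add: elems_C_obj_iff[OF assms])
      then show ?thesis
        by (rule continuous_map_eq) simp
    qed
  qed
  moreover have "(f x, f y) \<in> order_rel (G_obj t A)" if xy: "(x, y) \<in> order_rel X" for x y
  proof -
    have x: "x \<in> points X" "y \<in> points X"
      using poscompD(2)[OF assms] xy by auto
    have "f y a \<le> f x a" if "a \<in> elems A" for a
    proof -
      have "(\<lambda>x\<in>points X. f x a) \<in> elems (C_obj t X)"
        using f that by blast
      then have "(\<lambda>x\<in>points X. f x a) y \<le> (\<lambda>x\<in>points X. f x a) x"
        unfolding elems_C_obj_iff[OF assms] using xy by blast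
      then show ?thesis
        using x by simp
    qed
    then show ?thesis
      unfolding order_rel_G_obj using f x by blast
  qed
  ultimately show "f \<in> poscomp_hom X (G_obj t A)"
    using f by (auto simp: poscomp_hom_def)
qed

section \<open>Compactness of \<open>G A\<close>, transposition and functoriality\<close>

context unit_tensor
begin

text \<open>By Tychonoff it is enough that the morphisms form a closed subset of a power of the unit
  interval. Each defining condition compares continuous functions of finitely many coordinates, as
  the tensor is continuous and diagrams are finite.\<close>

theorem poscomp_G_obj:
  assumes "laxmon t A"
  shows "poscomp (G_obj t A)"
proof (rule poscompI)
  let ?P = "product_topology (\<lambda>_. top_of_set {0..1::real}) (elems A)"
  let ?H = "laxmon_hom t A (unit_monoid t)"
  have topP: "topspace ?P = elems A \<rightarrow>\<^sub>E {0..1}"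
    by simp
  have cont: "continuous_map ?P euclideanreal (\<lambda>\<Phi>. \<Phi> a)" if "a \<in> elems A" for a
    using continuous_map_product_coordinates[OF that, of "\<lambda>_. top_of_set {0..1::real}"]
    by (rule continuous_map_into_fulltopology)
  have in01: "\<Phi> a \<in> {0..1}" if "\<Phi> \<in> topspace ?P" "a \<in> elems A" for \<Phi> a
    using that by (auto simp: PiE_iff)
  have A: "dist_of A a b \<in> {0..1}" if "a \<in> elems A" "b \<in> elems A" for a b
    using assms that unfolding laxmon_def enriched_category_def by blast
  have "?H = {\<Phi> \<in> topspace ?P.
    (\<forall>x x'. x \<in> elems A \<longrightarrow> x' \<in> elems A \<longrightarrow> t (dist_of A x x') (\<Phi> x) \<le> \<Phi> x') \<and>
    (\<forall>D r h w c. finite_weighted_diagram t (elems A) (dist_of A) D r h w \<longrightarrow>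
       is_colimit t (elems A) (dist_of A) D h w c \<longrightarrow> \<Phi> c = wsup t D w (\<lambda>d. \<Phi> (h d))) \<and>
    (\<forall>x x'. x \<in> elems A \<longrightarrow> x' \<in> elems A \<longrightarrow> \<Phi> (mult_of A x x') \<le> t (\<Phi> x) (\<Phi> x'))}"
    unfolding topP using laxmon_hom_unit_iff[OF assms] by blast
  moreover have "closedin ?P \<dots>"
  proof (intro closedin_Collect_conj closedin_Collect_all closedin_Collect_imp)
    fix x x' assume x: "x \<in> elems A" "x' \<in> elems A"
    show "closedin ?P {\<Phi> \<in> topspace ?P. t (dist_of A x x') (\<Phi> x) \<le> \<Phi> x'}"
      using x A[OF x] in01 by (intro closedin_Collect_le continuous_map_t cont) auto
    show "closedin ?P {\<Phi> \<in> topspace ?P. \<Phi> (mult_of A x x') \<le> t (\<Phi> x) (\<Phi> x')}"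
      using x laxmon_mult_in[OF assms x] in01 by (intro closedin_Collect_le continuous_map_t cont) auto
  next
    fix D r h w c
    assume D: "finite_weighted_diagram t (elems A) (dist_of A) D r h w" and c: "is_colimit t (elems A) (dist_of A) D h w c"
    note D = finite_weighted_diagramD[OF D]
    have h: "h d \<in> elems A" if "d \<in> D" for d
      using D(2) that by blast
    show "closedin ?P {\<Phi> \<in> topspace ?P. \<Phi> c = wsup t D w (\<lambda>d. \<Phi> (h d))}"
    proof (intro closedin_Collect_eq continuous_map_wsup D(1,3) cont h in01)
      show "c \<in> elems A"
        using c by (simp add: is_colimit_def)
    qed
  qed
  ultimately have closedH: "closedin ?P ?H"
    by simp
  have "compact_space (top_of_set {0..1::real})"
    by (rule compact_space_subtopology) simp
  then have "compact_space ?P"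
    by (simp add: compact_space_product_topology)
  then have "compactin ?P ?H"
    using closedH by (rule closedin_compact_space)
  then show "compact_space (topol (G_obj t A))"
    by (simp add: G_obj_def Let_def compactin_subspace)
  let ?T = "topol (G_obj t A)"
  let ?T2 = "prod_topology ?T ?T"
  have "order_rel (G_obj t A) = {p \<in> topspace ?T2. \<forall>a. a \<in> elems A \<longrightarrow> snd p a \<le> fst p a}"
    using order_rel_G_obj[of _ _ t A] by auto
  moreover have "closedin ?T2 \<dots>"
  proof (intro closedin_Collect_all closedin_Collect_imp closedin_Collect_le)
    fix a assume a: "a \<in> elems A"
    note e = continuous_map_eval_G_obj[OF a, of t]
    show "continuous_map ?T2 euclideanreal (\<lambda>p. snd p a)"
      using continuous_map_compose[OF continuous_map_snd e] by (simp add: o_def)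
    show "continuous_map ?T2 euclideanreal (\<lambda>p. fst p a)"
      using continuous_map_compose[OF continuous_map_fst e] by (simp add: o_def)
  qed
  ultimately show "closedin ?T2 (order_rel (G_obj t A))"
    by simp
  show "order_rel (G_obj t A) \<subseteq> points (G_obj t A) \<times> points (G_obj t A)"
    using order_rel_G_obj[of _ _ t A] by auto
  show "(\<Phi>, \<Phi>) \<in> order_rel (G_obj t A)" if "\<Phi> \<in> points (G_obj t A)" for \<Phi>
    using that by (simp add: order_rel_G_obj)
  show "(\<Phi>, \<Xi>) \<in> order_rel (G_obj t A)"
    if "(\<Phi>, \<Psi>) \<in> order_rel (G_obj t A)" "(\<Psi>, \<Xi>) \<in> order_rel (G_obj t A)" for \<Phi> \<Psi> \<Xi>
    using that by (simp add: order_rel_G_obj) (meson order_trans)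
  show "\<Phi> = \<Psi>" if "(\<Phi>, \<Psi>) \<in> order_rel (G_obj t A)" "(\<Psi>, \<Phi>) \<in> order_rel (G_obj t A)" for \<Phi> \<Psi>
  proof (rule extensionalityI)
    show "\<Phi> \<in> extensional (elems A)" "\<Psi> \<in> extensional (elems A)"
      using that unfolding order_rel_G_obj points_G_obj laxmon_hom_def by (auto simp: PiE_iff)
    show "\<Phi> a = \<Psi> a" if "a \<in> elems A" for a
      using \<open>(\<Phi>, \<Psi>) \<in> _\<close> \<open>(\<Psi>, \<Phi>) \<in> _\<close> that unfolding order_rel_G_obj by (simp add: antisym)
  qed
qed

text \<open>Transposition swaps two arguments. The local fact \<open>iff\<close> matches the
  conditions on both sides, by initiality of \<open>G A\<close> and the pointwise description of
  morphisms into \<open>C X\<close>. Swapping twice is the identity because all functions are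
  extensional in both arguments.\<close>

theorem transpose_map_bij:
  assumes "poscomp X" "laxmon t A"
  shows "bij_betw (transpose_map X A) (poscomp_hom X (G_obj t A)) (laxmon_hom t A (C_obj t X))"
proof (rule bij_betw_byWitness[of _ "\<lambda>f. \<lambda>x\<in>points X. \<lambda>a\<in>elems A. f a x"])
  have iff: "h \<in> poscomp_hom X (G_obj t A) \<longleftrightarrow> transpose_map X A h \<in> laxmon_hom t A (C_obj t X)"
    if h: "h \<in> extensional (points X)" "\<And>x. x \<in> points X \<Longrightarrow> h x \<in> extensional (elems A)" for h
  proof -
    have hx: "(\<lambda>a\<in>elems A. transpose_map X A h a x) = h x" if "x \<in> points X" for x
      using h(2)[OF that] that by (auto simp: transpose_map_def extensional_def fun_eq_iff)
    have "h \<in> poscomp_hom X (G_obj t A) \<longleftrightarrow> (\<forall>x\<in>points X. h x \<in> laxmon_hom t A (unit_monoid t)) \<and>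
        (\<forall>a\<in>elems A. (\<lambda>x\<in>points X. h x a) \<in> elems (C_obj t X))"
      unfolding poscomp_hom_G_obj_iff[OF assms(1)] points_G_obj using h(1) by (auto simp: PiE_iff)
    also have "(\<forall>a\<in>elems A. (\<lambda>x\<in>points X. h x a) \<in> elems (C_obj t X)) \<longleftrightarrow>
        transpose_map X A h \<in> elems A \<rightarrow>\<^sub>E elems (C_obj t X)"
      by (simp add: transpose_map_def PiE_iff)
    also have "(\<forall>x\<in>points X. h x \<in> laxmon_hom t A (unit_monoid t)) \<longleftrightarrow>
        (\<forall>x\<in>points X. (\<lambda>a\<in>elems A. transpose_map X A h a x) \<in> laxmon_hom t A (unit_monoid t))"
      by (simp add: hx)
    also have "\<dots> \<and> transpose_map X A h \<in> elems A \<rightarrow>\<^sub>E elems (C_obj t X) \<longleftrightarrow>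
        transpose_map X A h \<in> laxmon_hom t A (C_obj t X)"
      using laxmon_hom_C_obj_iff[OF assms, of "transpose_map X A h"] laxmon_homD(1) by blast
    finally show ?thesis .
  qed
  have ext: "h \<in> extensional (points X)" "x \<in> points X \<Longrightarrow> h x \<in> extensional (elems A)"
    if "h \<in> poscomp_hom X (G_obj t A)" for h x
    using poscomp_homD(1)[OF that] by (auto simp: points_G_obj PiE_iff laxmon_hom_def)
  show "\<forall>h\<in>poscomp_hom X (G_obj t A). (\<lambda>x\<in>points X. \<lambda>a\<in>elems A. transpose_map X A h a x) = h"
  proof
    fix h assume h: "h \<in> poscomp_hom X (G_obj t A)"
    show "(\<lambda>x\<in>points X. \<lambda>a\<in>elems A. transpose_map X A h a x) = h"
    proof (rule extensionalityI[OF _ ext(1)[OF h]])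
      fix x assume x: "x \<in> points X"
      show "(\<lambda>x\<in>points X. \<lambda>a\<in>elems A. transpose_map X A h a x) x = h x"
        by (rule extensionalityI[OF _ ext(2)[OF h x]]) (use x in \<open>auto simp: transpose_map_def\<close>)
    qed simp
  qed
  show "transpose_map X A ` poscomp_hom X (G_obj t A) \<subseteq> laxmon_hom t A (C_obj t X)"
  proof (intro image_subsetI)
    fix h assume h: "h \<in> poscomp_hom X (G_obj t A)"
    then show "transpose_map X A h \<in> laxmon_hom t A (C_obj t X)"
      using iff[OF ext(1)[OF h] ext(2)[OF h]] by simp
  qed
  have inv: "transpose_map X A (\<lambda>x\<in>points X. \<lambda>a\<in>elems A. f a x) = f" if f: "f \<in> laxmon_hom t A (C_obj t X)" for f
  proof (rule extensionalityI)
    note f' = laxmon_homD(1)[OF f]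
    show "f \<in> extensional (elems A)"
      using f' by (simp add: PiE_iff)
    fix a assume a: "a \<in> elems A"
    then have "f a \<in> extensional (points X)"
      using PiE_mem[OF f' a] by (simp add: elems_C_obj_iff[OF assms(1)])
    then show "transpose_map X A (\<lambda>x\<in>points X. \<lambda>a\<in>elems A. f a x) a = f a"
      using a by (auto simp: transpose_map_def extensional_def fun_eq_iff)
  qed (simp add: transpose_map_def)
  then show "\<forall>f\<in>laxmon_hom t A (C_obj t X). transpose_map X A (\<lambda>x\<in>points X. \<lambda>a\<in>elems A. f a x) = f"
    by blast
  show "(\<lambda>f. \<lambda>x\<in>points X. \<lambda>a\<in>elems A. f a x) ` laxmon_hom t A (C_obj t X) \<subseteq> poscomp_hom X (G_obj t A)"
  proof (intro image_subsetI)
    fix f assume f: "f \<in> laxmon_hom t A (C_obj t X)"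
    show "(\<lambda>x\<in>points X. \<lambda>a\<in>elems A. f a x) \<in> poscomp_hom X (G_obj t A)"
      by (subst iff) (use inv[OF f] f in simp_all)
  qed
qed

text \<open>The identity of \<open>C X\<close> is a morphism, and by the pointwise criterion so are
  its evaluations.\<close>

lemma eval_in_laxmon_hom:
  assumes "poscomp X" "x \<in> points X"
  shows "(\<lambda>\<psi>\<in>elems (C_obj t X). \<psi> x) \<in> laxmon_hom t (C_obj t X) (unit_monoid t)"
proof -
  let ?C = "elems (C_obj t X)"
  have "(\<lambda>\<psi>\<in>?C. \<psi>) \<in> laxmon_hom t (C_obj t X) (C_obj t X)"
  proof -
    have "finitely_cocontinuous t ?C (dist_of (C_obj t X)) ?C (dist_of (C_obj t X)) (\<lambda>\<psi>. \<psi>)"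
      by (simp add: finitely_cocontinuous_def enriched_functor_def)
    then have "finitely_cocontinuous t ?C (dist_of (C_obj t X)) ?C (dist_of (C_obj t X)) (\<lambda>\<psi>\<in>?C. \<psi>)"
      by (subst finitely_cocontinuous_cong[of _ _ "\<lambda>\<psi>. \<psi>"]) auto
    then show ?thesis
      using mult_of_C_obj_in[OF assms(1)] by (simp add: laxmon_hom_def natural_le_C_obj_iff)
  qed
  then have "(\<lambda>a\<in>?C. (\<lambda>\<psi>\<in>?C. \<psi>) a x) \<in> laxmon_hom t (C_obj t X) (unit_monoid t)"
    using laxmon_hom_C_obj_iff[OF assms(1) laxmon_C_obj[OF assms(1)], of "\<lambda>\<psi>\<in>?C. \<psi>"] assms(2)
      laxmon_homD(1) by blast
  moreover have "(\<lambda>a\<in>?C. (\<lambda>\<psi>\<in>?C. \<psi>) a x) = (\<lambda>\<psi>\<in>?C. \<psi> x)"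
    by auto
  ultimately show ?thesis
    by simp
qed

lemma GC_unit_in:
  assumes "poscomp X"
  shows "GC_unit t X \<in> poscomp_hom X (GC_obj t X)"
  unfolding GC_obj_def poscomp_hom_G_obj_iff[OF assms]
proof (intro conjI ballI)
  show "GC_unit t X \<in> points X \<rightarrow>\<^sub>E points (G_obj t (C_obj t X))"
    using eval_in_laxmon_hom[OF assms] by (auto simp: GC_unit_def points_G_obj)
  fix \<psi> assume \<psi>: "\<psi> \<in> elems (C_obj t X)"
  have "(\<lambda>x\<in>points X. GC_unit t X x \<psi>) = \<psi>"
    using \<psi> by (auto simp: GC_unit_def elems_C_obj_iff[OF assms] extensional_def)
  then show "(\<lambda>x\<in>points X. GC_unit t X x \<psi>) \<in> elems (C_obj t X)"
    using \<psi> by simp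
qed

lemma natural_le_functor:
  assumes "enriched_functor X a Y b f" "enriched_category t Y b" "x \<in> X" "x' \<in> X" "natural_le a x x'"
  shows "natural_le b (f x) (f x')"
proof -
  have "b (f x) (f x') \<in> {0..1}" "a x x' \<le> b (f x) (f x')"
    using assms by (auto simp: enriched_functor_def enriched_category_def Pi_iff)
  then show ?thesis
    using assms(5) by (simp add: natural_le_def)
qed

lemma natural_le_trans:
  assumes "enriched_category t X a" "x \<in> X" "y \<in> X" "z \<in> X" "natural_le a x y" "natural_le a y z"
  shows "natural_le a x z"
proof -
  have "t (a x y) (a y z) \<le> a x z" "a x z \<in> {0..1}"
    using assms(1-4) by (auto simp: enriched_category_def)
  then show ?thesis
    using assms(5,6) t_1[of 1] by (simp add: natural_le_def)
qed

lemma compose_in_laxmon_hom_unit: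
  assumes "laxmon t A" "laxmon t B" "f \<in> laxmon_hom t A B" "\<Phi> \<in> laxmon_hom t B (unit_monoid t)"
  shows "compose (elems A) \<Phi> f \<in> laxmon_hom t A (unit_monoid t)"
proof -
  note f = laxmon_homD[OF assms(3)] and \<Phi> = laxmon_homD[OF assms(4)]
  have fa: "f a \<in> elems B" if "a \<in> elems A" for a
    using f(1) that by blast
  have \<Phi>b: "\<Phi> b \<in> {0..1}" if "b \<in> elems B" for b
    using laxmon_hom_unit_in[OF assms(4) that] .
  have "finitely_cocontinuous t (elems A) (dist_of A) {0..1} (ihom t) (\<lambda>a. \<Phi> (f a))"
    using finitely_cocontinuous_compose[OF f(2) \<Phi>(2)] by (simp add: unit_monoid_def)
  then have "finitely_cocontinuous t (elems A) (dist_of A) {0..1} (ihom t) (compose (elems A) \<Phi> f)"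
    by (subst finitely_cocontinuous_cong[of _ _ "\<lambda>a. \<Phi> (f a)"]) (auto simp: compose_def)
  \<comment> \<open>\<open>\<Phi>\<close> is monotone, so it may be applied to the laxness
    inequality of \<open>f\<close>; its own laxness then finishes.\<close>
  moreover have "natural_le (ihom t) (\<Phi> (f (mult_of A a a'))) (t (\<Phi> (f a)) (\<Phi> (f a')))"
    if a: "a \<in> elems A" "a' \<in> elems A" for a a'
  proof (rule natural_le_trans[OF enriched_category_unit])
    note m = laxmon_mult_in[OF assms(1) a] laxmon_mult_in[OF assms(2) fa[OF a(1)] fa[OF a(2)]]
    have "enriched_functor (elems B) (dist_of B) {0..1} (ihom t) \<Phi>"
      using \<Phi>(2) by (simp add: finitely_cocontinuous_def unit_monoid_def)
    then show "natural_le (ihom t) (\<Phi> (f (mult_of A a a'))) (\<Phi> (mult_of B (f a) (f a')))"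
      using enriched_category_unit fa[OF m(1)] m(2) f(3)[OF a] by (rule natural_le_functor)
    show "natural_le (ihom t) (\<Phi> (mult_of B (f a) (f a'))) (t (\<Phi> (f a)) (\<Phi> (f a')))"
      using \<Phi>(3)[OF fa[OF a(1)] fa[OF a(2)]] by (simp add: unit_monoid_def)
    show "\<Phi> (f (mult_of A a a')) \<in> {0..1}"
      by (rule \<Phi>b[OF fa[OF m(1)]])
    show "\<Phi> (mult_of B (f a) (f a')) \<in> {0..1}"
      by (rule \<Phi>b[OF m(2)])
    show "t (\<Phi> (f a)) (\<Phi> (f a')) \<in> {0..1}"
      by (rule t_in[OF \<Phi>b[OF fa[OF a(1)]] \<Phi>b[OF fa[OF a(2)]]])
  qed
  moreover have "compose (elems A) \<Phi> f \<in> elems A \<rightarrow>\<^sub>E {0..1}"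
    using \<Phi>b[OF fa] by (auto simp: compose_def simp del: atLeastAtMost_iff)
  ultimately show ?thesis
    unfolding laxmon_hom_def unit_monoid_def using laxmon_mult_in[OF assms(1)]
    by (simp add: compose_eq)
qed

lemma CG_unit_elem:
  assumes "laxmon t A" "a \<in> elems A"
  shows "(\<lambda>\<Phi>\<in>points (G_obj t A). \<Phi> a) \<in> elems (C_obj t (G_obj t A))"
proof (rule elems_C_obj_restrictI[OF poscomp_G_obj[OF assms(1)] continuous_map_eval_G_obj[OF assms(2)]])
  show "\<Phi> a \<in> {0..1}" if "\<Phi> \<in> points (G_obj t A)" for \<Phi>
    using laxmon_hom_unit_in[OF _ assms(2)] that unfolding points_G_obj .
qed (use assms(2) in \<open>simp add: order_rel_G_obj\<close>)

text \<open>The coordinate at \<open>a\<close> is evaluation at \<open>k a\<close>, which is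
  continuous and order-reversing by \<open>CG_unit_elem\<close>.\<close>

theorem G_map_in:
  assumes "laxmon t A" "laxmon t B" "k \<in> laxmon_hom t A B"
  shows "G_map t A B k \<in> poscomp_hom (G_obj t B) (G_obj t A)"
  unfolding poscomp_hom_G_obj_iff[OF poscomp_G_obj[OF assms(2)]]
proof (intro conjI ballI)
  show "G_map t A B k \<in> points (G_obj t B) \<rightarrow>\<^sub>E points (G_obj t A)"
    using compose_in_laxmon_hom_unit[OF assms] by (auto simp: G_map_def points_G_obj)
  fix a assume a: "a \<in> elems A"
  then have "k a \<in> elems B"
    using laxmon_homD(1)[OF assms(3)] by blast
  moreover have "(\<lambda>\<Phi>\<in>points (G_obj t B). G_map t A B k \<Phi> a) = (\<lambda>\<Phi>\<in>points (G_obj t B). \<Phi> (k a))"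
    using a by (auto simp: G_map_def compose_eq)
  ultimately show "(\<lambda>\<Phi>\<in>points (G_obj t B). G_map t A B k \<Phi> a) \<in> elems (C_obj t (G_obj t B))"
    using CG_unit_elem[OF assms(2)] by simp
qed

text \<open>Its evaluation at a point \<open>\<Phi>\<close> of \<open>G A\<close> is
  \<open>\<Phi>\<close> itself, so the pointwise criterion holds tautologically.\<close>

lemma CG_unit_in:
  assumes "laxmon t A"
  shows "CG_unit t A \<in> laxmon_hom t A (C_obj t (G_obj t A))"
proof -
  have "CG_unit t A \<in> elems A \<rightarrow>\<^sub>E elems (C_obj t (G_obj t A))"
    using CG_unit_elem[OF assms] by (auto simp: CG_unit_def)
  moreover have "(\<lambda>a\<in>elems A. CG_unit t A a \<Phi>) = \<Phi>" if "\<Phi> \<in> points (G_obj t A)" for \<Phi>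
  proof (rule extensionalityI[of _ "elems A"])
    show "\<Phi> \<in> extensional (elems A)"
      using that unfolding points_G_obj by (auto simp: laxmon_hom_def PiE_iff)
  qed (use that in \<open>auto simp: CG_unit_def\<close>)
  ultimately show ?thesis
    using laxmon_hom_C_obj_iff[OF poscomp_G_obj[OF assms] assms] by (simp add: points_G_obj)
qed

theorem C_map_in:
  assumes "poscomp X" "poscomp Y" "f \<in> poscomp_hom X Y"
  shows "C_map t X Y f \<in> laxmon_hom t (C_obj t Y) (C_obj t X)"
proof -
  have "C_map t X Y f \<in> elems (C_obj t Y) \<rightarrow>\<^sub>E elems (C_obj t X)"
    using compose_in_poscomp_hom[OF assms(1,3)] by (auto simp: C_map_def elems_C_obj)
  moreover have "(\<lambda>\<psi>\<in>elems (C_obj t Y). C_map t X Y f \<psi> x) = (\<lambda>\<psi>\<in>elems (C_obj t Y). \<psi> (f x))" if "x \<in> points X" for x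
    using that by (auto simp: C_map_def compose_eq)
  moreover have "f x \<in> points Y" if "x \<in> points X" for x
    using poscomp_homD(1)[OF assms(3)] that by blast
  ultimately show ?thesis
    using laxmon_hom_C_obj_iff[OF assms(1) laxmon_C_obj[OF assms(2)]] eval_in_laxmon_hom[OF assms(2)] by simp
qed

lemma poscomp_GC_obj: "poscomp X \<Longrightarrow> poscomp (GC_obj t X)"
  unfolding GC_obj_def by (intro poscomp_G_obj laxmon_C_obj)

lemma GC_map_in:
  assumes "poscomp X" "poscomp Y" "f \<in> poscomp_hom X Y"
  shows "GC_map t X Y f \<in> poscomp_hom (GC_obj t X) (GC_obj t Y)"
  unfolding GC_map_def GC_obj_def using assms by (intro G_map_in laxmon_C_obj C_map_in)

lemma GC_mult_in:
  assumes "poscomp X"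
  shows "GC_mult t X \<in> poscomp_hom (GC_obj t (GC_obj t X)) (GC_obj t X)"
  unfolding GC_mult_def GC_obj_def using assms
  by (intro G_map_in laxmon_C_obj CG_unit_in poscomp_G_obj)

end

section \<open>The comparison with the Vietoris monad\<close>

lemma closed_upper_setsD:
  assumes "A \<in> closed_upper_sets X"
  shows "closedin (topol X) A" "A \<subseteq> points X" "(x, y) \<in> order_rel X \<Longrightarrow> x \<in> A \<Longrightarrow> y \<in> A"
  using assms by (auto simp: closed_upper_sets_def upper_set_def)

lemma points_V_obj: "points (V_obj X) = closed_upper_sets X"
proof
  show "points (V_obj X) \<subseteq> closed_upper_sets X"
    by (auto simp: V_obj_def)
  have "closed_upper_sets X = {A \<in> closed_upper_sets X. A \<inter> {} = {}}"
    by simp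
  moreover have "closedin (topol X) {}" "lower_set X {}"
    by (simp_all add: lower_set_def)
  ultimately have "closed_upper_sets X \<in> {{A \<in> closed_upper_sets X. A \<inter> K = {}} | K. closedin (topol X) K \<and> lower_set X K}"
    by blast
  then show "closed_upper_sets X \<subseteq> points (V_obj X)"
    unfolding V_obj_def by (simp add: Union_upper le_supI2 del: mem_Collect_eq)
qed

lemma openin_V_obj_hit:
  assumes "openin (topol X) U" "lower_set X U"
  shows "openin (topol (V_obj X)) {A \<in> closed_upper_sets X. A \<inter> U \<noteq> {}}"
  using assms by (auto simp: V_obj_def intro!: topology_generated_by_Basis)

lemma openin_V_obj_miss:
  assumes "closedin (topol X) K" "lower_set X K"
  shows "openin (topol (V_obj X)) {A \<in> closed_upper_sets X. A \<inter> K = {}}"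
  using assms by (auto simp: V_obj_def intro!: topology_generated_by_Basis)

lemma order_rel_V_obj:
  "(A, B) \<in> order_rel (V_obj X) \<longleftrightarrow> A \<in> closed_upper_sets X \<and> B \<in> closed_upper_sets X \<and> B \<subseteq> A"
  by (simp add: V_obj_def)

section \<open>Suprema over closed upper sets: order embedding and continuity\<close>

lemma elems_C_obj_continuous:
  "poscomp X \<Longrightarrow> \<psi> \<in> elems (C_obj t X) \<Longrightarrow> continuous_map (topol X) euclideanreal \<psi>"
  by (simp add: elems_C_obj_iff)

lemma elems_C_obj_antimono:
  "poscomp X \<Longrightarrow> \<psi> \<in> elems (C_obj t X) \<Longrightarrow> (x, y) \<in> order_rel X \<Longrightarrow> \<psi> y \<le> \<psi> x"
  by (simp add: elems_C_obj_iff)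

lemma openin_superlevel:
  assumes "poscomp X" "\<psi> \<in> elems (C_obj t X)"
  shows "openin (topol X) {x \<in> points X. v < \<psi> x}"
  using elems_C_obj_continuous[OF assms] unfolding continuous_map_upper_lower_semicontinuous_lt by blast

lemma lower_set_superlevel:
  assumes "poscomp X" "\<psi> \<in> elems (C_obj t X)"
  shows "lower_set X {x \<in> points X. v < \<psi> x}" "lower_set X {x \<in> points X. v \<le> \<psi> x}"
  using elems_C_obj_antimono[OF assms] poscompD(2)[OF assms(1)] unfolding lower_set_def by fastforce+

lemma closedin_superlevel:
  assumes "poscomp X" "\<psi> \<in> elems (C_obj t X)"
  shows "closedin (topol X) {x \<in> points X. v \<le> \<psi> x}"
  using elems_C_obj_continuous[OF assms] unfolding continuous_map_upper_lower_semicontinuous_le by blast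

lemma j_map_apply:
  assumes "A \<in> closed_upper_sets X" "\<psi> \<in> elems (C_obj t X)"
  shows "j_map t X A \<psi> = Sup (insert 0 (\<psi> ` A))"
  using assms by (simp add: j_map_def)

lemma j_map_image_in:
  assumes "A \<in> closed_upper_sets X" "\<psi> \<in> elems (C_obj t X)"
  shows "\<psi> ` A \<subseteq> {0..1}"
  using elems_C_obj_in[OF assms(2)] closed_upper_setsD(2)[OF assms(1)] by blast

text \<open>The condition on \<open>v\<close> takes care of empty \<open>A\<close>, where the
  supremum is \<open>0\<close>.\<close>

lemma j_map_le_iff:
  assumes "A \<in> closed_upper_sets X" "\<psi> \<in> elems (C_obj t X)" "0 \<le> v"
  shows "j_map t X A \<psi> \<le> v \<longleftrightarrow> (\<forall>x\<in>A. \<psi> x \<le> v)"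
  unfolding j_map_apply[OF assms(1,2)] Sup_insert_0_le_iff[OF j_map_image_in[OF assms(1,2)]] using assms(3) by auto

lemma le_j_map:
  assumes "A \<in> closed_upper_sets X" "\<psi> \<in> elems (C_obj t X)" "x \<in> A"
  shows "\<psi> x \<le> j_map t X A \<psi>"
  unfolding j_map_apply[OF assms(1,2)] using le_Sup_insert_0[OF j_map_image_in[OF assms(1,2)]] assms(3) by blast

lemma j_map_in_unit:
  assumes "A \<in> closed_upper_sets X" "\<psi> \<in> elems (C_obj t X)"
  shows "j_map t X A \<psi> \<in> {0..1}"
  unfolding j_map_apply[OF assms] by (rule Sup_insert_0_in[OF j_map_image_in[OF assms]])

lemma mem_iff_le_j_map:
  assumes "poscomp X" "A \<in> closed_upper_sets X" "x \<in> points X"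
  shows "x \<in> A \<longleftrightarrow> (\<forall>\<psi>\<in>elems (C_obj t X). \<psi> x \<le> j_map t X A \<psi>)"
proof
  assume le: "\<forall>\<psi>\<in>elems (C_obj t X). \<psi> x \<le> j_map t X A \<psi>"
  show "x \<in> A"
  proof (rule ccontr)
    assume "x \<notin> A"
    \<comment> \<open>The down-closure of \<open>x\<close> misses \<open>A\<close> because
      \<open>A\<close> is an upper set, so an ordered Urysohn function separates the two.\<close>
    let ?K = "(order_rel X)\<inverse> `` {x}"
    have "closedin (topol X) {x}"
      using Hausdorff_imp_t1_space[OF poscomp_Hausdorff[OF assms(1)]] assms(3) by (simp add: t1_space_closedin_singleton)
    then have "closedin (topol X) ?K"
      by (rule closedin_down_closure[OF assms(1)])
    moreover have "lower_set X ?K"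
      using poscompD(2)[OF assms(1)] poscompD(4)[OF assms(1)] unfolding lower_set_def by blast
    moreover have "A \<inter> ?K = {}"
      using closed_upper_setsD(3)[OF assms(2)] \<open>x \<notin> A\<close> by blast
    ultimately obtain \<psi> where \<psi>: "\<psi> \<in> poscomp_hom X (op_space unit_space)"
      "\<And>y. y \<in> ?K \<Longrightarrow> \<psi> y = 1" "\<And>y. y \<in> A \<Longrightarrow> \<psi> y = 0"
      using ordered_Urysohn[OF assms(1,2)] by metis
    then have C: "\<psi> \<in> elems (C_obj t X)"
      by (simp add: elems_C_obj)
    have "j_map t X A \<psi> \<le> 0"
      using j_map_le_iff[OF assms(2) C, of 0] \<psi>(3) by simp
    moreover have "\<psi> x = 1"
      using \<psi>(2) poscompD(3)[OF assms(1,3)] by blast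
    ultimately show False
      using le C by force
  qed
qed (use le_j_map[OF assms(2)] in blast)

lemma subset_iff_j_map:
  assumes "poscomp X" "S \<subseteq> points X" "A \<in> closed_upper_sets X"
  shows "S \<subseteq> A \<longleftrightarrow> (\<forall>\<psi>\<in>elems (C_obj t X). \<forall>x\<in>S. \<psi> x \<le> j_map t X A \<psi>)"
  using mem_iff_le_j_map[OF assms(1,3), of _ t] assms(2) by blast

lemma j_map_mono_iff:
  assumes "poscomp X" "A \<in> closed_upper_sets X" "B \<in> closed_upper_sets X"
  shows "(\<forall>\<psi>\<in>elems (C_obj t X). j_map t X B \<psi> \<le> j_map t X A \<psi>) \<longleftrightarrow> B \<subseteq> A"
proof -
  have "j_map t X B \<psi> \<le> j_map t X A \<psi> \<longleftrightarrow> (\<forall>x\<in>B. \<psi> x \<le> j_map t X A \<psi>)" if "\<psi> \<in> elems (C_obj t X)" for \<psi>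
    using j_map_le_iff[OF assms(3) that] j_map_in_unit[OF assms(2) that] by simp
  then show ?thesis
    using subset_iff_j_map[OF assms(1) closed_upper_setsD(2)[OF assms(3)] assms(2)] by blast
qed

text \<open>For \<open>0 \<le> v\<close> the supremum exceeds \<open>v\<close> iff some value does,
  i.e. iff \<open>A\<close> hits the open lower set where \<open>\<psi> > v\<close>; this is a
  subbasic set.\<close>

lemma openin_j_map_greater:
  assumes "poscomp X" "\<psi> \<in> elems (C_obj t X)"
  shows "openin (topol (V_obj X)) {A \<in> closed_upper_sets X. v < j_map t X A \<psi>}"
proof (cases "0 \<le> v")
  case True
  have "{A \<in> closed_upper_sets X. v < j_map t X A \<psi>} = {A \<in> closed_upper_sets X. A \<inter> {x \<in> points X. v < \<psi> x} \<noteq> {}}"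
  proof (intro Collect_cong conj_cong refl)
    fix A assume A: "A \<in> closed_upper_sets X"
    show "v < j_map t X A \<psi> \<longleftrightarrow> A \<inter> {x \<in> points X. v < \<psi> x} \<noteq> {}"
      using j_map_le_iff[OF A assms(2) True] closed_upper_setsD(2)[OF A] by (auto simp: not_le[symmetric])
  qed
  then show ?thesis
    using openin_V_obj_hit[OF openin_superlevel[OF assms] lower_set_superlevel(1)[OF assms]] by simp
next
  case False
  then have "v < j_map t X A \<psi>" if "A \<in> closed_upper_sets X" for A
    using j_map_in_unit[OF that assms(2)] by auto
  then have "{A \<in> closed_upper_sets X. v < j_map t X A \<psi>} = topspace (topol (V_obj X))"
    by (auto simp: points_V_obj)
  then show ?thesis
    by simp
qed

lemma openin_j_map_less:
  assumes "poscomp X" "\<psi> \<in> elems (C_obj t X)"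
  shows "openin (topol (V_obj X)) {A \<in> closed_upper_sets X. j_map t X A \<psi> < v}"
proof -
  \<comment> \<open>A supremum below \<open>v\<close> is already below some \<open>s < v\<close>,
    and then \<open>A\<close> misses the closed lower set where \<open>\<psi> \<ge> s\<close>.
    Conversely, missing that set yields the non-strict bound \<open>s\<close>, which is why
    \<open>s\<close> is taken strictly below \<open>v\<close>.\<close>
  let ?M = "\<lambda>s. {A \<in> closed_upper_sets X. A \<inter> {x \<in> points X. s \<le> \<psi> x} = {}}"
  have "{A \<in> closed_upper_sets X. j_map t X A \<psi> < v} = (\<Union>s\<in>{0..<v}. ?M s)"
  proof (intro equalityI subsetI)
    fix A assume "A \<in> {A \<in> closed_upper_sets X. j_map t X A \<psi> < v}"
    then have A: "A \<in> closed_upper_sets X" "j_map t X A \<psi> < v"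
      by auto
    obtain s where s: "j_map t X A \<psi> < s" "s < v"
      using dense A(2) by blast
    have "\<psi> x < s" if "x \<in> A" for x
      using le_j_map[OF A(1) assms(2) that] s(1) by simp
    then have "A \<in> ?M s"
      using A(1) by force
    moreover have "0 \<le> s"
      using j_map_in_unit[OF A(1) assms(2)] s(1) by simp
    ultimately show "A \<in> (\<Union>s\<in>{0..<v}. ?M s)"
      using s(2) by auto
  next
    fix A assume "A \<in> (\<Union>s\<in>{0..<v}. ?M s)"
    then obtain s where s: "0 \<le> s" "s < v" "A \<in> closed_upper_sets X" "A \<inter> {x \<in> points X. s \<le> \<psi> x} = {}"
      by auto
    then have "j_map t X A \<psi> \<le> s"
      using j_map_le_iff[OF s(3) assms(2) s(1)] closed_upper_setsD(2)[OF s(3)] by force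
    then show "A \<in> {A \<in> closed_upper_sets X. j_map t X A \<psi> < v}"
      using s by simp
  qed
  then show ?thesis
    using openin_V_obj_miss[OF closedin_superlevel[OF assms] lower_set_superlevel(2)[OF assms]] by auto
qed

lemma continuous_map_j_map_eval:
  assumes "poscomp X" "\<psi> \<in> elems (C_obj t X)"
  shows "continuous_map (topol (V_obj X)) euclideanreal (\<lambda>A. j_map t X A \<psi>)"
  unfolding continuous_map_upper_lower_semicontinuous_lt points_V_obj
  using openin_j_map_greater[OF assms] openin_j_map_less[OF assms] by blast

definition j_inv :: "tensor \<Rightarrow> 'a ordered_space \<Rightarrow> (('a \<Rightarrow> real) \<Rightarrow> real) \<Rightarrow> 'a set" where
  "j_inv t X = (\<lambda>\<Phi>\<in>points (GC_obj t X). {x \<in> points X. \<forall>\<psi>\<in>elems (C_obj t X). \<psi> x \<le> \<Phi> \<psi>})"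

lemma j_inv_in:
  assumes "poscomp X" "\<Phi> \<in> points (GC_obj t X)"
  shows "j_inv t X \<Phi> \<in> closed_upper_sets X"
proof -
  have eq: "j_inv t X \<Phi> = {x \<in> points X. \<forall>\<psi>. \<psi> \<in> elems (C_obj t X) \<longrightarrow> \<psi> x \<le> \<Phi> \<psi>}"
    using assms(2) by (auto simp: j_inv_def)
  have "closedin (topol X) {x \<in> points X. \<forall>\<psi>. \<psi> \<in> elems (C_obj t X) \<longrightarrow> \<psi> x \<le> \<Phi> \<psi>}"
    using elems_C_obj_continuous[OF assms(1), of _ t]
    by (intro closedin_Collect_all closedin_Collect_imp closedin_Collect_le) auto
  moreover have "upper_set X {x \<in> points X. \<forall>\<psi>. \<psi> \<in> elems (C_obj t X) \<longrightarrow> \<psi> x \<le> \<Phi> \<psi>}"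
    unfolding upper_set_def
  proof (intro conjI ballI; clarify)
    fix x y \<psi> assume xy: "(x, y) \<in> order_rel X" and x: "\<forall>\<psi>. \<psi> \<in> elems (C_obj t X) \<longrightarrow> \<psi> x \<le> \<Phi> \<psi>"
    show "y \<in> points X \<and> (\<forall>\<psi>. \<psi> \<in> elems (C_obj t X) \<longrightarrow> \<psi> y \<le> \<Phi> \<psi>)"
      using poscompD(2)[OF assms(1)] xy x order_trans[OF elems_C_obj_antimono[OF assms(1) _ xy]] by blast
  qed
  ultimately show ?thesis
    unfolding eq closed_upper_sets_def by simp
qed

section \<open>Lax morphisms are exactly the suprema over closed upper sets\<close>

context unit_tensor
begin

text \<open>Residuation moves weights and distances to the other side of an inequality, where
  \<open>j_map_le_iff\<close> reduces the claim to points of \<open>A\<close>. Cocontinuity is then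
  an exchange of the quantifiers over \<open>A\<close> and \<open>D\<close>.\<close>

lemma j_map_in_laxmon_hom:
  assumes "poscomp X" "A \<in> closed_upper_sets X"
  shows "j_map t X A \<in> laxmon_hom t (C_obj t X) (unit_monoid t)"
  unfolding laxmon_hom_unit_iff[OF laxmon_C_obj[OF assms(1)]]
proof (intro conjI allI impI)
  let ?j = "j_map t X A"
  note jI = j_map_in_unit[OF assms(2)]
  have AX: "x \<in> points X" if "x \<in> A" for x
    using closed_upper_setsD(2)[OF assms(2)] that by blast
  show "?j \<in> elems (C_obj t X) \<rightarrow>\<^sub>E {0..1}"
    using jI assms(2) by (auto simp: PiE_iff j_map_def)
  fix \<psi> \<psi>' assume \<psi>: "\<psi> \<in> elems (C_obj t X)" "\<psi>' \<in> elems (C_obj t X)"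
  let ?d = "dist_of (C_obj t X) \<psi> \<psi>'"
  note d = dist_C_obj_in[OF \<psi>]
  have "?j \<psi> \<le> ihom t ?d (?j \<psi>')"
  proof -
    have "\<psi> x \<le> ihom t ?d (?j \<psi>')" if x: "x \<in> A" for x
    proof -
      note I = elems_C_obj_in[OF \<psi>(1) AX[OF x]] elems_C_obj_in[OF \<psi>(2) AX[OF x]]
      have "t ?d (\<psi> x) \<le> \<psi>' x"
        using dist_C_obj_le[OF \<psi> AX[OF x]] le_ihom_iff[OF I(1) d I(2)] t_comm[OF d I(1)] by simp
      also have "\<dots> \<le> ?j \<psi>'"
        using le_j_map[OF assms(2) \<psi>(2) x] .
      finally show ?thesis
        using le_ihom_iff[OF d I(1) jI[OF \<psi>(2)]] by simp
    qed
    then show ?thesis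
      using j_map_le_iff[OF assms(2) \<psi>(1)] ihom_in[OF d jI[OF \<psi>(2)]] by simp
  qed
  then show "t ?d (?j \<psi>) \<le> ?j \<psi>'"
    using le_ihom_iff[OF d jI[OF \<psi>(1)] jI[OF \<psi>(2)]] by simp
  show "?j (mult_of (C_obj t X) \<psi> \<psi>') \<le> t (?j \<psi>) (?j \<psi>')"
  proof (subst j_map_le_iff[OF assms(2) mult_of_C_obj_in[OF assms(1) \<psi>]])
    show "0 \<le> t (?j \<psi>) (?j \<psi>')"
      using t_in[OF jI[OF \<psi>(1)] jI[OF \<psi>(2)]] by simp
    show "\<forall>x\<in>A. mult_of (C_obj t X) \<psi> \<psi>' x \<le> t (?j \<psi>) (?j \<psi>')"
    proof
      fix x assume x: "x \<in> A"
      have "t (\<psi> x) (\<psi>' x) \<le> t (?j \<psi>) (?j \<psi>')"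
        by (intro t_mono jI \<psi> le_j_map[OF assms(2)] x elems_C_obj_in[OF \<psi>(1) AX[OF x]] elems_C_obj_in[OF \<psi>(2) AX[OF x]])
      then show "mult_of (C_obj t X) \<psi> \<psi>' x \<le> t (?j \<psi>) (?j \<psi>')"
        using AX[OF x] by (simp add: mult_of_C_obj)
    qed
  qed
next
  let ?j = "j_map t X A"
  note jI = j_map_in_unit[OF assms(2)]
  fix D r h w c
  assume D: "finite_weighted_diagram t (elems (C_obj t X)) (dist_of (C_obj t X)) D r h w"
    and c: "is_colimit t (elems (C_obj t X)) (dist_of (C_obj t X)) D h w c"
  note D = finite_weighted_diagramD[OF D]
  have hd: "h d \<in> elems (C_obj t X)" "w d \<in> {0..1}" if "d \<in> D" for d
    using D that by blast+
  have jh: "(\<lambda>d. ?j (h d)) \<in> D \<rightarrow> {0..1}"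
    using jI[OF hd(1)] by blast
  have cC: "c \<in> elems (C_obj t X)"
    using c by (simp add: is_colimit_def)
  have c: "c = (\<lambda>x\<in>points X. wsup t D w (\<lambda>d. h d x))"
    using c is_colimit_C_obj_iff[OF assms(1) D(1,3,2)] by simp
  show "?j c = wsup t D w (\<lambda>d. ?j (h d))"
  proof (rule eq_of_ge_iff_unit[OF jI[OF cC] wsup_in[OF D(3) jh]])
    fix v :: real assume v: "v \<in> {0..1}"
    have "?j c \<le> v \<longleftrightarrow> (\<forall>x\<in>A. c x \<le> v)"
      using j_map_le_iff[OF assms(2) cC] v by simp
    also have "\<dots> \<longleftrightarrow> (\<forall>x\<in>A. \<forall>d\<in>D. t (w d) (h d x) \<le> v)"
    proof (intro ball_cong refl)
      fix x assume "x \<in> A"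
      then have x: "x \<in> points X"
        using closed_upper_setsD(2)[OF assms(2)] by blast
      have "(\<lambda>d. h d x) \<in> D \<rightarrow> {0..1}"
        using elems_C_obj_in[OF hd(1) x] by blast
      from wsup_le_iff[OF D(3) this v] show "c x \<le> v \<longleftrightarrow> (\<forall>d\<in>D. t (w d) (h d x) \<le> v)"
        using x c by simp
    qed
    also have "\<dots> \<longleftrightarrow> (\<forall>d\<in>D. \<forall>x\<in>A. t (w d) (h d x) \<le> v)"
      by blast
    also have "\<dots> \<longleftrightarrow> (\<forall>d\<in>D. t (w d) (?j (h d)) \<le> v)"
    proof (intro ball_cong refl)
      fix d assume d: "d \<in> D"
      have "t (w d) (?j (h d)) \<le> v \<longleftrightarrow> ?j (h d) \<le> ihom t (w d) v"
        using le_ihom_iff[OF hd(2)[OF d] jI[OF hd(1)[OF d]] v] by simp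
      also have "\<dots> \<longleftrightarrow> (\<forall>x\<in>A. h d x \<le> ihom t (w d) v)"
        using j_map_le_iff[OF assms(2) hd(1)[OF d]] ihom_in[OF hd(2)[OF d] v] by simp
      also have "\<dots> \<longleftrightarrow> (\<forall>x\<in>A. t (w d) (h d x) \<le> v)"
      proof (intro ball_cong refl)
        fix x assume "x \<in> A"
        then have "x \<in> points X"
          using closed_upper_setsD(2)[OF assms(2)] by blast
        then show "h d x \<le> ihom t (w d) v \<longleftrightarrow> t (w d) (h d x) \<le> v"
          using le_ihom_iff[OF hd(2)[OF d] elems_C_obj_in[OF hd(1)[OF d]] v] by simp
      qed
      finally show "(\<forall>x\<in>A. t (w d) (h d x) \<le> v) \<longleftrightarrow> t (w d) (?j (h d)) \<le> v"
        by blast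
    qed
    also have "\<dots> \<longleftrightarrow> wsup t D w (\<lambda>d. ?j (h d)) \<le> v"
      using wsup_le_iff[OF D(3) jh v] by simp
    finally show "?j c \<le> v \<longleftrightarrow> wsup t D w (\<lambda>d. ?j (h d)) \<le> v" .
  qed
qed

lemma j_map_in_points:
  assumes "poscomp X" "A \<in> closed_upper_sets X"
  shows "j_map t X A \<in> points (GC_obj t X)"
  using j_map_in_laxmon_hom[OF assms] by (simp add: GC_obj_def points_G_obj)

lemma order_rel_GC_obj_j_map_iff:
  assumes "poscomp X" "A \<in> closed_upper_sets X" "B \<in> closed_upper_sets X"
  shows "(j_map t X A, j_map t X B) \<in> order_rel (GC_obj t X) \<longleftrightarrow> (A, B) \<in> order_rel (V_obj X)"
  using j_map_mono_iff[OF assms, of t] j_map_in_points[OF assms(1)] assms(2,3)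
  unfolding GC_obj_def by (simp add: order_rel_G_obj order_rel_V_obj)

theorem j_map_in:
  assumes "poscomp X"
  shows "j_map t X \<in> poscomp_hom (V_obj X) (GC_obj t X)"
proof -
  have "j_map t X \<in> points (V_obj X) \<rightarrow>\<^sub>E points (GC_obj t X)"
    using j_map_in_points[OF assms] by (auto simp: points_V_obj j_map_def)
  moreover have "continuous_map (topol (V_obj X)) (topol (GC_obj t X)) (j_map t X)"
    unfolding GC_obj_def
    using j_map_in_points[OF assms] continuous_map_j_map_eval[OF assms]
    by (intro continuous_map_into_G_obj) (auto simp: points_V_obj GC_obj_def)
  moreover have "(j_map t X A, j_map t X B) \<in> order_rel (GC_obj t X)" if "(A, B) \<in> order_rel (V_obj X)" for A B
    using order_rel_GC_obj_j_map_iff[OF assms] that by (simp add: order_rel_V_obj)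
  ultimately show ?thesis
    by (auto simp: poscomp_hom_def)
qed

lemma j_inv_j_map:
  assumes "poscomp X" "A \<in> closed_upper_sets X"
  shows "j_inv t X (j_map t X A) = A"
  using mem_iff_le_j_map[OF assms, of _ t] closed_upper_setsD(2)[OF assms(2)] j_map_in_points[OF assms]
  by (auto simp: j_inv_def)

lemma GC_colimit:
  assumes "poscomp X" "\<Phi> \<in> points (GC_obj t X)" "finite D" "w \<in> D \<rightarrow> {0..1}" "h \<in> D \<rightarrow> elems (C_obj t X)"
  shows "\<Phi> (\<lambda>x\<in>points X. wsup t D w (\<lambda>d. h d x)) = wsup t D w (\<lambda>d. \<Phi> (h d))"
proof -
  \<comment> \<open>Over the discrete enriched category, every weighted family is a diagram.\<close>
  define r where "r = (\<lambda>d d' :: nat. if d = d' then 1 else 0 :: real)"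
  have hd: "h d \<in> elems (C_obj t X)" "w d \<in> {0..1}" if "d \<in> D" for d
    using assms(4,5) that by blast+
  have "enriched_category t D r"
    using t_1[of 1] t_1[of 0] t_0[of 0] t_0[of 1] by (auto simp: enriched_category_def r_def)
  moreover have "enriched_functor D r (elems (C_obj t X)) (dist_of (C_obj t X)) h"
    unfolding enriched_functor_def
  proof (intro conjI ballI assms(5))
    fix d d' assume d: "d \<in> D" "d' \<in> D"
    have "dist_of (C_obj t X) (h d) (h d) = 1"
      using natural_le_C_obj_iff[OF hd(1)[OF d(1)] hd(1)[OF d(1)]] by (simp add: natural_le_def)
    then show "r d d' \<le> dist_of (C_obj t X) (h d) (h d')"
      using dist_C_obj_in[OF hd(1)[OF d(1)] hd(1)[OF d(2)]] by (cases "d = d'") (auto simp: r_def)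
  qed
  moreover have "\<forall>d\<in>D. \<forall>d'\<in>D. t (r d d') (w d') \<le> w d"
  proof (intro ballI)
    fix d d' assume "d \<in> D" "d' \<in> D"
    then show "t (r d d') (w d') \<le> w d"
      using t_1[OF hd(2)[of d]] t_0(2)[OF hd(2)[of d']] hd(2)[of d] by (cases "d = d'") (auto simp: r_def)
  qed
  ultimately have D: "finite_weighted_diagram t (elems (C_obj t X)) (dist_of (C_obj t X)) D r h w"
    using assms(3,4) by (simp add: finite_weighted_diagram_def)
  have "is_colimit t (elems (C_obj t X)) (dist_of (C_obj t X)) D h w (\<lambda>x\<in>points X. wsup t D w (\<lambda>d. h d x))"
    using is_colimit_C_obj_iff[OF assms(1,3-5)] by simp
  moreover have "\<Phi> \<in> laxmon_hom t (C_obj t X) (unit_monoid t)"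
    using assms(2) by (simp add: GC_obj_def points_G_obj)
  ultimately show ?thesis
    using D unfolding laxmon_hom_unit_iff[OF laxmon_C_obj[OF assms(1)]] by blast
qed

lemma GC_facts:
  assumes "poscomp X" "\<Phi> \<in> points (GC_obj t X)"
  shows "\<psi> \<in> elems (C_obj t X) \<Longrightarrow> \<Phi> \<psi> \<in> {0..1}"
    and "\<psi> \<in> elems (C_obj t X) \<Longrightarrow> \<psi>' \<in> elems (C_obj t X) \<Longrightarrow> (\<And>x. x \<in> points X \<Longrightarrow> \<psi> x \<le> \<psi>' x) \<Longrightarrow> \<Phi> \<psi> \<le> \<Phi> \<psi>'"
    and "\<psi> \<in> elems (C_obj t X) \<Longrightarrow> \<psi>' \<in> elems (C_obj t X) \<Longrightarrow>
      \<Phi> (mult_of (C_obj t X) \<psi> \<psi>') \<le> t (\<Phi> \<psi>) (\<Phi> \<psi>')"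
proof -
  have \<Phi>: "\<Phi> \<in> laxmon_hom t (C_obj t X) (unit_monoid t)"
    using assms(2) by (simp add: GC_obj_def points_G_obj)
  show in01: "\<Phi> \<psi> \<in> {0..1}" if "\<psi> \<in> elems (C_obj t X)" for \<psi>
    by (rule laxmon_hom_unit_in[OF \<Phi> that])
  show "\<Phi> (mult_of (C_obj t X) \<psi> \<psi>') \<le> t (\<Phi> \<psi>) (\<Phi> \<psi>')" if "\<psi> \<in> elems (C_obj t X)" "\<psi>' \<in> elems (C_obj t X)"
    using \<Phi> that unfolding laxmon_hom_unit_iff[OF laxmon_C_obj[OF assms(1)]] by blast
  assume \<psi>: "\<psi> \<in> elems (C_obj t X)" "\<psi>' \<in> elems (C_obj t X)" and le: "\<And>x. x \<in> points X \<Longrightarrow> \<psi> x \<le> \<psi>' x"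
  have "dist_of (C_obj t X) \<psi> \<psi>' = 1"
    using natural_le_C_obj_iff[OF \<psi>] le by (simp add: natural_le_def)
  moreover have "t (dist_of (C_obj t X) \<psi> \<psi>') (\<Phi> \<psi>) \<le> \<Phi> \<psi>'"
    using \<Phi> \<psi> unfolding laxmon_hom_unit_iff[OF laxmon_C_obj[OF assms(1)]] by blast
  ultimately show "\<Phi> \<psi> \<le> \<Phi> \<psi>'"
    using t_1[OF in01[OF \<psi>(1)]] by simp
qed

text \<open>Two-element diagrams cover all colimits used below: weights \<open>0, 0\<close> give the
  bottom element, \<open>1, 1\<close> a binary supremum, \<open>u, u\<close> on equal functions a
  copower, and \<open>u, 1\<close> the maximum of the constant \<open>u\<close> and a
  function.\<close>

lemma GC_wsup2:
  assumes "poscomp X" "\<Phi> \<in> points (GC_obj t X)" "u \<in> {0..1}" "v \<in> {0..1}"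
    and "\<psi> \<in> elems (C_obj t X)" "\<psi>' \<in> elems (C_obj t X)"
  shows "(\<lambda>x\<in>points X. max (t u (\<psi> x)) (t v (\<psi>' x))) \<in> elems (C_obj t X)"
    and "\<Phi> (\<lambda>x\<in>points X. max (t u (\<psi> x)) (t v (\<psi>' x))) = max (t u (\<Phi> \<psi>)) (t v (\<Phi> \<psi>'))"
proof -
  define h where "h = (\<lambda>d::nat. if d = 0 then \<psi> else \<psi>')"
  define w where "w = (\<lambda>d::nat. if d = 0 then u else v)"
  have w: "w \<in> {0, 1} \<rightarrow> {0..1}" and h: "h \<in> {0, 1} \<rightarrow> elems (C_obj t X)"
    using assms(3-6) by (auto simp: w_def h_def)
  have wsup: "wsup t {0, 1} w (\<lambda>d. if d = 0 then a else b) = max (t u a) (t v b)"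
    if "a \<in> {0..1}" "b \<in> {0..1}" for a b
    using t_in[OF assms(3) that(1)] t_in[OF assms(4) that(2)]
    by (simp add: wsup_def w_def cSup_eq_Max max.absorb2 le_max_iff_disj)
  have sup_eq: "(\<lambda>x\<in>points X. wsup t {0, 1} w (\<lambda>d. h d x)) = (\<lambda>x\<in>points X. max (t u (\<psi> x)) (t v (\<psi>' x)))"
  proof (rule restrict_ext)
    fix x assume x: "x \<in> points X"
    have "(\<lambda>d. h d x) = (\<lambda>d. if d = 0 then \<psi> x else \<psi>' x)"
      by (auto simp: h_def)
    then show "wsup t {0, 1} w (\<lambda>d. h d x) = max (t u (\<psi> x)) (t v (\<psi>' x))"
      using wsup[OF elems_C_obj_in[OF assms(5) x] elems_C_obj_in[OF assms(6) x]] by simp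
  qed
  show "(\<lambda>x\<in>points X. max (t u (\<psi> x)) (t v (\<psi>' x))) \<in> elems (C_obj t X)"
    using wsup_C_obj_in[OF assms(1) _ w h] sup_eq by simp
  have "(\<lambda>d. \<Phi> (h d)) = (\<lambda>d. if d = 0 then \<Phi> \<psi> else \<Phi> \<psi>')"
    by (auto simp: h_def)
  then show "\<Phi> (\<lambda>x\<in>points X. max (t u (\<psi> x)) (t v (\<psi>' x))) = max (t u (\<Phi> \<psi>)) (t v (\<Phi> \<psi>'))"
    using GC_colimit[OF assms(1,2) _ w h] sup_eq wsup[OF GC_facts(1)[OF assms(1,2,5)] GC_facts(1)[OF assms(1,2,6)]]
    by simp
qed

lemma GC_copower_le:
  assumes "poscomp X" "\<Phi> \<in> points (GC_obj t X)" "u \<in> {0..1}" "\<psi> \<in> elems (C_obj t X)" "\<psi>' \<in> elems (C_obj t X)"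
    and "\<And>x. x \<in> points X \<Longrightarrow> t u (\<psi> x) \<le> \<psi>' x"
  shows "t u (\<Phi> \<psi>) \<le> \<Phi> \<psi>'"
proof -
  note m = GC_wsup2[OF assms(1-3,3,4,4)]
  have "\<Phi> (\<lambda>x\<in>points X. max (t u (\<psi> x)) (t u (\<psi> x))) \<le> \<Phi> \<psi>'"
    using assms(6) by (intro GC_facts(2)[OF assms(1,2)] m(1) assms(5)) simp
  then show ?thesis
    using m(2) by simp
qed

lemma GC_power:
  assumes "poscomp X" "\<Phi> \<in> points (GC_obj t X)" "\<rho> \<in> elems (C_obj t X)"
  shows "(\<lambda>x\<in>points X. (t (\<rho> x) ^^ n) 1) \<in> elems (C_obj t X)"
    and "\<Phi> (\<lambda>x\<in>points X. (t (\<rho> x) ^^ n) 1) \<le> (t (\<Phi> \<rho>) ^^ n) 1"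
proof -
  define p where "p n = (\<lambda>x\<in>points X. (t (\<rho> x) ^^ n) 1)" for n
  have p_0: "p 0 = (\<lambda>x\<in>points X. 1)" and p_Suc: "p (Suc n) = mult_of (C_obj t X) \<rho> (p n)" for n
    by (auto simp: C_obj_def p_def)
  have p: "p n \<in> elems (C_obj t X)" for n
  proof (induction n)
    case 0
    show ?case
      unfolding p_0 by (rule const_in_C_obj[OF assms(1)]) simp
  next
    case (Suc n)
    show ?case
      unfolding p_Suc by (rule mult_of_C_obj_in[OF assms(1,3) Suc.IH])
  qed
  note \<Phi>I = GC_facts(1)[OF assms(1,2)]
  have le: "\<Phi> (p n) \<le> (t (\<Phi> \<rho>) ^^ n) 1" for n
  proof (induction n)
    \<comment> \<open>The unit need not be preserved: the power \<open>0\<close> is the constant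
      \<open>1\<close>, and of its image only the bound \<open>1\<close> is known.\<close>
    case 0
    show ?case
      using \<Phi>I[OF p[of 0]] by simp
  next
    case (Suc n)
    have "\<Phi> (p (Suc n)) \<le> t (\<Phi> \<rho>) (\<Phi> (p n))"
      unfolding p_Suc by (rule GC_facts(3)[OF assms p])
    also have "\<dots> \<le> t (\<Phi> \<rho>) ((t (\<Phi> \<rho>) ^^ n) 1)"
      by (intro t_mono \<Phi>I assms(3) p powers_in order_refl Suc.IH)
    finally show ?case
      by simp
  qed
  show "(\<lambda>x\<in>points X. (t (\<rho> x) ^^ n) 1) \<in> elems (C_obj t X)"
    "\<Phi> (\<lambda>x\<in>points X. (t (\<rho> x) ^^ n) 1) \<le> (t (\<Phi> \<rho>) ^^ n) 1"
    using p[of n] le[of n] by (simp_all only: p_def)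
qed

text \<open>
  A point \<open>x\<close> outside \<open>j_inv t X \<Phi>\<close> satisfies \<open>\<Phi> \<psi> < c < \<psi> x\<close> for some \<open>\<psi>\<close> and \<open>c\<close>. The function
  \<open>\<rho> = ihom t c \<circ> \<psi>\<close> is \<open>1\<close> where \<open>\<psi> > c\<close>, and \<open>t c \<circ> \<rho> \<le> \<psi>\<close> forces \<open>\<Phi> \<rho> < 1\<close>.
\<close>

lemma exists_peak_function:
  assumes "poscomp X" "\<Phi> \<in> points (GC_obj t X)" "x \<in> points X" "x \<notin> j_inv t X \<Phi>"
  obtains \<rho> U where "\<rho> \<in> elems (C_obj t X)" "\<Phi> \<rho> < 1" "openin (topol X) U" "x \<in> U" "\<And>y. y \<in> U \<Longrightarrow> \<rho> y = 1"
proof -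
  obtain \<psi> where \<psi>: "\<psi> \<in> elems (C_obj t X)" "\<Phi> \<psi> < \<psi> x"
    using assms(2-4) by (auto simp: j_inv_def not_le)
  obtain c where c: "\<Phi> \<psi> < c" "c < \<psi> x"
    using dense[OF \<psi>(2)] by blast
  have cI: "c \<in> {0..1}"
    using c GC_facts(1)[OF assms(1,2) \<psi>(1)] elems_C_obj_in[OF \<psi>(1) assms(3)] by simp
  define \<rho> where "\<rho> = (\<lambda>y\<in>points X. ihom t c (\<psi> y))"
  have \<psi>I: "\<psi> y \<in> {0..1}" if "y \<in> points X" for y
    by (rule elems_C_obj_in[OF \<psi>(1) that])
  have \<rho>: "\<rho> \<in> elems (C_obj t X)"
    unfolding \<rho>_def
  proof (rule elems_C_obj_restrictI[OF assms(1)])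
    show "continuous_map (topol X) euclideanreal (\<lambda>y. ihom t c (\<psi> y))"
      by (rule continuous_map_ihom[OF cI elems_C_obj_continuous[OF assms(1) \<psi>(1)] \<psi>I])
    show "ihom t c (\<psi> y) \<in> {0..1}" if "y \<in> points X" for y
      by (rule ihom_in[OF cI \<psi>I[OF that]])
    show "ihom t c (\<psi> z) \<le> ihom t c (\<psi> y)" if "(y, z) \<in> order_rel X" "y \<in> points X" "z \<in> points X" for y z
      by (rule ihom_mono[OF cI \<psi>I[OF that(3)] \<psi>I[OF that(2)] elems_C_obj_antimono[OF assms(1) \<psi>(1) that(1)]])
  qed
  have \<Phi>\<rho>: "\<Phi> \<rho> \<in> {0..1}"
    by (rule GC_facts(1)[OF assms(1,2) \<rho>])
  \<comment> \<open>If \<open>\<Phi> \<rho>\<close> were \<open>1\<close>, this would read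
    \<open>c \<le> \<Phi> \<psi>\<close>, against the choice of \<open>c\<close>.\<close>
  have "t c (\<Phi> \<rho>) \<le> \<Phi> \<psi>"
    using t_ihom_le[OF cI \<psi>I] by (intro GC_copower_le[OF assms(1,2) cI \<rho> \<psi>(1)]) (simp add: \<rho>_def)
  moreover have "t c 1 = c"
    using t_comm[OF cI, of 1] t_1[OF cI] by simp
  ultimately have "\<Phi> \<rho> \<noteq> 1"
    using c(1) by auto
  then have "\<Phi> \<rho> < 1"
    using \<Phi>\<rho> by simp
  moreover have "\<rho> y = 1" if "y \<in> {y \<in> points X. c < \<psi> y}" for y
    using that ihom_eq_1_iff[OF cI \<psi>I[of y]] by (simp add: \<rho>_def)
  ultimately show thesis
    using that[OF \<rho> _ openin_superlevel[OF assms(1) \<psi>(1), of c]] assms(3) c(2) by blast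
qed

lemma exists_compact_peak_function:
  assumes "poscomp X" "\<Phi> \<in> points (GC_obj t X)" "closedin (topol X) K" "K \<inter> j_inv t X \<Phi> = {}"
  obtains \<rho> where "\<rho> \<in> elems (C_obj t X)" "\<Phi> \<rho> < 1" "\<forall>y\<in>K. \<rho> y = 1"
proof -
  let ?P = "\<lambda>U. openin (topol X) U \<and> (\<exists>\<rho>\<in>elems (C_obj t X). \<Phi> \<rho> < 1 \<and> (\<forall>y\<in>U. \<rho> y = 1))"
  have "compactin (topol X) K"
    using closedin_compact_space[OF poscompD(1)[OF assms(1)] assms(3)] .
  moreover have "K \<subseteq> \<Union>{U. ?P U}"
  proof
    fix x assume x: "x \<in> K"
    then have "x \<in> points X" "x \<notin> j_inv t X \<Phi>"
      using closedin_subset[OF assms(3)] assms(4) by auto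
    then obtain \<rho> U where "\<rho> \<in> elems (C_obj t X)" "\<Phi> \<rho> < 1" "openin (topol X) U" "x \<in> U" "\<And>y. y \<in> U \<Longrightarrow> \<rho> y = 1"
      using exists_peak_function[OF assms(1,2)] by metis
    then show "x \<in> \<Union>{U. ?P U}"
      by blast
  qed
  ultimately obtain \<F> where \<F>: "finite \<F>" "\<F> \<subseteq> {U. ?P U}" "K \<subseteq> \<Union>\<F>"
    using compactinD[of "topol X" K "{U. ?P U}"] by blast
  have "\<exists>\<rho>\<in>elems (C_obj t X). \<Phi> \<rho> < 1 \<and> (\<forall>y\<in>\<Union>\<F>. \<rho> y = 1)"
    using \<F>(1,2)
  proof (induction \<F>)
    \<comment> \<open>The constant \<open>1\<close> would not do as a start, since
      \<open>\<Phi>\<close> may send it to \<open>1\<close>. The copower by \<open>0\<close> gives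
      the bottom function, which \<open>\<Phi>\<close> sends to \<open>0\<close>.\<close>
    case empty
    have one: "(\<lambda>x\<in>points X. 1) \<in> elems (C_obj t X)"
      by (rule const_in_C_obj[OF assms(1)]) simp
    define z where "z = (\<lambda>x\<in>points X. max (t 0 ((\<lambda>x\<in>points X. 1) x)) (t 0 ((\<lambda>x\<in>points X. 1) x)))"
    have z: "z \<in> elems (C_obj t X)" "\<Phi> z = max (t 0 (\<Phi> (\<lambda>x\<in>points X. 1))) (t 0 (\<Phi> (\<lambda>x\<in>points X. 1)))"
      unfolding z_def by (rule GC_wsup2[OF assms(1,2) _ _ one one]; simp)+
    then have "\<Phi> z < 1"
      using t_0(2)[OF GC_facts(1)[OF assms(1,2) one]] by simp
    then show ?case
      using z(1) by auto
  next
    case (insert U \<F>)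
    obtain \<rho> where \<rho>: "\<rho> \<in> elems (C_obj t X)" "\<Phi> \<rho> < 1" "\<forall>y\<in>\<Union>\<F>. \<rho> y = 1"
      using insert by auto
    obtain \<sigma> where \<sigma>: "\<sigma> \<in> elems (C_obj t X)" "\<Phi> \<sigma> < 1" "\<forall>y\<in>U. \<sigma> y = 1"
      using insert.prems by auto
    \<comment> \<open>The maximum of the two functions is \<open>1\<close> on both sets, and by
      cocontinuity \<open>\<Phi> m\<close> is the maximum of two numbers below
      \<open>1\<close>.\<close>
    define m where "m = (\<lambda>x\<in>points X. max (t 1 (\<rho> x)) (t 1 (\<sigma> x)))"
    have m: "m \<in> elems (C_obj t X)" "\<Phi> m = max (t 1 (\<Phi> \<rho>)) (t 1 (\<Phi> \<sigma>))"
      unfolding m_def by (rule GC_wsup2[OF assms(1,2) _ _ \<rho>(1) \<sigma>(1)]; simp)+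
    have "\<Phi> m < 1"
      using m(2) t_1[OF GC_facts(1)[OF assms(1,2) \<rho>(1)]] t_1[OF GC_facts(1)[OF assms(1,2) \<sigma>(1)]] \<rho>(2) \<sigma>(2)
      by simp
    moreover have "m y = 1" if y: "y \<in> \<Union>(insert U \<F>)" for y
    proof -
      have "y \<in> points X"
        using y insert.prems openin_subset by blast
      then have I: "\<rho> y \<in> {0..1}" "\<sigma> y \<in> {0..1}" "m y = max (\<rho> y) (\<sigma> y)"
        using elems_C_obj_in[OF \<rho>(1)] elems_C_obj_in[OF \<sigma>(1)] t_1 by (simp_all add: m_def)
      have "\<rho> y = 1 \<or> \<sigma> y = 1"
        using y \<rho>(3) \<sigma>(3) by blast
      then show ?thesis
        using I by auto
    qed
    ultimately show ?case
      using m(1) by blast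
  qed
  then show thesis
    using that \<F>(3) by blast
qed

theorem j_map_j_inv:
  assumes "poscomp X" "\<Phi> \<in> points (GC_obj t X)"
  shows "j_map t X (j_inv t X \<Phi>) = \<Phi>"
proof (rule extensionalityI)
  define A where "A = j_inv t X \<Phi>"
  have A: "A \<in> closed_upper_sets X"
    unfolding A_def by (rule j_inv_in[OF assms])
  show "j_map t X (j_inv t X \<Phi>) \<in> extensional (elems (C_obj t X))"
    using A by (simp add: j_map_def A_def)
  show "\<Phi> \<in> extensional (elems (C_obj t X))"
    using assms(2) by (auto simp: GC_obj_def points_G_obj laxmon_hom_def PiE_iff)
  fix \<psi> assume \<psi>: "\<psi> \<in> elems (C_obj t X)"
  note \<Phi>I = GC_facts(1)[OF assms]
  have "\<forall>x\<in>A. \<psi> x \<le> \<Phi> \<psi>"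
    using \<psi> assms(2) by (auto simp: A_def j_inv_def)
  then have "j_map t X A \<psi> \<le> \<Phi> \<psi>"
    using j_map_le_iff[OF A \<psi>] \<Phi>I[OF \<psi>] by simp
  moreover have "\<Phi> \<psi> \<le> u" if u: "j_map t X A \<psi> < u" "u < 1" for u
  proof -
    have uI: "u \<in> {0..1}" "0 < u"
      using u j_map_in_unit[OF A \<psi>] by auto
    let ?K = "{x \<in> points X. u \<le> \<psi> x}"
    have K: "?K \<inter> j_inv t X \<Phi> = {}"
      using le_j_map[OF A \<psi>] u(1) unfolding A_def by force
    obtain \<rho> where \<rho>: "\<rho> \<in> elems (C_obj t X)" "\<Phi> \<rho> < 1" "\<forall>y\<in>?K. \<rho> y = 1"
      by (rule exists_compact_peak_function[OF assms closedin_superlevel[OF assms(1) \<psi>] K])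
    have "\<Phi> \<rho> \<in> {0..<1}"
      using \<Phi>I[OF \<rho>(1)] \<rho>(2) by simp
    then obtain n where n: "(t (\<Phi> \<rho>) ^^ n) 1 < u"
      using powers_small[OF _ uI(2)] by blast
    define p where "p = (\<lambda>x\<in>points X. (t (\<rho> x) ^^ n) 1)"
    have p: "p \<in> elems (C_obj t X)" "\<Phi> p \<le> (t (\<Phi> \<rho>) ^^ n) 1"
      unfolding p_def by (rule GC_power[OF assms \<rho>(1)])+
    define one where "one = (\<lambda>x\<in>points X. 1 :: real)"
    have one: "one \<in> elems (C_obj t X)"
      unfolding one_def by (rule const_in_C_obj[OF assms(1)]) simp
    \<comment> \<open>\<open>m\<close> is the maximum of \<open>u\<close> and \<open>p\<close>,
      written as a weighted supremum so that cocontinuity applies. The weight \<open>u\<close> on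
      the constant \<open>1\<close> contributes \<open>t u (\<Phi> one) \<le> u\<close>, whatever
      \<open>\<Phi> one\<close> is.\<close>
    define m where "m = (\<lambda>x\<in>points X. max (t u (one x)) (t 1 (p x)))"
    have m: "m \<in> elems (C_obj t X)" "\<Phi> m = max (t u (\<Phi> one)) (t 1 (\<Phi> p))"
      unfolding m_def by (rule GC_wsup2[OF assms uI(1) _ one p(1)]; simp)+
    \<comment> \<open>On \<open>?K\<close> all powers of \<open>\<rho>\<close> are \<open>1\<close>;
      elsewhere \<open>\<psi> x < u\<close>.\<close>
    have "\<psi> x \<le> m x" if x: "x \<in> points X" for x
    proof -
      have "(t 1 ^^ n) 1 = 1"
        by (induction n) (simp_all add: t_1)
      then have "\<rho> x = 1 \<Longrightarrow> t 1 (p x) = 1"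
        using x t_1[of 1] by (simp add: p_def)
      moreover have "t u (one x) = u"
        unfolding one_def using x t_comm[OF uI(1), of 1] t_1[OF uI(1)] by simp
      ultimately show ?thesis
        unfolding m_def using x \<rho>(3) elems_C_obj_in[OF \<psi> x] by (cases "u \<le> \<psi> x") auto
    qed
    then have "\<Phi> \<psi> \<le> \<Phi> m"
      by (rule GC_facts(2)[OF assms \<psi> m(1)])
    also have "\<dots> \<le> u"
      using m(2) t_le(1)[OF uI(1) \<Phi>I[OF one]] t_1[OF \<Phi>I[OF p(1)]] p(2) n by simp
    finally show ?thesis .
  qed
  \<comment> \<open>Otherwise some \<open>u\<close> would lie strictly between the two numbers; then
    \<open>u < \<Phi> \<psi> \<le> 1\<close>, and the bound just shown contradicts this.\<close>
  then have "\<Phi> \<psi> \<le> j_map t X A \<psi>"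
    using \<Phi>I[OF \<psi>] dense[of "j_map t X A \<psi>" "\<Phi> \<psi>"] by (meson atLeastAtMost_iff less_le_trans not_le)
  ultimately show "j_map t X (j_inv t X \<Phi>) \<psi> = \<Phi> \<psi>"
    by (simp add: A_def)
qed

theorem j_inv_in_poscomp_hom:
  assumes "poscomp X"
  shows "j_inv t X \<in> poscomp_hom (GC_obj t X) (V_obj X)"
proof -
  let ?S = "closed_upper_sets X" and ?G = "points (GC_obj t X)"
  have into: "j_inv t X \<in> ?G \<rightarrow>\<^sub>E points (V_obj X)"
    using j_inv_in[OF assms] by (auto simp: points_V_obj j_inv_def)
  have eval: "continuous_map (topol (GC_obj t X)) euclideanreal (\<lambda>\<Phi>. \<Phi> \<psi>)" if "\<psi> \<in> elems (C_obj t X)" for \<psi>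
    unfolding GC_obj_def by (rule continuous_map_eval_G_obj[OF that])
  have jj: "\<Phi> \<psi> = j_map t X (j_inv t X \<Phi>) \<psi>" if "\<Phi> \<in> ?G" for \<Phi> \<psi>
    using j_map_j_inv[OF assms that] by simp
  have hit_open: "openin (topol (GC_obj t X)) {\<Phi> \<in> ?G. j_inv t X \<Phi> \<inter> U \<noteq> {}}"
    if U: "openin (topol X) U" "lower_set X U" for U
  proof (subst openin_subopen, intro ballI)
    fix \<Phi> assume "\<Phi> \<in> {\<Phi> \<in> ?G. j_inv t X \<Phi> \<inter> U \<noteq> {}}"
    then obtain x where \<Phi>: "\<Phi> \<in> ?G" and x: "x \<in> j_inv t X \<Phi>" "x \<in> U"
      by blast
    have xX: "x \<in> points X"
      using openin_subset[OF U(1)] x(2) by blast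
    have "points X - U \<in> closed_upper_sets X"
      using U upper_set_Compl[OF assms U(2)] by (auto simp: closed_upper_sets_def)
    then obtain \<psi> where \<psi>: "\<psi> \<in> elems (C_obj t X)" "j_map t X (points X - U) \<psi> < \<psi> x"
      using mem_iff_le_j_map[OF assms _ xX, of "points X - U" t] x(2) by (auto simp: not_le)
    \<comment> \<open>The closed upper set \<open>points X - U\<close> does not contain
      \<open>x\<close>, so some \<open>\<psi>\<close> exceeds at \<open>x\<close> its supremum
      \<open>?v\<close> over this set. If \<open>\<Psi> \<psi> > ?v\<close>, then the set belonging
      to \<open>\<Psi>\<close> has a point with \<open>\<psi> > ?v\<close>, and this point must lie
      in \<open>U\<close>.\<close>
    let ?v = "j_map t X (points X - U) \<psi>"
    have v: "\<psi> y \<le> ?v" if "y \<in> points X - U" for y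
      using le_j_map[OF \<open>points X - U \<in> closed_upper_sets X\<close> \<psi>(1) that] .
    have "0 \<le> ?v"
      using j_map_in_unit[OF \<open>points X - U \<in> closed_upper_sets X\<close> \<psi>(1)] by simp
    let ?O = "{\<Phi> \<in> ?G. ?v < \<Phi> \<psi>}"
    have "openin (topol (GC_obj t X)) ?O"
      using eval[OF \<psi>(1)] unfolding continuous_map_upper_lower_semicontinuous_lt by blast
    moreover have "\<Phi> \<in> ?O"
      using \<Phi> \<psi>(2) le_j_map[OF j_inv_in[OF assms \<Phi>] \<psi>(1) x(1)] jj[OF \<Phi>, of \<psi>] by simp
    moreover have "?O \<subseteq> {\<Phi> \<in> ?G. j_inv t X \<Phi> \<inter> U \<noteq> {}}"
    proof
      fix \<Psi> assume "\<Psi> \<in> ?O"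
      then have \<Psi>: "\<Psi> \<in> ?G" "?v < j_map t X (j_inv t X \<Psi>) \<psi>"
        using jj by auto
      then obtain y where "y \<in> j_inv t X \<Psi>" "?v < \<psi> y"
        using j_map_le_iff[OF j_inv_in[OF assms \<Psi>(1)] \<psi>(1) \<open>0 \<le> ?v\<close>] by (auto simp: not_le[symmetric])
      moreover have "y \<in> points X"
        using closed_upper_setsD(2)[OF j_inv_in[OF assms \<Psi>(1)]] calculation(1) by blast
      ultimately show "\<Psi> \<in> {\<Phi> \<in> ?G. j_inv t X \<Phi> \<inter> U \<noteq> {}}"
        using v[of y] \<Psi>(1) by force
    qed
    ultimately show "\<exists>T. openin (topol (GC_obj t X)) T \<and> \<Phi> \<in> T \<and> T \<subseteq> {\<Phi> \<in> ?G. j_inv t X \<Phi> \<inter> U \<noteq> {}}"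
      by blast
  qed
  have miss_open: "openin (topol (GC_obj t X)) {\<Phi> \<in> ?G. j_inv t X \<Phi> \<inter> K = {}}"
    if K: "closedin (topol X) K" "lower_set X K" for K
  proof (subst openin_subopen, intro ballI)
    fix \<Phi> assume "\<Phi> \<in> {\<Phi> \<in> ?G. j_inv t X \<Phi> \<inter> K = {}}"
    then have \<Phi>: "\<Phi> \<in> ?G" "j_inv t X \<Phi> \<inter> K = {}"
      by auto
    obtain \<psi> where "\<psi> \<in> poscomp_hom X (op_space unit_space)"
      and \<psi>01: "\<And>x. x \<in> K \<Longrightarrow> \<psi> x = 1" "\<And>x. x \<in> j_inv t X \<Phi> \<Longrightarrow> \<psi> x = 0"
      using ordered_Urysohn[OF assms j_inv_in[OF assms \<Phi>(1)] K \<Phi>(2)] by metis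
    then have \<psi>: "\<psi> \<in> elems (C_obj t X)"
      by (simp add: elems_C_obj)
    \<comment> \<open>\<open>\<psi>\<close> is \<open>1\<close> on \<open>K\<close>, so a set over
      which the supremum of \<open>\<psi>\<close> is below \<open>1\<close> misses \<open>K\<close>;
      for \<open>\<Phi>\<close> itself this supremum is \<open>0\<close>.\<close>
    let ?O = "{\<Phi> \<in> ?G. \<Phi> \<psi> < 1}"
    have "openin (topol (GC_obj t X)) ?O"
      using eval[OF \<psi>] unfolding continuous_map_upper_lower_semicontinuous_lt by blast
    moreover have "j_map t X (j_inv t X \<Phi>) \<psi> \<le> 0"
      using j_map_le_iff[OF j_inv_in[OF assms \<Phi>(1)] \<psi>, of 0] \<psi>01(2) by simp
    then have "\<Phi> \<in> ?O"
      using jj[OF \<Phi>(1), of \<psi>] \<Phi>(1) by simp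
    moreover have "?O \<subseteq> {\<Phi> \<in> ?G. j_inv t X \<Phi> \<inter> K = {}}"
    proof
      fix \<Psi> assume "\<Psi> \<in> ?O"
      then have \<Psi>: "\<Psi> \<in> ?G" "j_map t X (j_inv t X \<Psi>) \<psi> < 1"
        using jj by auto
      then have "\<psi> y < 1" if "y \<in> j_inv t X \<Psi>" for y
        using le_j_map[OF j_inv_in[OF assms \<Psi>(1)] \<psi> that] by simp
      then show "\<Psi> \<in> {\<Phi> \<in> ?G. j_inv t X \<Phi> \<inter> K = {}}"
        using \<Psi>(1) \<psi>01(1) by force
    qed
    ultimately show "\<exists>T. openin (topol (GC_obj t X)) T \<and> \<Phi> \<in> T \<and> T \<subseteq> {\<Phi> \<in> ?G. j_inv t X \<Phi> \<inter> K = {}}"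
      by blast
  qed
  have vimage: "j_inv t X -` {A \<in> ?S. Q A} \<inter> ?G = {\<Phi> \<in> ?G. Q (j_inv t X \<Phi>)}" for Q
    using j_inv_in[OF assms] by auto
  have "continuous_map (topol (GC_obj t X)) (topol (V_obj X)) (j_inv t X)"
    unfolding V_obj_def ordered_space.simps
  proof (rule continuous_on_generated_topo)
    show "j_inv t X ` ?G \<subseteq> \<Union>({{A \<in> ?S. A \<inter> U \<noteq> {}} |U. openin (topol X) U \<and> lower_set X U} \<union>
        {{A \<in> ?S. A \<inter> K = {}} |K. closedin (topol X) K \<and> lower_set X K})"
      using into points_V_obj[of X] by (simp add: V_obj_def) blast
    fix W
    assume "W \<in> {{A \<in> ?S. A \<inter> U \<noteq> {}} |U. openin (topol X) U \<and> lower_set X U} \<union>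
        {{A \<in> ?S. A \<inter> K = {}} |K. closedin (topol X) K \<and> lower_set X K}"
    then consider (hit) U where "W = {A \<in> ?S. A \<inter> U \<noteq> {}}" "openin (topol X) U" "lower_set X U"
      | (miss) K where "W = {A \<in> ?S. A \<inter> K = {}}" "closedin (topol X) K" "lower_set X K"
      by blast
    then show "openin (topol (GC_obj t X)) (j_inv t X -` W \<inter> ?G)"
    proof cases
      case (hit U)
      then show ?thesis
        using hit_open[of U] vimage[of "\<lambda>A. A \<inter> U \<noteq> {}"] by simp
    next
      case (miss K)
      then show ?thesis
        using miss_open[of K] vimage[of "\<lambda>A. A \<inter> K = {}"] by simp
    qed
  qed
  moreover have "(j_inv t X \<Phi>, j_inv t X \<Psi>) \<in> order_rel (V_obj X)" if "(\<Phi>, \<Psi>) \<in> order_rel (GC_obj t X)" for \<Phi> \<Psi>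
  proof -
    have G: "\<Phi> \<in> ?G" "\<Psi> \<in> ?G"
      using poscompD(2)[OF poscomp_GC_obj[OF assms]] that by auto
    show ?thesis
      using order_rel_GC_obj_j_map_iff[OF assms j_inv_in[OF assms G(1)] j_inv_in[OF assms G(2)]]
        j_map_j_inv[OF assms G(1)] j_map_j_inv[OF assms G(2)] that by simp
  qed
  ultimately show ?thesis
    using into by (auto simp: poscomp_hom_def)
qed

theorem j_map_iso:
  assumes "poscomp X"
  shows "poscomp_iso (V_obj X) (GC_obj t X) (j_map t X)"
  unfolding poscomp_iso_def
proof (intro conjI bexI[OF _ j_inv_in_poscomp_hom[OF assms]] j_map_in assms)
  show "compose (points (V_obj X)) (j_inv t X) (j_map t X) = id_map (points (V_obj X))"
    unfolding compose_def using j_inv_j_map[OF assms] by (intro restrict_ext) (simp add: points_V_obj)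
  show "compose (points (GC_obj t X)) (j_map t X) (j_inv t X) = id_map (points (GC_obj t X))"
    unfolding compose_def using j_map_j_inv[OF assms] by (intro restrict_ext) simp
qed

end

section \<open>The Vietoris monad\<close>

lemma j_map_extensional: "A \<in> closed_upper_sets X \<Longrightarrow> j_map t X A \<in> extensional (elems (C_obj t X))"
  by (simp add: j_map_def)

lemma j_map_eqI:
  assumes "A \<in> closed_upper_sets X" "\<psi> \<in> elems (C_obj t X)" "s \<in> {0..1}"
    and "\<And>v. v \<in> {0..1} \<Longrightarrow> (\<forall>x\<in>A. \<psi> x \<le> v) \<longleftrightarrow> s \<le> v"
  shows "j_map t X A \<psi> = s"
proof (rule eq_of_ge_iff_unit[OF j_map_in_unit[OF assms(1,2)] assms(3)])
  show "j_map t X A \<psi> \<le> v \<longleftrightarrow> s \<le> v" if "v \<in> {0..1}" for v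
    using j_map_le_iff[OF assms(1,2)] assms(4)[OF that] that by simp
qed

lemma V_unit_apply: "x \<in> points X \<Longrightarrow> V_unit X x = order_rel X `` {x}"
  by (auto simp: V_unit_def)

lemma V_unit_in_closed_upper_sets:
  assumes "poscomp X" "x \<in> points X"
  shows "order_rel X `` {x} \<in> closed_upper_sets X"
proof -
  have "closedin (topol X) {x}"
    using Hausdorff_imp_t1_space[OF poscomp_Hausdorff[OF assms(1)]] assms(2) by (simp add: t1_space_closedin_singleton)
  then have "closedin (topol X) (order_rel X `` {x})"
    by (rule closedin_up_closure[OF assms(1)])
  moreover have "upper_set X (order_rel X `` {x})"
    unfolding upper_set_def using poscompD(2)[OF assms(1)] poscompD(4)[OF assms(1)] by blast
  ultimately show ?thesis
    by (simp add: closed_upper_sets_def)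
qed

text \<open>\<open>\<psi>\<close> is order-reversing, so on the principal upper set of
  \<open>x\<close> it is largest at \<open>x\<close>.\<close>

lemma j_map_V_unit:
  assumes "poscomp X" "x \<in> points X" "\<psi> \<in> elems (C_obj t X)"
  shows "j_map t X (order_rel X `` {x}) \<psi> = \<psi> x"
proof (rule j_map_eqI[OF V_unit_in_closed_upper_sets[OF assms(1,2)] assms(3) elems_C_obj_in[OF assms(3,2)]])
  fix v
  show "(\<forall>y\<in>order_rel X `` {x}. \<psi> y \<le> v) \<longleftrightarrow> \<psi> x \<le> v"
    using poscompD(3)[OF assms(1,2)] elems_C_obj_antimono[OF assms(1,3)] by (blast intro: order_trans)
qed

section \<open>The Vietoris space and its structure maps, transported along \<open>j\<close>\<close>

context unit_tensor
begin

text \<open>The space is the image of the compact space \<open>GC_obj t X\<close> under the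
  continuous map \<open>j_inv t X\<close>. Its order is closed because inclusion of closed upper
  sets amounts to inequalities between the continuous functions
  \<open>\<lambda>A. j_map t X A \<psi>\<close>. The tensor serves the proof only.\<close>

lemma poscomp_V_obj:
  fixes X :: "'a ordered_space"
  assumes "poscomp X"
  shows "poscomp (V_obj X)"
proof (rule poscompI)
  let ?T = "topol (V_obj X)"
  have "j_inv t X ` points (GC_obj t X) = points (V_obj X)"
  proof (intro equalityI subsetI)
    fix A assume "A \<in> points (V_obj X)"
    then show "A \<in> j_inv t X ` points (GC_obj t X)"
      unfolding points_V_obj
      by (metis imageI j_inv_j_map[OF assms] j_map_in_points[OF assms])
  qed (use j_inv_in[OF assms] in \<open>auto simp: points_V_obj\<close>)
  moreover have "compactin ?T (j_inv t X ` points (GC_obj t X))"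
    using poscompD(1)[OF poscomp_GC_obj[OF assms]] poscomp_homD(2)[OF j_inv_in_poscomp_hom[OF assms]]
    by (intro image_compactin) (auto simp: compact_space_def)
  ultimately show "compact_space ?T"
    by (simp add: compact_space_def)
  let ?T2 = "prod_topology ?T ?T"
  have "order_rel (V_obj X) = {p \<in> topspace ?T2. \<forall>\<psi>. \<psi> \<in> elems (C_obj t X) \<longrightarrow> j_map t X (snd p) \<psi> \<le> j_map t X (fst p) \<psi>}"
  proof (rule set_eqI)
    fix p :: "'a set \<times> 'a set"
    obtain A B where p: "p = (A, B)"
      by (cases p)
    show "p \<in> order_rel (V_obj X) \<longleftrightarrow>
      p \<in> {p \<in> topspace ?T2. \<forall>\<psi>. \<psi> \<in> elems (C_obj t X) \<longrightarrow> j_map t X (snd p) \<psi> \<le> j_map t X (fst p) \<psi>}"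
      using j_map_mono_iff[OF assms, of A B t] unfolding p order_rel_V_obj by (auto simp: points_V_obj)
  qed
  moreover have "closedin ?T2 \<dots>"
  proof (intro closedin_Collect_all closedin_Collect_imp closedin_Collect_le)
    fix \<psi> assume "\<psi> \<in> elems (C_obj t X)"
    note c = continuous_map_j_map_eval[OF assms this]
    show "continuous_map ?T2 euclideanreal (\<lambda>p. j_map t X (snd p) \<psi>)"
      using continuous_map_compose[OF continuous_map_snd c] by (simp add: o_def)
    show "continuous_map ?T2 euclideanreal (\<lambda>p. j_map t X (fst p) \<psi>)"
      using continuous_map_compose[OF continuous_map_fst c] by (simp add: o_def)
  qed
  ultimately show "closedin ?T2 (order_rel (V_obj X))"
    by simp
  show "order_rel (V_obj X) \<subseteq> points (V_obj X) \<times> points (V_obj X)"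
    by (rule subrelI) (simp add: points_V_obj order_rel_V_obj)
qed (auto simp: points_V_obj order_rel_V_obj)

text \<open>As \<open>j\<close> has an inverse morphism, continuity and monotonicity into
  \<open>V_obj Y\<close> can be checked after composing with \<open>j\<close>, that is, on suprema.
  The structure maps of the Vietoris monad and the composition of distributors are treated in this
  way.\<close>

lemma V_valued_in_poscomp_hom:
  assumes "poscomp X" "poscomp Y" "h \<in> points X \<rightarrow>\<^sub>E closed_upper_sets Y"
    and "compose (points X) (j_map t Y) h \<in> poscomp_hom X (GC_obj t Y)"
  shows "h \<in> poscomp_hom X (V_obj Y)"
proof -
  have "compose (points X) (j_inv t Y) (compose (points X) (j_map t Y) h) = h"
  proof (rule extensionalityI[of _ "points X"])
    show "h \<in> extensional (points X)"
      using assms(3) by (simp add: PiE_iff)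
    show "compose (points X) (j_inv t Y) (compose (points X) (j_map t Y) h) x = h x" if "x \<in> points X" for x
      using j_inv_j_map[OF assms(2) PiE_mem[OF assms(3) that]] that by (simp add: compose_eq)
  qed simp
  then show ?thesis
    using compose_in_poscomp_hom[OF assms(1,4) j_inv_in_poscomp_hom[OF assms(2)]] by simp
qed

lemma GC_map_apply:
  assumes "\<Phi> \<in> points (GC_obj t X)" "\<psi> \<in> elems (C_obj t Y)"
  shows "GC_map t X Y f \<Phi> \<psi> = \<Phi> (compose (points X) \<psi> f)"
  using assms by (simp add: GC_map_def G_map_def GC_obj_def compose_eq C_map_def)

lemma GC_mult_apply:
  assumes "\<Xi> \<in> points (GC_obj t (GC_obj t X))" "\<psi> \<in> elems (C_obj t X)"
  shows "GC_mult t X \<Xi> \<psi> = \<Xi> (\<lambda>\<Phi>\<in>points (GC_obj t X). \<Phi> \<psi>)"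
  using assms by (simp add: GC_mult_def G_map_def GC_obj_def compose_eq CG_unit_def)

text \<open>The functional \<open>GC_map t X Y f (j_map t X A)\<close> belongs to a closed upper set
  \<open>B\<close> because \<open>j\<close> is surjective. This \<open>B\<close> is the least closed
  upper set containing the image of \<open>A\<close>, hence the intersection that defines
  \<open>V_map\<close>.\<close>

theorem j_map_V_map:
  assumes "poscomp X" "poscomp Y" "f \<in> poscomp_hom X Y" "A \<in> closed_upper_sets X"
  shows "V_map X Y f A \<in> closed_upper_sets Y"
    and "j_map t Y (V_map X Y f A) = GC_map t X Y f (j_map t X A)"
proof -
  let ?\<Phi> = "GC_map t X Y f (j_map t X A)"
  define B where "B = j_inv t Y ?\<Phi>"
  have jA: "j_map t X A \<in> points (GC_obj t X)"
    by (rule j_map_in_points[OF assms(1,4)])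
  have \<Phi>: "?\<Phi> \<in> points (GC_obj t Y)"
    by (rule PiE_mem[OF poscomp_homD(1)[OF GC_map_in[OF assms(1-3)]] jA])
  have B: "B \<in> closed_upper_sets Y" "j_map t Y B = ?\<Phi>"
    unfolding B_def by (rule j_inv_in[OF assms(2) \<Phi>], rule j_map_j_inv[OF assms(2) \<Phi>])
  have AX: "A \<subseteq> points X" "f ` A \<subseteq> points Y"
    using closed_upper_setsD(2)[OF assms(4)] poscomp_homD(1)[OF assms(3)] by blast+
  \<comment> \<open>Inclusion of closed upper sets is comparison of suprema, and by construction the
    supremum of \<open>\<psi>\<close> over \<open>B\<close> is that of
    \<open>\<psi> \<circ> f\<close> over \<open>A\<close>.\<close>
  have least: "B \<subseteq> B' \<longleftrightarrow> f ` A \<subseteq> B'" if B': "B' \<in> closed_upper_sets Y" for B'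
  proof -
    have "j_map t Y B \<psi> \<le> j_map t Y B' \<psi> \<longleftrightarrow> (\<forall>y\<in>f ` A. \<psi> y \<le> j_map t Y B' \<psi>)" if \<psi>: "\<psi> \<in> elems (C_obj t Y)" for \<psi>
    proof -
      have \<psi>f: "compose (points X) \<psi> f \<in> elems (C_obj t X)"
        using compose_in_poscomp_hom[OF assms(1,3)] \<psi> by (simp add: elems_C_obj)
      have "j_map t Y B \<psi> = j_map t X A (compose (points X) \<psi> f)"
        unfolding B(2) by (rule GC_map_apply[OF jA \<psi>])
      then have "j_map t Y B \<psi> \<le> j_map t Y B' \<psi> \<longleftrightarrow> (\<forall>x\<in>A. compose (points X) \<psi> f x \<le> j_map t Y B' \<psi>)"
        using j_map_le_iff[OF assms(4) \<psi>f] j_map_in_unit[OF B' \<psi>] by simp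
      also have "\<dots> \<longleftrightarrow> (\<forall>y\<in>f ` A. \<psi> y \<le> j_map t Y B' \<psi>)"
        using AX(1) by (auto simp: compose_eq subset_iff)
      finally show ?thesis .
    qed
    then show ?thesis
      using j_map_mono_iff[OF assms(2) B' B(1), of t] subset_iff_j_map[OF assms(2) AX(2) B', of t] by simp
  qed
  have "V_map X Y f A = \<Inter>{B' \<in> closed_upper_sets Y. f ` A \<subseteq> B'}"
    using assms(4) by (simp add: V_map_def)
  also have "\<dots> = B"
    using least B(1) by blast
  finally show "V_map X Y f A \<in> closed_upper_sets Y" "j_map t Y (V_map X Y f A) = ?\<Phi>"
    using B by simp_all
qed

theorem V_map_naturality:
  assumes "poscomp X" "poscomp Y" "f \<in> poscomp_hom X Y"
  shows "V_map X Y f \<in> poscomp_hom (V_obj X) (V_obj Y)"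
    and "compose (points (V_obj X)) (j_map t Y) (V_map X Y f) =
           compose (points (V_obj X)) (GC_map t X Y f) (j_map t X)"
proof -
  show eq: "compose (points (V_obj X)) (j_map t Y) (V_map X Y f) =
           compose (points (V_obj X)) (GC_map t X Y f) (j_map t X)"
    unfolding compose_def
    using j_map_V_map(2)[OF assms] by (intro restrict_ext) (simp add: points_V_obj)
  show "V_map X Y f \<in> poscomp_hom (V_obj X) (V_obj Y)"
  proof (rule V_valued_in_poscomp_hom[OF poscomp_V_obj[OF assms(1)] assms(2)])
    show "V_map X Y f \<in> points (V_obj X) \<rightarrow>\<^sub>E closed_upper_sets Y"
      using j_map_V_map(1)[OF assms] by (auto simp: points_V_obj V_map_def)
    show "compose (points (V_obj X)) (j_map t Y) (V_map X Y f) \<in> poscomp_hom (V_obj X) (GC_obj t Y)"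
      unfolding eq
      by (rule compose_in_poscomp_hom[OF poscomp_V_obj[OF assms(1)] j_map_in[OF assms(1)] GC_map_in[OF assms]])
  qed
qed

theorem V_unit_compat:
  assumes "poscomp X"
  shows "V_unit X \<in> poscomp_hom X (V_obj X)"
    and "compose (points X) (j_map t X) (V_unit X) = GC_unit t X"
proof -
  show eq: "compose (points X) (j_map t X) (V_unit X) = GC_unit t X"
    unfolding compose_def GC_unit_def
  proof (rule restrict_ext)
    fix x assume x: "x \<in> points X"
    show "j_map t X (V_unit X x) = (\<lambda>\<psi>\<in>elems (C_obj t X). \<psi> x)"
      unfolding V_unit_apply[OF x]
      by (rule extensionalityI[OF j_map_extensional[OF V_unit_in_closed_upper_sets[OF assms x]]])
        (simp_all add: j_map_V_unit[OF assms x])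
  qed
  show "V_unit X \<in> poscomp_hom X (V_obj X)"
  proof (rule V_valued_in_poscomp_hom[OF assms assms])
    show "V_unit X \<in> points X \<rightarrow>\<^sub>E closed_upper_sets X"
      using V_unit_in_closed_upper_sets[OF assms] by (intro PiE_I) (simp_all add: V_unit_apply, simp add: V_unit_def)
    show "compose (points X) (j_map t X) (V_unit X) \<in> poscomp_hom X (GC_obj t X)"
      unfolding eq by (rule GC_unit_in[OF assms])
  qed
qed

text \<open>\<open>\<A>\<close> is an upper set for reverse inclusion, so \<open>x\<close> lies in a
  member of \<open>\<A>\<close> iff the principal upper set of \<open>x\<close> belongs to
  \<open>\<A>\<close>. The union is thus the preimage of a closed set under the continuous
  unit.\<close>

lemma Union_in_closed_upper_sets:
  assumes "poscomp X" "\<A> \<in> closed_upper_sets (V_obj X)"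
  shows "\<Union>\<A> \<in> closed_upper_sets X"
proof -
  have \<A>: "A \<in> closed_upper_sets X" if "A \<in> \<A>" for A
    using closed_upper_setsD(2)[OF assms(2)] that by (auto simp: points_V_obj)
  have "\<Union>\<A> = {x \<in> points X. V_unit X x \<in> \<A>}"
  proof (intro equalityI subsetI)
    fix x assume "x \<in> \<Union>\<A>"
    then obtain A where A: "A \<in> \<A>" "x \<in> A"
      by blast
    have x: "x \<in> points X"
      using closed_upper_setsD(2)[OF \<A>[OF A(1)]] A(2) by blast
    have "order_rel X `` {x} \<subseteq> A"
      using closed_upper_setsD(3)[OF \<A>[OF A(1)]] A(2) by blast
    then have "(A, V_unit X x) \<in> order_rel (V_obj X)"
      unfolding order_rel_V_obj V_unit_apply[OF x]
      using \<A>[OF A(1)] V_unit_in_closed_upper_sets[OF assms(1) x] by blast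
    then show "x \<in> {x \<in> points X. V_unit X x \<in> \<A>}"
      using closed_upper_setsD(3)[OF assms(2)] A(1) x by blast
  next
    fix x assume "x \<in> {x \<in> points X. V_unit X x \<in> \<A>}"
    then show "x \<in> \<Union>\<A>"
      using poscompD(3)[OF assms(1), of x] V_unit_apply[of x X] by blast
  qed
  then have "closedin (topol X) (\<Union>\<A>)"
    using closedin_continuous_map_preimage[OF poscomp_homD(2)[OF V_unit_compat(1)[OF assms(1)]]
        closed_upper_setsD(1)[OF assms(2)]] by simp
  moreover have "upper_set X (\<Union>\<A>)"
    unfolding upper_set_def using closed_upper_setsD(2,3)[OF \<A>] by blast
  ultimately show ?thesis
    by (simp add: closed_upper_sets_def)
qed

theorem V_mult_compat:
  assumes "poscomp X"
  shows "V_mult X \<in> poscomp_hom (V_obj (V_obj X)) (V_obj X)"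
    and "compose (points (V_obj (V_obj X))) (j_map t X) (V_mult X) =
        compose (points (V_obj (V_obj X))) (GC_mult t X)
          (compose (points (V_obj (V_obj X)))
            (GC_map t (V_obj X) (GC_obj t X) (j_map t X)) (j_map t (V_obj X)))"
    (is "_ = ?R")
proof -
  let ?V = "V_obj X"
  note V = poscomp_V_obj[OF assms]
  note VV = poscomp_V_obj[OF V]
  note GC = poscomp_GC_obj[OF assms]
  show eq: "compose (points (V_obj ?V)) (j_map t X) (V_mult X) = ?R"
  proof (rule extensionalityI[of _ "points (V_obj ?V)"])
    fix \<A> assume \<A>': "\<A> \<in> points (V_obj ?V)"
    then have \<A>: "\<A> \<in> closed_upper_sets ?V"
      by (simp add: points_V_obj)
    note U = Union_in_closed_upper_sets[OF assms \<A>]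
    have \<A>X: "A \<in> closed_upper_sets X" if "A \<in> \<A>" for A
      using closed_upper_setsD(2)[OF \<A>] that by (auto simp: points_V_obj)
    note j\<A> = j_map_in_points[OF V \<A>]
    let ?\<Xi> = "GC_map t ?V (GC_obj t X) (j_map t X) (j_map t ?V \<A>)"
    have \<Xi>: "?\<Xi> \<in> points (GC_obj t (GC_obj t X))"
      by (rule PiE_mem[OF poscomp_homD(1)[OF GC_map_in[OF V GC j_map_in[OF assms]]] j\<A>])
    have "j_map t X (\<Union>\<A>) = GC_mult t X ?\<Xi>"
    proof (rule extensionalityI[OF j_map_extensional[OF U]])
      have "GC_mult t X ?\<Xi> \<in> points (GC_obj t X)"
        by (rule PiE_mem[OF poscomp_homD(1)[OF GC_mult_in[OF assms]] \<Xi>])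
      then show "GC_mult t X ?\<Xi> \<in> extensional (elems (C_obj t X))"
        by (auto simp: GC_obj_def points_G_obj laxmon_hom_def PiE_iff)
      fix \<psi> assume \<psi>: "\<psi> \<in> elems (C_obj t X)"
      let ?e = "\<lambda>\<Phi>\<in>points (GC_obj t X). \<Phi> \<psi>"
      have e: "?e \<in> elems (C_obj t (GC_obj t X))"
        unfolding GC_obj_def by (rule CG_unit_elem[OF laxmon_C_obj[OF assms] \<psi>])
      \<comment> \<open>This is the function \<open>A \<mapsto> j_map t X A \<psi>\<close> on
        \<open>V_obj X\<close>. Its supremum over \<open>\<A>\<close> is an iterated supremum of
        \<open>\<psi>\<close>, i.e. the supremum over the union.\<close>
      let ?ej = "compose (points ?V) ?e (j_map t X)"
      have ej: "?ej \<in> elems (C_obj t ?V)"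
        using compose_in_poscomp_hom[OF V j_map_in[OF assms]] e by (simp add: elems_C_obj)
      have "GC_mult t X ?\<Xi> \<psi> = j_map t ?V \<A> ?ej"
        using GC_mult_apply[OF \<Xi> \<psi>] GC_map_apply[OF j\<A> e] by simp
      moreover have "j_map t X (\<Union>\<A>) \<psi> = j_map t ?V \<A> ?ej"
      proof (rule j_map_eqI[OF U \<psi> j_map_in_unit[OF \<A> ej]])
        fix v :: real assume v: "v \<in> {0..1}"
        have "j_map t ?V \<A> ?ej \<le> v \<longleftrightarrow> (\<forall>A\<in>\<A>. ?ej A \<le> v)"
          using j_map_le_iff[OF \<A> ej] v by simp
        also have "\<dots> \<longleftrightarrow> (\<forall>A\<in>\<A>. \<forall>x\<in>A. \<psi> x \<le> v)"
        proof (intro ball_cong refl)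
          fix A assume "A \<in> \<A>"
          note A = \<A>X[OF this]
          have "?ej A = j_map t X A \<psi>"
            using A j_map_in_points[OF assms A] by (simp add: compose_eq points_V_obj)
          then show "?ej A \<le> v \<longleftrightarrow> (\<forall>x\<in>A. \<psi> x \<le> v)"
            using j_map_le_iff[OF A \<psi>] v by simp
        qed
        finally show "(\<forall>x\<in>\<Union>\<A>. \<psi> x \<le> v) \<longleftrightarrow> j_map t ?V \<A> ?ej \<le> v"
          by blast
      qed
      ultimately show "j_map t X (\<Union>\<A>) \<psi> = GC_mult t X ?\<Xi> \<psi>"
        by simp
    qed
    then show "compose (points (V_obj ?V)) (j_map t X) (V_mult X) \<A> = ?R \<A>"
      using \<A> \<A>' by (simp add: compose_eq V_mult_def)
  qed simp_all
  show "V_mult X \<in> poscomp_hom (V_obj ?V) ?V"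
  proof (rule V_valued_in_poscomp_hom[OF VV assms])
    show "V_mult X \<in> points (V_obj ?V) \<rightarrow>\<^sub>E closed_upper_sets X"
      using Union_in_closed_upper_sets[OF assms] by (auto simp: V_mult_def points_V_obj)
    show "compose (points (V_obj ?V)) (j_map t X) (V_mult X) \<in> poscomp_hom (V_obj ?V) (GC_obj t X)"
      unfolding eq
      using compose_in_poscomp_hom[OF VV
          compose_in_poscomp_hom[OF VV j_map_in[OF V] GC_map_in[OF V GC j_map_in[OF assms]]] GC_mult_in[OF assms]] .
  qed
qed

end

section \<open>Continuous distributors\<close>

lemma dist_homD:
  assumes "\<phi> \<in> dist_hom X Y"
  shows "\<phi> \<subseteq> points X \<times> points Y" "(\<lambda>x\<in>points X. \<phi> `` {x}) \<in> poscomp_hom X (V_obj Y)"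
    "x \<in> points X \<Longrightarrow> \<phi> `` {x} \<in> closed_upper_sets Y"
proof -
  show *: "\<phi> \<subseteq> points X \<times> points Y" "(\<lambda>x\<in>points X. \<phi> `` {x}) \<in> poscomp_hom X (V_obj Y)"
    using assms by (auto simp: dist_hom_def)
  show "\<phi> `` {x} \<in> closed_upper_sets Y" if "x \<in> points X"
    using PiE_mem[OF poscomp_homD(1)[OF *(2)] that] that by (simp add: points_V_obj)
qed

lemma C_dist_apply:
  assumes "x \<in> points X" "\<phi> `` {x} \<in> closed_upper_sets Y" "\<psi> \<in> elems (C_obj t Y)"
  shows "C_dist t X Y \<phi> \<psi> x = j_map t Y (\<phi> `` {x}) \<psi>"
proof -
  have "\<psi> ` (\<phi> `` {x}) = {\<psi> y |y. (x, y) \<in> \<phi>}"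
    by auto
  then show ?thesis
    using assms by (simp add: C_dist_def j_map_apply)
qed

lemma dist_hom_bij:
  "bij_betw (\<lambda>\<phi>. \<lambda>x\<in>points X. \<phi> `` {x}) (dist_hom X Y) (poscomp_hom X (V_obj Y))"
proof (rule bij_betw_byWitness[of _ "\<lambda>h. {(x, y). x \<in> points X \<and> y \<in> h x}"])
  show "\<forall>\<phi>\<in>dist_hom X Y. {(x, y). x \<in> points X \<and> y \<in> (\<lambda>x\<in>points X. \<phi> `` {x}) x} = \<phi>"
    using dist_homD(1)[of _ X Y] by fastforce
  have inv: "(\<lambda>x\<in>points X. {(x, y). x \<in> points X \<and> y \<in> h x} `` {x}) = h"
    if "h \<in> poscomp_hom X (V_obj Y)" for h
    using poscomp_homD(1)[OF that] by (intro extensionalityI[of _ "points X"]) (auto simp: PiE_iff)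
  then show "\<forall>h\<in>poscomp_hom X (V_obj Y). (\<lambda>x\<in>points X. {(x, y). x \<in> points X \<and> y \<in> h x} `` {x}) = h"
    by blast
  show "(\<lambda>\<phi>. \<lambda>x\<in>points X. \<phi> `` {x}) ` dist_hom X Y \<subseteq> poscomp_hom X (V_obj Y)"
    using dist_homD(2) by blast
  show "(\<lambda>h. {(x, y). x \<in> points X \<and> y \<in> h x}) ` poscomp_hom X (V_obj Y) \<subseteq> dist_hom X Y"
  proof (intro image_subsetI)
    fix h assume h: "h \<in> poscomp_hom X (V_obj Y)"
    have "h x \<subseteq> points Y" if "x \<in> points X" for x
      using PiE_mem[OF poscomp_homD(1)[OF h] that] closed_upper_setsD(2) by (simp add: points_V_obj)
    then show "{(x, y). x \<in> points X \<and> y \<in> h x} \<in> dist_hom X Y"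
      using h inv[OF h] unfolding dist_hom_def by auto
  qed
qed

section \<open>Full faithfulness, and from it functoriality, of \<open>C\<close> on
  distributors\<close>

context unit_tensor
begin

text \<open>Three bijections are chained: currying, composition with \<open>j_map t Y\<close>, and
  transposition. What remains is that the composite is given by suprema over the fibres of
  \<open>\<phi>\<close>.\<close>

theorem C_dist_bij:
  assumes "poscomp X" "poscomp Y"
  shows "bij_betw (C_dist t X Y) (dist_hom X Y) (laxmon_hom t (C_obj t Y) (C_obj t X))"
proof -
  have 1: "bij_betw (compose (points X) (j_map t Y)) (poscomp_hom X (V_obj Y)) (poscomp_hom X (GC_obj t Y))"
  proof (rule bij_betw_byWitness[of _ "compose (points X) (j_inv t Y)"])
    show "\<forall>h\<in>poscomp_hom X (V_obj Y). compose (points X) (j_inv t Y) (compose (points X) (j_map t Y) h) = h"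
    proof
      fix h assume "h \<in> poscomp_hom X (V_obj Y)"
      note h = poscomp_homD(1)[OF this]
      show "compose (points X) (j_inv t Y) (compose (points X) (j_map t Y) h) = h"
      proof (rule extensionalityI[of _ "points X"])
        show "compose (points X) (j_inv t Y) (compose (points X) (j_map t Y) h) x = h x" if "x \<in> points X" for x
          using PiE_mem[OF h that] j_inv_j_map[OF assms(2)] that by (simp add: compose_eq points_V_obj)
      qed (use h in \<open>auto simp: PiE_iff\<close>)
    qed
    show "\<forall>h\<in>poscomp_hom X (GC_obj t Y). compose (points X) (j_map t Y) (compose (points X) (j_inv t Y) h) = h"
    proof
      fix h assume "h \<in> poscomp_hom X (GC_obj t Y)"
      note h = poscomp_homD(1)[OF this]
      show "compose (points X) (j_map t Y) (compose (points X) (j_inv t Y) h) = h"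
      proof (rule extensionalityI[of _ "points X"])
        show "compose (points X) (j_map t Y) (compose (points X) (j_inv t Y) h) x = h x" if "x \<in> points X" for x
          using PiE_mem[OF h that] j_map_j_inv[OF assms(2)] that by (simp add: compose_eq)
      qed (use h in \<open>auto simp: PiE_iff\<close>)
    qed
    show "compose (points X) (j_map t Y) ` poscomp_hom X (V_obj Y) \<subseteq> poscomp_hom X (GC_obj t Y)"
      using compose_in_poscomp_hom[OF assms(1) _ j_map_in[OF assms(2)]] by blast
    show "compose (points X) (j_inv t Y) ` poscomp_hom X (GC_obj t Y) \<subseteq> poscomp_hom X (V_obj Y)"
      using compose_in_poscomp_hom[OF assms(1) _ j_inv_in_poscomp_hom[OF assms(2)]] by blast
  qed
  have "bij_betw (transpose_map X (C_obj t Y)) (poscomp_hom X (GC_obj t Y)) (laxmon_hom t (C_obj t Y) (C_obj t X))"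
    unfolding GC_obj_def by (rule transpose_map_bij[OF assms(1) laxmon_C_obj[OF assms(2)]])
  from bij_betw_trans[OF bij_betw_trans[OF dist_hom_bij 1] this]
  have "bij_betw (transpose_map X (C_obj t Y) \<circ> (compose (points X) (j_map t Y) \<circ> (\<lambda>\<phi>. \<lambda>x\<in>points X. \<phi> `` {x})))
    (dist_hom X Y) (laxmon_hom t (C_obj t Y) (C_obj t X))" .
  moreover have "(transpose_map X (C_obj t Y) \<circ> (compose (points X) (j_map t Y) \<circ> (\<lambda>\<phi>. \<lambda>x\<in>points X. \<phi> `` {x}))) \<phi> =
      C_dist t X Y \<phi>" if "\<phi> \<in> dist_hom X Y" for \<phi>
  proof -
    have "j_map t Y (\<phi> `` {x}) \<psi> = Sup (insert 0 {\<psi> y |y. (x, y) \<in> \<phi>})"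
      if "\<psi> \<in> elems (C_obj t Y)" "x \<in> points X" for \<psi> x
      using C_dist_apply[OF that(2) dist_homD(3)[OF \<open>\<phi> \<in> dist_hom X Y\<close> that(2)] that(1)] that
      by (simp add: C_dist_def)
    then show ?thesis
      unfolding transpose_map_def C_dist_def o_def by (intro restrict_ext) (simp add: compose_eq)
  qed
  ultimately show ?thesis
    using bij_betw_cong by blast
qed

lemma Image_in_closed_upper_sets:
  fixes Y :: "'b ordered_space" and Z :: "'c ordered_space"
  assumes "poscomp Y" "poscomp Z" "\<rho> \<in> dist_hom Y Z" "A \<in> closed_upper_sets Y"
  shows "\<rho> `` A \<in> closed_upper_sets Z"
proof -
  let ?T = "prod_topology (topol Y) (topol Z)"
  note \<rho> = dist_homD[OF assms(3)]
  have AY: "A \<subseteq> points Y"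
    by (rule closed_upper_setsD(2)[OF assms(4)])
  \<comment> \<open>The graph of \<open>\<rho>\<close> is closed, and images are projections along a compact factor.\<close>
  have "\<rho> = {p \<in> topspace ?T. \<forall>\<psi>. \<psi> \<in> elems (C_obj t Z) \<longrightarrow> \<psi> (snd p) \<le> C_dist t Y Z \<rho> \<psi> (fst p)}"
  proof (rule set_eqI)
    fix p :: "'b \<times> 'c"
    obtain y z where p: "p = (y, z)"
      by (cases p)
    have "(y, z) \<in> \<rho> \<longleftrightarrow> (\<forall>\<psi>\<in>elems (C_obj t Z). \<psi> z \<le> C_dist t Y Z \<rho> \<psi> y)" if yz: "y \<in> points Y" "z \<in> points Z"
      using mem_iff_le_j_map[OF assms(2) \<rho>(3)[OF yz(1)] yz(2), of t] C_dist_apply[OF yz(1) \<rho>(3)[OF yz(1)], of _ t]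
      by simp
    then show "p \<in> \<rho> \<longleftrightarrow> p \<in> {p \<in> topspace ?T. \<forall>\<psi>. \<psi> \<in> elems (C_obj t Z) \<longrightarrow> \<psi> (snd p) \<le> C_dist t Y Z \<rho> \<psi> (fst p)}"
      using \<rho>(1) unfolding p by auto
  qed
  moreover have "closedin ?T \<dots>"
  proof (intro closedin_Collect_all closedin_Collect_imp closedin_Collect_le)
    fix \<psi> assume \<psi>: "\<psi> \<in> elems (C_obj t Z)"
    \<comment> \<open>\<open>C_dist_bij\<close> is used for continuity here: it places
      \<open>C_dist t Y Z \<rho> \<psi>\<close> in \<open>C Y\<close>, so the conditions that define
      the graph are closed.\<close>
    have "C_dist t Y Z \<rho> \<in> laxmon_hom t (C_obj t Z) (C_obj t Y)"
      using C_dist_bij[OF assms(1,2)] assms(3) by (rule bij_betwE[THEN bspec])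
    then have "C_dist t Y Z \<rho> \<psi> \<in> elems (C_obj t Y)"
      using laxmon_homD(1) \<psi> by blast
    note c = elems_C_obj_continuous[OF assms(1) this]
    show "continuous_map ?T euclideanreal (\<lambda>p. C_dist t Y Z \<rho> \<psi> (fst p))"
      using continuous_map_compose[OF continuous_map_fst c] by (simp add: o_def)
    show "continuous_map ?T euclideanreal (\<lambda>p. \<psi> (snd p))"
      using continuous_map_compose[OF continuous_map_snd elems_C_obj_continuous[OF assms(2) \<psi>]] by (simp add: o_def)
  qed
  ultimately have "closedin ?T \<rho>"
    by simp
  then have "closedin ?T (\<rho> \<inter> A \<times> points Z)"
    using closed_upper_setsD(1)[OF assms(4)] by (intro closedin_Int) (simp_all add: closedin_prod_Times_iff)
  then have "closedin (topol Z) (snd ` (\<rho> \<inter> A \<times> points Z))"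
    using closed_map_snd[OF poscompD(1)[OF assms(1)], of "topol Z"] by (simp add: closed_map_def)
  also have "snd ` (\<rho> \<inter> A \<times> points Z) = \<rho> `` A"
    using \<rho>(1) by force
  finally have "closedin (topol Z) (\<rho> `` A)" .
  moreover have "upper_set Z (\<rho> `` A)"
    unfolding upper_set_def
  proof (intro conjI ballI; clarify)
    show "z \<in> points Z" if "(y, z) \<in> \<rho>" for y z
      using \<rho>(1) that by blast
    fix z z' y assume "(z, z') \<in> order_rel Z" "(y, z) \<in> \<rho>" "y \<in> A"
    then show "z' \<in> \<rho> `` A"
      using closed_upper_setsD(3)[OF \<rho>(3)[of y]] AY by blast
  qed
  ultimately show ?thesis
    by (simp add: closed_upper_sets_def)
qed

text \<open>A supremum over the composite relation is an iterated supremum. The local fact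
  \<open>eq\<close> comes first because it also yields continuity of the composite: after
  composition with \<open>j\<close>, its coordinate at \<open>\<psi>\<close> is
  \<open>C_dist t X Y \<phi> (C_dist t Y Z \<rho> \<psi>)\<close>, a function in
  \<open>C X\<close>.\<close>

theorem C_dist_comp:
  assumes "poscomp X" "poscomp Y" "poscomp Z" "\<phi> \<in> dist_hom X Y" "\<rho> \<in> dist_hom Y Z"
  shows "\<phi> O \<rho> \<in> dist_hom X Z"
    and "C_dist t X Z (\<phi> O \<rho>) = compose (elems (C_obj t Z)) (C_dist t X Y \<phi>) (C_dist t Y Z \<rho>)"
proof -
  note \<phi> = dist_homD[OF assms(4)] and \<rho> = dist_homD[OF assms(5)]
  have C\<phi>: "C_dist t X Y \<phi> \<psi> \<in> elems (C_obj t X)" if "\<psi> \<in> elems (C_obj t Y)" for \<psi>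
    using bij_betwE[OF C_dist_bij[OF assms(1,2)]] assms(4) laxmon_homD(1) that by blast
  have C\<rho>: "C_dist t Y Z \<rho> \<psi> \<in> elems (C_obj t Y)" if "\<psi> \<in> elems (C_obj t Z)" for \<psi>
    using bij_betwE[OF C_dist_bij[OF assms(2,3)]] assms(5) laxmon_homD(1) that by blast
  have im: "(\<phi> O \<rho>) `` {x} \<in> closed_upper_sets Z" if "x \<in> points X" for x
    using Image_in_closed_upper_sets[OF assms(2,3,5) \<phi>(3)[OF that]] by (simp add: relcomp_Image)
  have eq: "j_map t Z ((\<phi> O \<rho>) `` {x}) \<psi> = C_dist t X Y \<phi> (C_dist t Y Z \<rho> \<psi>) x"
    if x: "x \<in> points X" and \<psi>: "\<psi> \<in> elems (C_obj t Z)" for x \<psi>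
  proof (rule j_map_eqI[OF im[OF x] \<psi> elems_C_obj_in[OF C\<phi>[OF C\<rho>[OF \<psi>]] x]])
    fix v :: real assume v: "v \<in> {0..1}"
    have "C_dist t X Y \<phi> (C_dist t Y Z \<rho> \<psi>) x \<le> v \<longleftrightarrow> (\<forall>y\<in>\<phi> `` {x}. C_dist t Y Z \<rho> \<psi> y \<le> v)"
      using C_dist_apply[OF x \<phi>(3)[OF x] C\<rho>[OF \<psi>]] j_map_le_iff[OF \<phi>(3)[OF x] C\<rho>[OF \<psi>]] v by simp
    also have "\<dots> \<longleftrightarrow> (\<forall>y\<in>\<phi> `` {x}. \<forall>z\<in>\<rho> `` {y}. \<psi> z \<le> v)"
    proof (intro ball_cong refl)
      fix y assume "y \<in> \<phi> `` {x}"
      then have y: "y \<in> points Y"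
        using \<phi>(1) by blast
      show "C_dist t Y Z \<rho> \<psi> y \<le> v \<longleftrightarrow> (\<forall>z\<in>\<rho> `` {y}. \<psi> z \<le> v)"
        using C_dist_apply[OF y \<rho>(3)[OF y] \<psi>] j_map_le_iff[OF \<rho>(3)[OF y] \<psi>] v by simp
    qed
    finally show "(\<forall>z\<in>(\<phi> O \<rho>) `` {x}. \<psi> z \<le> v) \<longleftrightarrow> C_dist t X Y \<phi> (C_dist t Y Z \<rho> \<psi>) x \<le> v"
      by blast
  qed
  show "\<phi> O \<rho> \<in> dist_hom X Z"
  proof -
    have "(\<lambda>x\<in>points X. (\<phi> O \<rho>) `` {x}) \<in> poscomp_hom X (V_obj Z)"
    proof (rule V_valued_in_poscomp_hom[OF assms(1,3)])
      show "(\<lambda>x\<in>points X. (\<phi> O \<rho>) `` {x}) \<in> points X \<rightarrow>\<^sub>E closed_upper_sets Z"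
        using im by simp
      have "(\<lambda>x\<in>points X. compose (points X) (j_map t Z) (\<lambda>x\<in>points X. (\<phi> O \<rho>) `` {x}) x \<psi>) \<in> elems (C_obj t X)"
        if \<psi>: "\<psi> \<in> elems (C_obj t Z)" for \<psi>
      proof -
        have "(\<lambda>x\<in>points X. compose (points X) (j_map t Z) (\<lambda>x\<in>points X. (\<phi> O \<rho>) `` {x}) x \<psi>) =
            C_dist t X Y \<phi> (C_dist t Y Z \<rho> \<psi>)"
        proof (rule extensionalityI[of _ "points X"])
          show "C_dist t X Y \<phi> (C_dist t Y Z \<rho> \<psi>) \<in> extensional (points X)"
            using C\<phi>[OF C\<rho>[OF \<psi>]] by (simp add: elems_C_obj_iff[OF assms(1)])
        qed (simp_all add: compose_eq eq \<psi>)
        then show ?thesis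
          using C\<phi>[OF C\<rho>[OF \<psi>]] by simp
      qed
      moreover have "compose (points X) (j_map t Z) (\<lambda>x\<in>points X. (\<phi> O \<rho>) `` {x}) \<in> points X \<rightarrow>\<^sub>E points (G_obj t (C_obj t Z))"
        using j_map_in_points[OF assms(3) im] by (auto simp: compose_def GC_obj_def)
      ultimately show "compose (points X) (j_map t Z) (\<lambda>x\<in>points X. (\<phi> O \<rho>) `` {x}) \<in> poscomp_hom X (GC_obj t Z)"
        unfolding GC_obj_def poscomp_hom_G_obj_iff[OF assms(1)] by blast
    qed
    then show ?thesis
      using \<phi>(1) \<rho>(1) unfolding dist_hom_def by blast
  qed
  show "C_dist t X Z (\<phi> O \<rho>) = compose (elems (C_obj t Z)) (C_dist t X Y \<phi>) (C_dist t Y Z \<rho>)"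
  proof (rule extensionalityI[of _ "elems (C_obj t Z)"])
    fix \<psi> assume \<psi>: "\<psi> \<in> elems (C_obj t Z)"
    have "C_dist t X Z (\<phi> O \<rho>) \<psi> = C_dist t X Y \<phi> (C_dist t Y Z \<rho> \<psi>)"
    proof (rule extensionalityI[of _ "points X"])
      show "C_dist t X Z (\<phi> O \<rho>) \<psi> \<in> extensional (points X)"
        using \<psi> by (simp add: C_dist_def)
      show "C_dist t X Y \<phi> (C_dist t Y Z \<rho> \<psi>) \<in> extensional (points X)"
        using C\<phi>[OF C\<rho>[OF \<psi>]] by (simp add: elems_C_obj_iff[OF assms(1)])
      show "C_dist t X Z (\<phi> O \<rho>) \<psi> x = C_dist t X Y \<phi> (C_dist t Y Z \<rho> \<psi>) x" if "x \<in> points X" for x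
        using C_dist_apply[OF that im[OF that] \<psi>] eq[OF that \<psi>] by simp
    qed
    then show "C_dist t X Z (\<phi> O \<rho>) \<psi> = compose (elems (C_obj t Z)) (C_dist t X Y \<phi>) (C_dist t Y Z \<rho>) \<psi>"
      using \<psi> by (simp add: compose_eq)
  qed (simp_all add: C_dist_def)
qed

text \<open>The identity distributor curries to the unit of the Vietoris monad, so
  \<open>j_map_V_unit\<close> computes its image under \<open>C\<close>.\<close>

theorem C_dist_id:
  assumes "poscomp X"
  shows "order_rel X \<in> dist_hom X X"
    and "C_dist t X X (order_rel X) = id_map (elems (C_obj t X))"
proof -
  have "(\<lambda>x\<in>points X. order_rel X `` {x}) = V_unit X"
    unfolding V_unit_def by (intro restrict_ext) auto
  then show "order_rel X \<in> dist_hom X X"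
    using V_unit_compat(1)[OF assms] poscompD(2)[OF assms] by (simp add: dist_hom_def)
  show "C_dist t X X (order_rel X) = id_map (elems (C_obj t X))"
  proof (rule extensionalityI[of _ "elems (C_obj t X)"])
    fix \<psi> assume \<psi>: "\<psi> \<in> elems (C_obj t X)"
    have "C_dist t X X (order_rel X) \<psi> = \<psi>"
    proof (rule extensionalityI[of _ "points X"])
      show "C_dist t X X (order_rel X) \<psi> \<in> extensional (points X)"
        using \<psi> by (simp add: C_dist_def)
      show "\<psi> \<in> extensional (points X)"
        using \<psi> by (simp add: elems_C_obj_iff[OF assms])
      show "C_dist t X X (order_rel X) \<psi> x = \<psi> x" if "x \<in> points X" for x
        using C_dist_apply[OF that V_unit_in_closed_upper_sets[OF assms that] \<psi>] j_map_V_unit[OF assms that \<psi>]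
        by simp
    qed
    then show "C_dist t X X (order_rel X) \<psi> = id_map (elems (C_obj t X)) \<psi>"
      using \<psi> by simp
  qed (simp_all add: C_dist_def)
qed

end


theorem theorem6p14:
  fixes t :: tensor
    and X :: "'a ordered_space" and Y :: "'b ordered_space" and Z :: "'c ordered_space"
  assumes "t = mult_tensor \<or> t = lukasiewicz_tensor"
    and "poscomp X" and "poscomp Y" and "poscomp Z"
  shows
    \<comment> \<open>\<open>C\<close> and \<open>G\<close> form the adjunction induced by the dualising object\<close>
    "(laxmon t (C_obj t X) \<and>
      (\<forall>f\<in>poscomp_hom X Y. C_map t X Y f \<in> laxmon_hom t (C_obj t Y) (C_obj t X)) \<and>
      (\<forall>A :: 'm enriched_monoid. laxmon t A \<longrightarrow>
         poscomp (G_obj t A) \<and>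
         bij_betw (transpose_map X A) (poscomp_hom X (G_obj t A)) (laxmon_hom t A (C_obj t X))) \<and>
      (\<forall>(A :: 'm enriched_monoid) (B :: 'n enriched_monoid) k.
         laxmon t A \<and> laxmon t B \<and> k \<in> laxmon_hom t A B \<longrightarrow>
         G_map t A B k \<in> poscomp_hom (G_obj t B) (G_obj t A)))
     \<and>
     \<comment> \<open>\<open>j\<close> is a monad morphism all of whose components are isomorphisms\<close>
     (poscomp (V_obj X) \<and> poscomp (GC_obj t X) \<and>
      (\<forall>f\<in>poscomp_hom X Y.
         V_map X Y f \<in> poscomp_hom (V_obj X) (V_obj Y) \<and>
         compose (points (V_obj X)) (j_map t Y) (V_map X Y f) =
           compose (points (V_obj X)) (GC_map t X Y f) (j_map t X)) \<and>
      V_unit X \<in> poscomp_hom X (V_obj X) \<and>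
      compose (points X) (j_map t X) (V_unit X) = GC_unit t X \<and>
      V_mult X \<in> poscomp_hom (V_obj (V_obj X)) (V_obj X) \<and>
      compose (points (V_obj (V_obj X))) (j_map t X) (V_mult X) =
        compose (points (V_obj (V_obj X))) (GC_mult t X)
          (compose (points (V_obj (V_obj X)))
            (GC_map t (V_obj X) (GC_obj t X) (j_map t X)) (j_map t (V_obj X))) \<and>
      poscomp_iso (V_obj X) (GC_obj t X) (j_map t X))
     \<and>
     \<comment> \<open>\<open>C\<close> is a functor on continuous distributors\<close>
     (order_rel X \<in> dist_hom X X \<and>
      C_dist t X X (order_rel X) = id_map (elems (C_obj t X)) \<and>
      (\<forall>\<phi>\<in>dist_hom X Y. \<forall>\<rho>\<in>dist_hom Y Z.
         \<phi> O \<rho> \<in> dist_hom X Z \<and>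
         C_dist t X Z (\<phi> O \<rho>) =
           compose (elems (C_obj t Z)) (C_dist t X Y \<phi>) (C_dist t Y Z \<rho>)))
     \<and>
     \<comment> \<open>\<open>C\<close> is fully faithful\<close>
     bij_betw (C_dist t X Y) (dist_hom X Y) (laxmon_hom t (C_obj t Y) (C_obj t X))"
proof -
  \<comment> \<open>The choice of the tensor enters here only; all the rest holds for every instance
    of the locale.\<close>
  have "unit_tensor t"
    using assms(1) unit_tensor_mult unit_tensor_lukasiewicz by blast
  then interpret unit_tensor t .
  note X = assms(2) and Y = assms(3) and Z = assms(4)
  show ?thesis
  proof (intro conjI ballI allI impI; (elim conjE)?)
    show "laxmon t (C_obj t X)"
      by (rule laxmon_C_obj[OF X])
    show "C_map t X Y f \<in> laxmon_hom t (C_obj t Y) (C_obj t X)" if "f \<in> poscomp_hom X Y" for f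
      by (rule C_map_in[OF X Y that])
    show "poscomp (G_obj t A)" if "laxmon t A" for A :: "'m enriched_monoid"
      by (rule poscomp_G_obj[OF that])
    show "bij_betw (transpose_map X A) (poscomp_hom X (G_obj t A)) (laxmon_hom t A (C_obj t X))"
      if "laxmon t A" for A :: "'m enriched_monoid"
      by (rule transpose_map_bij[OF X that])
    show "G_map t A B k \<in> poscomp_hom (G_obj t B) (G_obj t A)"
      if "laxmon t A" "laxmon t B" "k \<in> laxmon_hom t A B"
      for A :: "'m enriched_monoid" and B :: "'n enriched_monoid" and k
      by (rule G_map_in[OF that])
    show "\<phi> O \<rho> \<in> dist_hom X Z"
      and "C_dist t X Z (\<phi> O \<rho>) = compose (elems (C_obj t Z)) (C_dist t X Y \<phi>) (C_dist t Y Z \<rho>)"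
      if "\<phi> \<in> dist_hom X Y" "\<rho> \<in> dist_hom Y Z" for \<phi> \<rho>
      by (rule C_dist_comp[OF X Y Z that])+
  qed (fact poscomp_V_obj[OF X] poscomp_GC_obj[OF X] V_unit_compat[OF X] V_mult_compat[OF X] j_map_iso[OF X]
      C_dist_id[OF X] C_dist_bij[OF X Y] V_map_naturality[OF X Y])+
qed

end
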